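(* Let $X$ be a spectrally positive Lévy process (with $X_0=0$) whose sample paths have unbounded variation, let $\gamma>0$, and let $(z_n,n\ge 1)$ be a sequence of non-negative real numbers converging to a point $z$. Let $(Z,C)$ denote the unique solution to $$Z_t=z+X_{C_t}+\gamma\int_0^t \mathrm{I}(Z_s=0)\,ds,\qquad C_t=\int_0^t \mathrm{I}(Z_s>0)\,ds,\qquad t\ge 0.$$ Consider a sequence $(X^n,n\ge 1)$ of processes with càdlàg paths such that each $X^n$ is the piecewise constant extension of some discrete-time process defined on $\mathbb{N}/n$ and starts at $0$. Suppose that $X^n\to X$ in the Skorohod topology, either weakly or almost surely. Let $C^n$ and $Z^n$ be the processes defined by $C^n(0)=C^n(0-)=0$, $$C^n(t)=C^n\big((\lfloor nt\rfloor/n)-\big)+\big(t-\lfloor nt\rfloor/n\big)\,\mathrm{I}(Z^n(t)>0)$$ and $$Z^n(t)=(z_n+X^n-\gamma\,\mathrm{Id})\big(C^n(\lfloor nt\rfloor/n)\big)+\gamma\lfloor nt\rfloor/n .$$ Then $C^n\to C$ uniformly on compact sets and $Z^n\to Z$ in the Skorohod topology. The type of convergence is weak or almost sure, according to the type of convergence of $(X^n,n\ge 1)$.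
   Context: A spectrally positive Lévy process is a real-valued Lévy process with càdlàg paths and no negative jumps. "Unbounded variation" means that the sample paths have unbounded variation on any (non-degenerate) interval. Under this assumption the displayed equation for $(Z,C)$ has a unique solution for every $\gamma>0$, $z\ge 0$. $\mathrm{I}$ denotes the indicator function and $\mathrm{Id}$ the identity function, so $(z_n+X^n-\gamma\,\mathrm{Id})(u)=z_n+X^n(u)-\gamma u$. $C^n(s-)$ denotes the left limit of $C^n$ at $s$. The piecewise constant extension of a process $(Y_{k/n},k\in\mathbb{N})$ (with $0\in\mathbb{N}$) is $t\mapsto Y_{\lfloor nt\rfloor/n}$. The Skorohod topology is the $J_1$ topology on càdlàg functions on $[0,\infty)$. *)

theory Defs
  imports "HOL-Probability.Probability"
begin

text \<open>Time is the half-line \<open>[0, \<infinity>)\<close>; a path is a function \<^typ>\<open>real \<Rightarrow> real\<close> whose values at negative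
  arguments are irrelevant. Both path topologies below ignore these values, so paths that agree on
  \<open>[0, \<infinity>)\<close> are topologically indistinguishable.\<close>

definition cadlag :: "(real \<Rightarrow> real) \<Rightarrow> bool" where
  "cadlag x \<longleftrightarrow>
     (\<forall>t\<ge>0. (x \<longlongrightarrow> x t) (at_right t)) \<and> (\<forall>t>0. \<exists>l. (x \<longlongrightarrow> l) (at_left t))"

definition left_lim :: "(real \<Rightarrow> real) \<Rightarrow> real \<Rightarrow> real" where
  "left_lim x t = Lim (at_left t) x"

definition time_change :: "(real \<Rightarrow> real) \<Rightarrow> bool" where
  "time_change \<theta> \<longleftrightarrow> bij_betw \<theta> {0..} {0..} \<and> strict_mono_on {0..} \<theta>"

text \<open>The sets \<open>skorohod_nbhd x T \<epsilon>\<close> form a neighbourhood base at \<open>x\<close> of the \<open>J\<^sub>1\<close> topology on \<open>[0, \<infinity>)\<close>: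
  \<open>y\<^sub>n \<rightarrow> x\<close> iff there are time changes \<open>\<theta>\<^sub>n\<close> with \<open>sup\<^sub>t \<bar>\<theta>\<^sub>n t - t\<bar> \<rightarrow> 0\<close> and
  \<open>sup\<^bsub>t \<le> T\<^esub> \<bar>y\<^sub>n (\<theta>\<^sub>n t) - x t\<bar> \<rightarrow> 0\<close> for every \<open>T\<close>.\<close>

definition skorohod_nbhd :: "(real \<Rightarrow> real) \<Rightarrow> real \<Rightarrow> real \<Rightarrow> (real \<Rightarrow> real) set" where
  "skorohod_nbhd x T \<epsilon> = {y. cadlag y \<and> (\<exists>\<theta>. time_change \<theta> \<and>
     (\<forall>t\<ge>0. \<bar>\<theta> t - t\<bar> < \<epsilon>) \<and> (\<forall>t\<in>{0..T}. \<bar>y (\<theta> t) - x t\<bar> < \<epsilon>))}"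

definition skorohod_topology :: "(real \<Rightarrow> real) topology" where
  "skorohod_topology = topology (\<lambda>U. U \<subseteq> Collect cadlag \<and>
     (\<forall>x\<in>U. \<exists>T. \<exists>\<epsilon>>0. skorohod_nbhd x T \<epsilon> \<subseteq> U))"

text \<open>Continuous paths with uniform convergence on compact sets.\<close>

definition ucc_nbhd :: "(real \<Rightarrow> real) \<Rightarrow> real \<Rightarrow> real \<Rightarrow> (real \<Rightarrow> real) set" where
  "ucc_nbhd x T \<epsilon> = {y. continuous_on {0..} y \<and> (\<forall>t\<in>{0..T}. \<bar>y t - x t\<bar> < \<epsilon>)}"

definition ucc_topology :: "(real \<Rightarrow> real) topology" where
  "ucc_topology = topology (\<lambda>U. U \<subseteq> Collect (continuous_on {0..}) \<and>
     (\<forall>x\<in>U. \<exists>T. \<exists>\<epsilon>>0. ucc_nbhd x T \<epsilon> \<subseteq> U))"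

text \<open>Convergence in law of processes with paths in a topological space; the processes may live on
  different probability spaces.\<close>

definition weakly_converges ::
  "(real \<Rightarrow> real) topology \<Rightarrow> (nat \<Rightarrow> 'b measure) \<Rightarrow> (nat \<Rightarrow> real \<Rightarrow> 'b \<Rightarrow> real) \<Rightarrow>
     'a measure \<Rightarrow> (real \<Rightarrow> 'a \<Rightarrow> real) \<Rightarrow> bool" where
  "weakly_converges T N Xn M X \<longleftrightarrow>
     (\<forall>f. continuous_map T euclideanreal f \<and> bounded (f ` topspace T) \<longrightarrow>
        (\<lambda>n. \<integral>\<omega>. f (\<lambda>t. Xn n t \<omega>) \<partial>N n) \<longlonglongrightarrow> (\<integral>\<omega>. f (\<lambda>t. X t \<omega>) \<partial>M))"

definition process :: "'a measure \<Rightarrow> (real \<Rightarrow> 'a \<Rightarrow> real) \<Rightarrow> bool" where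
  "process M X \<longleftrightarrow> (\<forall>t\<ge>0. X t \<in> borel_measurable M)"

definition cadlag_process :: "'a measure \<Rightarrow> (real \<Rightarrow> 'a \<Rightarrow> real) \<Rightarrow> bool" where
  "cadlag_process M X \<longleftrightarrow> process M X \<and> (\<forall>\<omega>\<in>space M. cadlag (\<lambda>t. X t \<omega>))"

definition levy_process :: "'a measure \<Rightarrow> (real \<Rightarrow> 'a \<Rightarrow> real) \<Rightarrow> bool" where
  "levy_process M X \<longleftrightarrow> prob_space M \<and> cadlag_process M X \<and> (AE \<omega> in M. X 0 \<omega> = 0) \<and>
     (\<forall>(\<tau>::nat \<Rightarrow> real) k. 0 \<le> \<tau> 0 \<and> (\<forall>i<k. \<tau> i \<le> \<tau> (Suc i)) \<longrightarrow>
        prob_space.indep_vars M (\<lambda>_. borel) (\<lambda>i \<omega>. X (\<tau> (Suc i)) \<omega> - X (\<tau> i) \<omega>) {..<k}) \<and>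
     (\<forall>s\<ge>0. \<forall>h\<ge>0. distr M borel (\<lambda>\<omega>. X (s + h) \<omega> - X s \<omega>) = distr M borel (\<lambda>\<omega>. X h \<omega> - X 0 \<omega>))"

definition spectrally_positive_levy :: "'a measure \<Rightarrow> (real \<Rightarrow> 'a \<Rightarrow> real) \<Rightarrow> bool" where
  "spectrally_positive_levy M X \<longleftrightarrow> levy_process M X \<and>
     (AE \<omega> in M. \<forall>t>0. left_lim (\<lambda>s. X s \<omega>) t \<le> X t \<omega>)"

definition bounded_variation_on_interval :: "(real \<Rightarrow> real) \<Rightarrow> real \<Rightarrow> real \<Rightarrow> bool" where
  "bounded_variation_on_interval x a b \<longleftrightarrow> (\<exists>B. \<forall>(\<tau>::nat \<Rightarrow> real) k.
     (\<forall>i\<le>k. \<tau> i \<in> {a..b}) \<and> (\<forall>i<k. \<tau> i \<le> \<tau> (Suc i)) \<longrightarrow>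
       (\<Sum>i<k. \<bar>x (\<tau> (Suc i)) - x (\<tau> i)\<bar>) \<le> B)"

definition unbounded_variation_paths :: "'a measure \<Rightarrow> (real \<Rightarrow> 'a \<Rightarrow> real) \<Rightarrow> bool" where
  "unbounded_variation_paths M X \<longleftrightarrow>
     (AE \<omega> in M. \<forall>a\<ge>0. \<forall>b>a. \<not> bounded_variation_on_interval (\<lambda>t. X t \<omega>) a b)"

definition sticky_solution ::
  "'a measure \<Rightarrow> (real \<Rightarrow> 'a \<Rightarrow> real) \<Rightarrow> real \<Rightarrow> real \<Rightarrow>
     (real \<Rightarrow> 'a \<Rightarrow> real) \<Rightarrow> (real \<Rightarrow> 'a \<Rightarrow> real) \<Rightarrow> bool" where
  "sticky_solution M X \<gamma> z Z C \<longleftrightarrow> cadlag_process M Z \<and>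
     process M C \<and> (\<forall>\<omega>\<in>space M. continuous_on {0..} (\<lambda>t. C t \<omega>)) \<and>
     (AE \<omega> in M. \<forall>t\<ge>0.
        Z t \<omega> = z + X (C t \<omega>) \<omega> + \<gamma> * (LBINT s:{0..t}. indicat_real {0} (Z s \<omega>)) \<and>
        C t \<omega> = (LBINT s:{0..t}. indicat_real {0<..} (Z s \<omega>)))"

definition grid_floor :: "nat \<Rightarrow> real \<Rightarrow> real" where
  "grid_floor n t = real_of_int \<lfloor>real n * t\<rfloor> / real n"

text \<open>Only the values \<open>Y (k / n)\<close> with \<open>k\<close> a natural number matter.\<close>

definition piecewise_constant_extension ::
  "'b measure \<Rightarrow> nat \<Rightarrow> (real \<Rightarrow> 'b \<Rightarrow> real) \<Rightarrow> (real \<Rightarrow> 'b \<Rightarrow> real) \<Rightarrow> bool" where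
  "piecewise_constant_extension N n Y X \<longleftrightarrow>
     (\<forall>k::nat. Y (real k / real n) \<in> borel_measurable N) \<and>
     (\<forall>\<omega>\<in>space N. \<forall>t\<ge>0. X t \<omega> = Y (grid_floor n t) \<omega>)"

text \<open>The path equations of the discretization, with driving path \<open>x\<close>. The conditional encodes the
  convention \<open>c (0-) = 0\<close>. For \<open>n \<ge> 1\<close> the equations determine \<open>c\<close> and \<open>w\<close> uniquely on \<open>[0, \<infinity>)\<close>,
  successively on the intervals \<open>[k / n, (k + 1) / n)\<close>.\<close>

definition discretized_paths ::
  "nat \<Rightarrow> real \<Rightarrow> real \<Rightarrow> (real \<Rightarrow> real) \<Rightarrow> (real \<Rightarrow> real) \<Rightarrow> (real \<Rightarrow> real) \<Rightarrow> bool" where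
  "discretized_paths n \<gamma> z x c w \<longleftrightarrow> c 0 = 0 \<and>
     (\<forall>t\<ge>0. c t = (if grid_floor n t = 0 then 0 else left_lim c (grid_floor n t)) +
                   (t - grid_floor n t) * indicat_real {0<..} (w t)) \<and>
     (\<forall>t\<ge>0. w t = (z + x (c (grid_floor n t)) - \<gamma> * c (grid_floor n t)) + \<gamma> * grid_floor n t)"

definition discrete_approximation ::
  "'b measure \<Rightarrow> nat \<Rightarrow> real \<Rightarrow> real \<Rightarrow> (real \<Rightarrow> 'b \<Rightarrow> real) \<Rightarrow>
     (real \<Rightarrow> 'b \<Rightarrow> real) \<Rightarrow> (real \<Rightarrow> 'b \<Rightarrow> real) \<Rightarrow> bool" where
  "discrete_approximation N n \<gamma> z X C Z \<longleftrightarrow> prob_space N \<and> cadlag_process N X \<and>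
     (\<exists>Y. piecewise_constant_extension N n Y X) \<and> (AE \<omega> in N. X 0 \<omega> = 0) \<and>
     (\<forall>\<omega>\<in>space N. discretized_paths n \<gamma> z (\<lambda>t. X t \<omega>) (\<lambda>t. C t \<omega>) (\<lambda>t. Z t \<omega>))"


lemma skorohod_nbhd_mono:
  assumes "T' \<le> T" "\<epsilon> \<le> \<epsilon>'"
  shows "skorohod_nbhd x T \<epsilon> \<subseteq> skorohod_nbhd x T' \<epsilon>'"
proof
  fix y assume "y \<in> skorohod_nbhd x T \<epsilon>"
  then obtain l where "cadlag y" "time_change l" "\<And>t. t \<ge> 0 \<Longrightarrow> \<bar>l t - t\<bar> < \<epsilon>"
    "\<And>t. t \<in> {0..T} \<Longrightarrow> \<bar>y (l t) - x t\<bar> < \<epsilon>" unfolding skorohod_nbhd_def by blast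
  with assms have "cadlag y \<and> time_change l \<and> (\<forall>t\<ge>0. \<bar>l t - t\<bar> < \<epsilon>') \<and> (\<forall>t\<in>{0..T'}. \<bar>y (l t) - x t\<bar> < \<epsilon>')"
    by (smt (verit) atLeastAtMost_iff)
  then show "y \<in> skorohod_nbhd x T' \<epsilon>'" unfolding skorohod_nbhd_def by blast
qed

lemma ucc_nbhd_mono:
  assumes "T' \<le> T" "\<epsilon> \<le> \<epsilon>'"
  shows "ucc_nbhd x T \<epsilon> \<subseteq> ucc_nbhd x T' \<epsilon>'"
proof
  fix y assume y: "y \<in> ucc_nbhd x T \<epsilon>"
  have "\<bar>y t - x t\<bar> < \<epsilon>'" if "t \<in> {0..T'}" for t
  proof -
    have "t \<in> {0..T}" using that assms(1) by simp
    then have "\<bar>y t - x t\<bar> < \<epsilon>" using y unfolding ucc_nbhd_def by blast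
    then show ?thesis using assms(2) by linarith
  qed
  then show "y \<in> ucc_nbhd x T' \<epsilon>'" using y unfolding ucc_nbhd_def by blast
qed

lemma istopology_nbhds:
  fixes N :: "'a \<Rightarrow> real \<Rightarrow> real \<Rightarrow> 'a set"
  assumes mono: "\<And>x T T' e e'. T' \<le> T \<Longrightarrow> e \<le> e' \<Longrightarrow> N x T e \<subseteq> N x T' e'"
  shows "istopology (\<lambda>U. U \<subseteq> D \<and> (\<forall>x\<in>U. \<exists>T. \<exists>e>0. N x T e \<subseteq> U))"
  unfolding istopology_def
proof (intro conjI allI impI ballI)
  fix U V x
  assume U: "U \<subseteq> D \<and> (\<forall>x\<in>U. \<exists>T. \<exists>e>0. N x T e \<subseteq> U)"
    and V: "V \<subseteq> D \<and> (\<forall>x\<in>V. \<exists>T. \<exists>e>0. N x T e \<subseteq> V)"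
  show "U \<inter> V \<subseteq> D" using U by blast
  assume x: "x \<in> U \<inter> V"
  obtain T e where 1: "e > 0" "N x T e \<subseteq> U" using U x by blast
  obtain T' e' where 2: "e' > 0" "N x T' e' \<subseteq> V" using V x by blast
  have "N x (max T T') (min e e') \<subseteq> U \<inter> V"
    using 1(2) 2(2) mono[of T "max T T'" "min e e'" e x] mono[of T' "max T T'" "min e e'" e' x]
    by auto
  then show "\<exists>T. \<exists>e>0. N x T e \<subseteq> U \<inter> V" using 1(1) 2(1) by (meson min_less_iff_conj)
next
  fix K :: "'a set set"
  assume K: "\<forall>U\<in>K. U \<subseteq> D \<and> (\<forall>x\<in>U. \<exists>T. \<exists>e>0. N x T e \<subseteq> U)"
  then show "\<Union>K \<subseteq> D" by blast
  fix x assume "x \<in> \<Union>K"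
  then obtain U where "U \<in> K" "x \<in> U" by blast
  with K show "\<exists>T. \<exists>e>0. N x T e \<subseteq> \<Union>K" by (meson Union_upper order_trans)
qed

lemma openin_skorohod:
  "openin skorohod_topology U \<longleftrightarrow>
     U \<subseteq> Collect cadlag \<and> (\<forall>x\<in>U. \<exists>T. \<exists>\<epsilon>>0. skorohod_nbhd x T \<epsilon> \<subseteq> U)"
  unfolding skorohod_topology_def
  by (subst topology_inverse'[OF istopology_nbhds[OF skorohod_nbhd_mono]]) auto

lemma openin_ucc:
  "openin ucc_topology U \<longleftrightarrow>
     U \<subseteq> Collect (continuous_on {0..}) \<and> (\<forall>x\<in>U. \<exists>T. \<exists>\<epsilon>>0. ucc_nbhd x T \<epsilon> \<subseteq> U)"
  unfolding ucc_topology_def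
  by (subst topology_inverse'[OF istopology_nbhds[OF ucc_nbhd_mono]]) auto

lemma topspace_skorohod: "topspace skorohod_topology = Collect cadlag"
proof -
  have "openin skorohod_topology (Collect cadlag)"
    unfolding openin_skorohod by (auto simp: skorohod_nbhd_def intro!: exI[of _ "1::real"])
  then show ?thesis
    by (metis openin_skorohod openin_subset openin_topspace subset_antisym)
qed

lemma topspace_ucc: "topspace ucc_topology = Collect (continuous_on {0..})"
proof -
  have "openin ucc_topology (Collect (continuous_on {0..}))"
    unfolding openin_ucc by (auto simp: ucc_nbhd_def intro!: exI[of _ "1::real"])
  then show ?thesis
    by (metis openin_ucc openin_subset openin_topspace subset_antisym)
qed

lemma time_change_comp:
  assumes "time_change f" "time_change g" shows "time_change (g \<circ> f)"
proof -
  have "bij_betw (g \<circ> f) {0..} {0..}"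
    using assms unfolding time_change_def by (blast intro: bij_betw_trans)
  moreover have "(g \<circ> f) s < (g \<circ> f) t" if "s \<in> {0..}" "t \<in> {0..}" "s < t" for s t
  proof -
    have "f s < f t"
      using assms(1) that unfolding time_change_def by (blast intro: strict_mono_onD)
    moreover have "f s \<in> {0..}" "f t \<in> {0..}"
      using assms(1) that unfolding time_change_def by (blast dest: bij_betwE)+
    ultimately have "g (f s) < g (f t)"
      using assms(2) unfolding time_change_def by (blast intro: strict_mono_onD)
    then show ?thesis by simp
  qed
  ultimately show ?thesis unfolding time_change_def by (blast intro: strict_mono_onI)
qed

lemma skorohod_nbhd_triangle:
  assumes y: "y \<in> skorohod_nbhd x T (\<epsilon> / 2)" and "0 < \<epsilon>" "\<epsilon> \<le> 1"
  shows "skorohod_nbhd y (T + 1) (\<epsilon> / 2) \<subseteq> skorohod_nbhd x T \<epsilon>"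
proof
  fix w assume "w \<in> skorohod_nbhd y (T + 1) (\<epsilon> / 2)"
  then obtain g where g: "cadlag w" "time_change g" "\<And>t. t \<ge> 0 \<Longrightarrow> \<bar>g t - t\<bar> < \<epsilon> / 2"
    "\<And>t. t \<in> {0..T + 1} \<Longrightarrow> \<bar>w (g t) - y t\<bar> < \<epsilon> / 2" unfolding skorohod_nbhd_def by blast
  obtain f where f: "time_change f" "\<And>t. t \<ge> 0 \<Longrightarrow> \<bar>f t - t\<bar> < \<epsilon> / 2"
    "\<And>t. t \<in> {0..T} \<Longrightarrow> \<bar>y (f t) - x t\<bar> < \<epsilon> / 2" using y unfolding skorohod_nbhd_def by blast
  have f0: "f t \<ge> 0" if "t \<ge> 0" for t
    using f(1) that unfolding time_change_def bij_betw_def by auto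
  have "\<bar>(g \<circ> f) t - t\<bar> < \<epsilon>" if "t \<ge> 0" for t
    using f(2)[OF that] g(3)[OF f0[OF that]] unfolding comp_def by linarith
  moreover have "\<bar>w ((g \<circ> f) t) - x t\<bar> < \<epsilon>" if t: "t \<in> {0..T}" for t
  proof -
    have "t \<ge> 0" using t by simp
    then have "f t \<in> {0..T + 1}"
      using f0[of t] f(2)[of t] t assms by (simp, linarith)
    from g(4)[OF this] f(3)[OF t] show ?thesis unfolding comp_def by linarith
  qed
  ultimately show "w \<in> skorohod_nbhd x T \<epsilon>"
    unfolding skorohod_nbhd_def using g(1) time_change_comp[OF f(1) g(2)] by blast
qed

lemma time_change_id: "time_change (\<lambda>t. t)"
  unfolding time_change_def by (auto simp: bij_betw_def strict_mono_on_def)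

lemma skorohod_nbhd_self: "cadlag x \<Longrightarrow> \<epsilon> > 0 \<Longrightarrow> x \<in> skorohod_nbhd x T \<epsilon>"
  unfolding skorohod_nbhd_def using time_change_id by force

lemma skorohod_nbhd_interior:
  assumes x: "cadlag x" and e: "\<epsilon> > 0"
  shows "\<exists>U. openin skorohod_topology U \<and> x \<in> U \<and> U \<subseteq> skorohod_nbhd x T \<epsilon>"
proof (intro exI conjI)
  let ?U = "{y. cadlag y \<and> (\<exists>S. \<exists>\<delta>>0. skorohod_nbhd y S \<delta> \<subseteq> skorohod_nbhd x T \<epsilon>)}"
  show "openin skorohod_topology ?U"
    unfolding openin_skorohod
  proof (intro conjI ballI)
    show "?U \<subseteq> Collect cadlag" by blast
    fix y assume "y \<in> ?U"
    then obtain S d where d: "d > 0" "skorohod_nbhd y S d \<subseteq> skorohod_nbhd x T \<epsilon>" by blast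
    define d' where "d' = min d 1"
    have "skorohod_nbhd y S (d' / 2) \<subseteq> ?U"
    proof
      fix w assume w: "w \<in> skorohod_nbhd y S (d' / 2)"
      have "skorohod_nbhd w (S + 1) (d' / 2) \<subseteq> skorohod_nbhd x T \<epsilon>"
        using skorohod_nbhd_triangle[OF w] skorohod_nbhd_mono[of S S d' d y] d
        unfolding d'_def by force
      moreover have "d' / 2 > 0" using d unfolding d'_def by auto
      moreover have "cadlag w" using w unfolding skorohod_nbhd_def by blast
      ultimately show "w \<in> ?U" by blast
    qed
    moreover have "d' / 2 > 0" using d unfolding d'_def by auto
    ultimately show "\<exists>S. \<exists>\<delta>>0. skorohod_nbhd y S \<delta> \<subseteq> ?U" by blast
  qed
  show "x \<in> ?U" using x e by blast
  show "?U \<subseteq> skorohod_nbhd x T \<epsilon>" using skorohod_nbhd_self by blast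
qed

lemma limitin_skorohod:
  "limitin skorohod_topology X x F \<longleftrightarrow>
     cadlag x \<and> (\<forall>T. \<forall>\<epsilon>>0. eventually (\<lambda>n. X n \<in> skorohod_nbhd x T \<epsilon>) F)"
proof (intro iffI conjI allI impI)
  assume L: "limitin skorohod_topology X x F"
  then show x: "cadlag x" by (simp add: limitin_def topspace_skorohod)
  fix T \<epsilon> :: real assume "\<epsilon> > 0"
  then obtain U where U: "openin skorohod_topology U" "x \<in> U" "U \<subseteq> skorohod_nbhd x T \<epsilon>"
    using skorohod_nbhd_interior[OF x] by blast
  have "eventually (\<lambda>n. X n \<in> U) F" using L U unfolding limitin_def by blast
  then show "eventually (\<lambda>n. X n \<in> skorohod_nbhd x T \<epsilon>) F"
    by (rule eventually_mono) (use U in blast)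
next
  assume R: "cadlag x \<and> (\<forall>T. \<forall>\<epsilon>>0. eventually (\<lambda>n. X n \<in> skorohod_nbhd x T \<epsilon>) F)"
  show "limitin skorohod_topology X x F"
    unfolding limitin_def topspace_skorohod
  proof (intro conjI allI impI)
    show "x \<in> Collect cadlag" using R by blast
    fix U assume "openin skorohod_topology U \<and> x \<in> U"
    then obtain T e where e: "e > 0" "skorohod_nbhd x T e \<subseteq> U" unfolding openin_skorohod by blast
    have "eventually (\<lambda>n. X n \<in> skorohod_nbhd x T e) F" using R e by blast
    then show "eventually (\<lambda>n. X n \<in> U) F"
      by (rule eventually_mono) (use e in blast)
  qed
qed

end

theory Submission
  imports Defs
begin

text \<open>The convergence is deterministic and quantitative. Put \<open>L t = t - C t\<close>. Since \<open>x\<close> has no negative jumps,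
  \<open>Z \<ge> 0\<close>, so \<open>Z t = z + x (C t) + \<gamma> * L t\<close> where \<open>L\<close> grows only on \<open>{Z = 0}\<close>; this is a Skorohod reflection
  problem, and \<open>\<gamma> * L t\<close> is the running supremum of \<open>- (z + x)\<close> (truncated at \<open>0\<close>) over \<open>[0, C t]\<close>. In addition
  \<open>C\<close> is an increasing bijection of \<open>[0, \<infinity>)\<close>. The discretized clock solves the same problem driven by \<open>x\<^sub>n\<close> up to
  an error bounded by \<open>1 / n\<close> and the negative jumps of \<open>x\<^sub>n\<close>, which are small when \<open>x\<^sub>n\<close> is \<open>J\<^sub>1\<close>-close to \<open>x\<close>. Hence, if
  \<open>\<theta>\<close> is the time change matching \<open>x\<^sub>n\<close> with \<open>x\<close>, the time at which the discrete clock shows \<open>j / n\<close> is close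
  to the time at which \<open>\<theta> \<circ> C\<close> does. This gives the uniform convergence of the clocks, and interpolating between
  these times gives the time change matching \<open>Z\<^sub>n\<close> with \<open>Z\<close>. The weak version follows from a mapping theorem in
  which the test function is replaced by its Lipschitz sup-convolutions for a \<open>J\<^sub>1\<close> quasi-metric.\<close>

subsection \<open>Time changes\<close>

text \<open>The obstacle is composition: \<open>x \<circ> C\<close> and its discrete counterpart
  have to be matched, and near a jump of the driver an approximate match of the arguments is
  worthless. A grid path jumps only at grid points, so the arguments need to agree only in the cell
  [j/n, (j+1)/n) in which they lie. Sending the time at which \<open>\<theta> \<circ> C\<close>
  reaches j/n to the time at which the discrete clock does achieves this; the distance between the
  two times then enters only the drift term and the size of the time change. That distance is
  controlled through the lag t - C t, because a running supremum is stable under uniform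
  perturbation and reparametrization of the driver, whereas the indicator of {Z = 0} is not stable
  under perturbation of Z. The comparison is uniform over all grid paths in one neighbourhood of x,
  the form that both modes of convergence consume. In the weak case the J1 neighbourhoods look at x
  on a bounded window, so a distance read off from them is not symmetric; a triangle inequality in a
  fixed order of arguments is enough for sup-convolutions.\<close>

lemma time_change_nonneg: "time_change f \<Longrightarrow> 0 \<le> t \<Longrightarrow> 0 \<le> f t"
  unfolding time_change_def bij_betw_def by auto

lemma time_change_less: "time_change f \<Longrightarrow> 0 \<le> s \<Longrightarrow> s < t \<Longrightarrow> f s < f t"
  unfolding time_change_def by (auto intro: strict_mono_onD)

lemma time_change_less_iff: "time_change f \<Longrightarrow> 0 \<le> s \<Longrightarrow> 0 \<le> t \<Longrightarrow> f s < f t \<longleftrightarrow> s < t"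
  by (metis time_change_less less_asym linorder_neqE)

lemma time_change_le_iff: "time_change f \<Longrightarrow> 0 \<le> s \<Longrightarrow> 0 \<le> t \<Longrightarrow> f s \<le> f t \<longleftrightarrow> s \<le> t"
  by (meson time_change_less_iff not_less)

lemma time_change_surj:
  assumes "time_change f" "0 \<le> t" obtains s where "0 \<le> s" "f s = t"
  using assms unfolding time_change_def bij_betw_def by (metis atLeast_iff image_iff)

lemma time_change_zero: assumes "time_change f" shows "f 0 = 0"
proof -
  obtain s where "0 \<le> s" "f s = 0" using time_change_surj[OF assms, of 0] by auto
  moreover have "f 0 \<le> f s" using time_change_le_iff[OF assms, of 0 s] calculation by simp
  ultimately show ?thesis using time_change_nonneg[OF assms, of 0] by simp
qed

lemma time_changeI:
  assumes "\<And>t. 0 \<le> t \<Longrightarrow> 0 \<le> f t" "\<And>s t. 0 \<le> s \<Longrightarrow> s < t \<Longrightarrow> f s < f t"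
    and "\<And>t. 0 \<le> t \<Longrightarrow> \<exists>s\<ge>0. f s = t"
  shows "time_change f"
proof -
  have "strict_mono_on {0..} f" using assms(2) by (auto intro: strict_mono_onI)
  moreover have "f ` {0..} = {0..}" using assms(1,3) by force
  ultimately show ?thesis
    unfolding time_change_def bij_betw_def by (simp add: strict_mono_on_imp_inj_on)
qed

lemma time_change_inverse:
  assumes f: "time_change f"
  obtains g where "time_change g" "\<And>t. 0 \<le> t \<Longrightarrow> f (g t) = t" "\<And>t. 0 \<le> t \<Longrightarrow> g (f t) = t"
proof -
  define g where "g = inv_into {0..} f"
  have fg: "f (g t) = t" and g0: "0 \<le> g t" if "0 \<le> t" for t
    using that f unfolding g_def time_change_def bij_betw_def
    by (auto simp: f_inv_into_f) (metis atLeast_iff inv_into_into)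
  have gf: "g (f t) = t" if "0 \<le> t" for t
    using that f unfolding g_def time_change_def bij_betw_def by (simp add: inv_into_f_f)
  have "time_change g"
  proof (rule time_changeI)
    show "0 \<le> g t" if "0 \<le> t" for t using g0 that .
    show "g s < g t" if "0 \<le> s" "s < t" for s t
      using time_change_less_iff[OF f, of "g s" "g t"] fg g0 that by simp
    show "\<exists>s\<ge>0. g s = t" if "0 \<le> t" for t
      using gf[OF that] time_change_nonneg[OF f that] by blast
  qed
  then show ?thesis using that fg gf by blast
qed

section \<open>Time changes matching two increasing sequences of times\<close>

lemma increasing_sequence_cell:
  fixes s :: "nat \<Rightarrow> real"
  assumes "s 0 \<le> t" "t < s r"
  obtains i where "i < r" "s i \<le> t" "t < s (Suc i)"
proof -
  let ?m = "LEAST m. t < s m"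
  have m: "t < s ?m" using assms(2) by (rule LeastI)
  have "?m \<le> r" using assms(2) by (rule Least_le)
  obtain i where i: "?m = Suc i" using m assms(1) by (metis linorder_not_less not0_implies_Suc)
  then have "\<not> t < s i" using not_less_Least[of i "\<lambda>m. t < s m"] by simp
  then show ?thesis using that[of i] m i \<open>?m \<le> r\<close> by simp
qed

text \<open>The polygonal function taking the value \<open>s k\<close> at \<open>k\<close>. Two such
  functions share the integer nodes, so inverting one and applying the other carries one sequence to
  the other.\<close>

definition interpolate :: "(nat \<Rightarrow> real) \<Rightarrow> real \<Rightarrow> real" where
  "interpolate s u = (let k = nat \<lfloor>u\<rfloor> in s k + (u - real k) * (s (Suc k) - s k))"

lemma interpolate_cell:
  assumes "real k \<le> u" "u < real k + 1"
  shows "interpolate s u = s k + (u - real k) * (s (Suc k) - s k)"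
proof -
  have "nat \<lfloor>u\<rfloor> = k" using assms by linarith
  then show ?thesis by (simp add: interpolate_def)
qed

lemma interpolate_bounds:
  assumes s: "strict_mono s" and "real k \<le> u" "u < real k + 1"
  shows "s k \<le> interpolate s u" "interpolate s u < s (Suc k)"
proof -
  have d: "0 < s (Suc k) - s k" using s by (simp add: strict_mono_Suc_iff)
  show "s k \<le> interpolate s u" using interpolate_cell[OF assms(2,3)] d assms by simp
  have "(u - real k) * (s (Suc k) - s k) < 1 * (s (Suc k) - s k)"
    using d assms by (intro mult_strict_right_mono) auto
  then show "interpolate s u < s (Suc k)" using interpolate_cell[OF assms(2,3), of s] by simp
qed

lemma nat_cell: assumes "0 \<le> (u::real)" obtains k where "real k \<le> u" "u < real k + 1"
  using that[of "nat \<lfloor>u\<rfloor>"] assms by linarith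

lemma time_change_interpolate:
  assumes s: "strict_mono s" "s 0 = 0" and unb: "\<And>B. \<exists>i. B < s i"
  shows "time_change (interpolate s)"
proof (rule time_changeI)
  fix t :: real assume "0 \<le> t"
  then obtain k where k: "real k \<le> t" "t < real k + 1" by (rule nat_cell)
  have "s 0 \<le> s k" using s(1) by (simp add: strict_mono_less_eq)
  then show "0 \<le> interpolate s t" using interpolate_bounds[OF s(1) k] s(2) by simp
next
  fix u v :: real assume u: "0 \<le> u" and uv: "u < v"
  from u obtain k where k: "real k \<le> u" "u < real k + 1" by (rule nat_cell)
  from u uv have "0 \<le> v" by simp
  then obtain l where l: "real l \<le> v" "v < real l + 1" by (rule nat_cell)
  have kl: "k \<le> l" using k l uv by linarith
  show "interpolate s u < interpolate s v"
  proof (cases "k = l")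
    case True
    have "0 < s (Suc k) - s k" using s by (simp add: strict_mono_Suc_iff)
    then show ?thesis using interpolate_cell[OF k] interpolate_cell[OF l] True uv
      by simp
  next
    case False
    then have "s (Suc k) \<le> s l" using kl s(1) by (simp add: strict_mono_less_eq)
    then show ?thesis using interpolate_bounds[OF s(1) k] interpolate_bounds[OF s(1) l] by simp
  qed
next
  fix t :: real assume t: "0 \<le> t"
  obtain r where "t < s r" using unb by blast
  then obtain k where k: "s k \<le> t" "t < s (Suc k)"
    using increasing_sequence_cell[of s t r] s(2) t by auto
  define u where "u = real k + (t - s k) / (s (Suc k) - s k)"
  have d: "0 < s (Suc k) - s k" using k by simp
  then have "(t - s k) / (s (Suc k) - s k) < 1" "0 \<le> (t - s k) / (s (Suc k) - s k)" using k by simp_all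
  then have u: "real k \<le> u" "u < real k + 1" unfolding u_def by simp_all
  have "interpolate s u = t" using interpolate_cell[OF u, of s] d unfolding u_def by simp
  then show "\<exists>s'\<ge>0. interpolate s s' = t" using u by (intro exI[of _ u]) auto
qed

text \<open>Both polygonal functions are run with a common parameter: there the two values are
  convex combinations with the same weights, so the bound at the nodes passes to all times. That
  half-open cells go exactly into half-open cells is what lets piecewise constant paths be compared
  without loss at jumps.\<close>

lemma time_change_between_sequences:
  assumes s: "strict_mono s" "s 0 = 0" "\<And>B. \<exists>i. B < s i"
    and r: "strict_mono r" "r 0 = 0" "\<And>B. \<exists>i. B < r i"
    and close: "\<And>i. \<bar>r i - s i\<bar> \<le> \<delta>"
  obtains \<theta> where "time_change \<theta>" "\<And>t. 0 \<le> t \<Longrightarrow> \<bar>\<theta> t - t\<bar> \<le> \<delta>"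
    "\<And>i t. s i \<le> t \<Longrightarrow> t < s (Suc i) \<Longrightarrow> r i \<le> \<theta> t \<and> \<theta> t < r (Suc i)"
proof -
  have si: "time_change (interpolate s)" and ir: "time_change (interpolate r)"
    using time_change_interpolate s r by blast+
  obtain g where g: "time_change g" "\<And>t. 0 \<le> t \<Longrightarrow> interpolate s (g t) = t"
    by (rule time_change_inverse[OF si]) blast
  define \<theta> where "\<theta> = interpolate r \<circ> g"
  have tc: "time_change \<theta>" unfolding \<theta>_def using g(1) ir by (rule time_change_comp)
  have 1: "\<bar>\<theta> t - t\<bar> \<le> \<delta> \<and> (\<forall>i. s i \<le> t \<and> t < s (Suc i) \<longrightarrow> r i \<le> \<theta> t \<and> \<theta> t < r (Suc i))"
    if t: "0 \<le> t" for t
  proof -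
    define u where "u = g t"
    have tu: "interpolate s u = t" unfolding u_def using g(2) t .
    have "0 \<le> u" unfolding u_def using g(1) t by (rule time_change_nonneg)
    then obtain k where k: "real k \<le> u" "u < real k + 1" by (rule nat_cell)
    define p where "p = u - real k"
    have p: "0 \<le> p" "p \<le> 1" using k unfolding p_def by simp_all
    have th: "\<theta> t = interpolate r u" unfolding \<theta>_def u_def by simp
    have "\<theta> t - t = (1 - p) * (r k - s k) + p * (r (Suc k) - s (Suc k))"
      using interpolate_cell[OF k, of r] interpolate_cell[OF k, of s] th tu
      unfolding p_def by (simp add: algebra_simps)
    then have "\<bar>\<theta> t - t\<bar> \<le> (1 - p) * \<bar>r k - s k\<bar> + p * \<bar>r (Suc k) - s (Suc k)\<bar>"
      using p by (metis abs_mult abs_of_nonneg abs_triangle_ineq diff_ge_0_iff_ge)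
    also have "\<dots> \<le> (1 - p) * \<delta> + p * \<delta>"
      using p close by (intro add_mono mult_left_mono) auto
    finally have A: "\<bar>\<theta> t - t\<bar> \<le> \<delta>" by (simp add: algebra_simps)
    have B: "r i \<le> \<theta> t \<and> \<theta> t < r (Suc i)" if "s i \<le> t" "t < s (Suc i)" for i
    proof -
      have "s k \<le> t" "t < s (Suc k)" using interpolate_bounds[OF s(1) k] tu by simp_all
      then have "s k < s (Suc i)" "s i < s (Suc k)" using that by simp_all
      then have "k = i" using s(1) by (simp add: strict_mono_less)
      then show ?thesis using interpolate_bounds[OF r(1) k] th by simp
    qed
    show ?thesis using A B by blast
  qed
  have "0 \<le> t" if "s i \<le> t" for i t
    using that s(1,2) by (metis le0 order_trans strict_mono_less_eq)
  then show ?thesis using that tc 1 by blast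
qed

subsection \<open>Cadlag paths\<close>

lemma gap_growth:
  fixes s :: "nat \<Rightarrow> real"
  assumes "s 0 = 0" "\<And>i. d \<le> s (Suc i) - s i"
  shows "real i * d \<le> s i"
proof (induction i)
  case (Suc i)
  then show ?case using assms(2)[of i] by (simp add: algebra_simps)
qed (use assms in simp)

lemma gap_strict_mono:
  fixes s :: "nat \<Rightarrow> real"
  assumes "d > 0" "\<And>i. d \<le> s (Suc i) - s i"
  shows "strict_mono s"
  unfolding strict_mono_Suc_iff
proof
  fix i show "s i < s (Suc i)" using assms(1) assms(2)[of i] by linarith
qed

lemma gap_unbounded:
  fixes s :: "nat \<Rightarrow> real"
  assumes "d > 0" "s 0 = 0" "\<And>i. d \<le> s (Suc i) - s i"
  shows "\<exists>i. B < s i"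
proof -
  obtain i where "B < real i * d" using reals_Archimedean3[OF assms(1)] by blast
  then show ?thesis using gap_growth[of s d i, OF assms(2,3)] by (intro exI[of _ i]) linarith
qed

text \<open>Continuous induction on the endpoints of good finite partitions: the left limit at their
  supremum makes the supremum itself an endpoint, and right continuity there yields a further one.
  The sequence is infinite with a uniform gap \<open>d\<close>, ready to serve as the nodes of a
  time change, although only its first \<open>r\<close> cells are controlled.\<close>

lemma cadlag_partition:
  assumes x: "cadlag x" and e: "e > 0"
  obtains s r d where "d > 0" "s 0 = 0" "\<And>i. d \<le> s (Suc i) - s i" "T < s r"
    "\<And>i u v. i < r \<Longrightarrow> s i \<le> u \<Longrightarrow> u < s (Suc i) \<Longrightarrow> s i \<le> v \<Longrightarrow> v < s (Suc i) \<Longrightarrow> \<bar>x u - x v\<bar> < e"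
proof -
  define P where "P t s r d \<longleftrightarrow> d > 0 \<and> s 0 = 0 \<and> (\<forall>i. d \<le> s (Suc i) - s i) \<and> s r = t \<and>
     (\<forall>i<r. \<forall>u v. s i \<le> u \<longrightarrow> u < s (Suc i) \<longrightarrow> s i \<le> v \<longrightarrow> v < s (Suc i) \<longrightarrow> \<bar>x u - x v\<bar> < e)"
    for t and s :: "nat \<Rightarrow> real" and r :: nat and d :: real
  define R where "R t \<longleftrightarrow> (\<exists>s r d. P t s r d)" for t
  have R0: "R 0"
    unfolding R_def P_def by (intro exI[of _ real] exI[of _ 0] exI[of _ 1]) auto
  have Rstep: "R t'" if t: "R t" "t < t'" "\<And>u v. t \<le> u \<Longrightarrow> u < t' \<Longrightarrow> t \<le> v \<Longrightarrow> v < t' \<Longrightarrow> \<bar>x u - x v\<bar> < e"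
    for t t'
  proof -
    obtain s r d where P: "P t s r d" using t(1) unfolding R_def by blast
    \<comment> \<open>Past the new endpoint the nodes continue with unit steps, so that the gap
      condition survives for all indices.\<close>
    define s' where "s' i = (if i \<le> r then s i else t' + real (i - Suc r))" for i
    define d' where "d' = min d (min 1 (t' - t))"
    have gap: "d' \<le> s' (Suc i) - s' i" for i
    proof -
      consider "i < r" | "i = r" | "r < i" by linarith
      then show ?thesis
      proof cases
        case 1
        have "d \<le> s (Suc i) - s i" using P unfolding P_def by blast
        then show ?thesis using 1 unfolding s'_def d'_def by simp
      next
        case 2
        have "s r = t" using P unfolding P_def by blast
        then show ?thesis using 2 unfolding s'_def d'_def by simp
      next
        case 3
        then have "real (Suc i - Suc r) = real (i - Suc r) + 1" by linarith
        then show ?thesis using 3 unfolding s'_def d'_def by simp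
      qed
    qed
    have osc: "\<bar>x u - x v\<bar> < e" if "i < Suc r" "s' i \<le> u" "u < s' (Suc i)" "s' i \<le> v" "v < s' (Suc i)" for i u v
    proof (cases "i < r")
      case True
      then have "s' i = s i" "s' (Suc i) = s (Suc i)" unfolding s'_def by auto
      then show ?thesis using P True that unfolding P_def by auto
    next
      case False
      then have "i = r" using that by simp
      then have "s' i = t" "s' (Suc i) = t'" using P unfolding s'_def P_def by auto
      then show ?thesis using t(3) that by auto
    qed
    have "0 < d'" using P t(2) unfolding P_def d'_def by simp
    moreover have "s' 0 = 0" using P unfolding P_def s'_def by simp
    moreover have "s' (Suc r) = t'" unfolding s'_def by simp
    ultimately have "P t' s' (Suc r) d'" unfolding P_def using gap osc by blast
    then show ?thesis unfolding R_def by blast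
  qed
  have Rnn: "0 \<le> t" if t: "R t" for t
  proof -
    obtain s r d where P: "d > 0" "s 0 = 0" "\<And>i. d \<le> s (Suc i) - s i" "s r = t" 
      using t unfolding R_def P_def by blast
    have "real r * d \<le> t" using gap_growth[of s d r, OF P(2,3)] P(4) by simp
    moreover have "0 \<le> real r * d" using P(1) by simp
    ultimately show ?thesis by linarith
  qed
  have "\<exists>t. R t \<and> T < t"
  proof (rule ccontr)
    assume N: "\<not> (\<exists>t. R t \<and> T < t)"
    define \<sigma> where "\<sigma> = Sup (Collect R)"
    have bdd: "bdd_above (Collect R)" using N by (intro bdd_aboveI[of _ T]) (auto simp: not_less)
    have ub: "t \<le> \<sigma>" if "R t" for t unfolding \<sigma>_def using that bdd by (intro cSup_upper) auto
    have s0: "0 \<le> \<sigma>" using ub[OF R0] .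
    have Rs: "R \<sigma>"
    proof (cases "\<sigma> = 0")
      case True then show ?thesis using R0 by simp
    next
      case False
      then have "0 < \<sigma>" using s0 by simp
      then obtain l where "(x \<longlongrightarrow> l) (at_left \<sigma>)" using x unfolding cadlag_def by blast
      then have "eventually (\<lambda>u. dist (x u) l < e / 2) (at_left \<sigma>)"
        using e by (intro tendstoD) auto
      then obtain b where b: "b < \<sigma>" "\<And>u. b < u \<Longrightarrow> u < \<sigma> \<Longrightarrow> dist (x u) l < e / 2"
        unfolding eventually_at_left_field by blast
      obtain t where t: "R t" "b < t"
        using less_cSup_iff[OF _ bdd, of b] R0 b(1) unfolding \<sigma>_def by blast
      show ?thesis
      proof (cases "t = \<sigma>")
        case True then show ?thesis using t by simp
      next
        case False
        then have "t < \<sigma>" using ub[OF t(1)] by simp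
        moreover have "\<bar>x u - x v\<bar> < e" if "t \<le> u" "u < \<sigma>" "t \<le> v" "v < \<sigma>" for u v
          using b(2)[of u] b(2)[of v] that t(2) unfolding dist_real_def by linarith
        ultimately show ?thesis using Rstep[OF t(1)] by blast
      qed
    qed
    have "(x \<longlongrightarrow> x \<sigma>) (at_right \<sigma>)" using x s0 unfolding cadlag_def by blast
    then have "eventually (\<lambda>u. dist (x u) (x \<sigma>) < e / 2) (at_right \<sigma>)"
      using e by (intro tendstoD) auto
    then obtain b where b: "\<sigma> < b" "\<And>u. \<sigma> < u \<Longrightarrow> u < b \<Longrightarrow> dist (x u) (x \<sigma>) < e / 2"
      unfolding eventually_at_right_field by blast
    have near: "dist (x u) (x \<sigma>) < e / 2" if "\<sigma> \<le> u" "u < b" for u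
      using b(2)[of u] that e by (cases "u = \<sigma>") auto
    have "\<bar>x u - x v\<bar> < e" if "\<sigma> \<le> u" "u < b" "\<sigma> \<le> v" "v < b" for u v
      using near[of u] near[of v] that unfolding dist_real_def by linarith
    then have "R b" using Rstep[OF Rs b(1)] by blast
    then show False using ub b(1) by fastforce
  qed
  then obtain t s r d where "T < t" "P t s r d" unfolding R_def by blast
  then show ?thesis using that[of d s r] unfolding P_def by auto
qed

lemma cadlag_bounded:
  assumes x: "cadlag x" obtains B where "\<And>t. 0 \<le> t \<Longrightarrow> t \<le> T \<Longrightarrow> \<bar>x t\<bar> \<le> B"
proof -
  obtain s r d where s: "d > 0" "s 0 = 0" "\<And>i. d \<le> s (Suc i) - s i" "T < s r"
    "\<And>i u v. i < r \<Longrightarrow> s i \<le> u \<Longrightarrow> u < s (Suc i) \<Longrightarrow> s i \<le> v \<Longrightarrow> v < s (Suc i) \<Longrightarrow> \<bar>x u - x v\<bar> < 1"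
    by (rule cadlag_partition[OF x zero_less_one]) blast
  define B where "B = (\<Sum>i<r. \<bar>x (s i)\<bar>) + 1"
  have "\<bar>x t\<bar> \<le> B" if t: "0 \<le> t" "t \<le> T" for t
  proof -
    obtain i where i: "i < r" "s i \<le> t" "t < s (Suc i)"
      using increasing_sequence_cell[of s t r] s(2,4) t by auto
    have "\<bar>x t - x (s i)\<bar> < 1" using s(5)[OF i(1) i(2,3), of "s i"] i by simp
    moreover have "\<bar>x (s i)\<bar> \<le> (\<Sum>i<r. \<bar>x (s i)\<bar>)"
      using i(1) by (intro member_le_sum) auto
    ultimately show ?thesis unfolding B_def by linarith
  qed
  then show ?thesis using that by blast
qed

text \<open>Right continuity exhibits the path as a limit of its values at grid points to the right.
  Values at negative arguments are arbitrary, hence the clamp \<open>max 0 t\<close>.\<close>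

lemma cadlag_borel_measurable:
  assumes x: "cadlag x" shows "(\<lambda>t. x (max 0 t)) \<in> borel_measurable borel"
proof (rule borel_measurable_LIMSEQ_real)
  fix t :: real
  \<comment> \<open>The \<open>+ 1\<close> puts \<open>p n\<close> strictly to the right of
    \<open>max 0 t\<close>, as the filter \<open>at_right\<close> demands.\<close>
  define p where "p n = (real_of_int \<lfloor>real (Suc n) * max 0 t\<rfloor> + 1) / real (Suc n)" for n
  have up: "p n \<le> max 0 t + 1 / real (Suc n)" and lo: "max 0 t < p n" for n
  proof -
    have "real_of_int \<lfloor>real (Suc n) * max 0 t\<rfloor> \<le> real (Suc n) * max 0 t" by simp
    then have "p n \<le> (real (Suc n) * max 0 t + 1) / real (Suc n)"
      unfolding p_def by (intro divide_right_mono) auto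
    then show "p n \<le> max 0 t + 1 / real (Suc n)" by (simp add: add_divide_distrib)
    have "real (Suc n) * max 0 t < real_of_int \<lfloor>real (Suc n) * max 0 t\<rfloor> + 1" by linarith
    then have "(real (Suc n) * max 0 t) / real (Suc n) < p n"
      unfolding p_def by (intro divide_strict_right_mono) auto
    then show "max 0 t < p n" by simp
  qed
  have "(\<lambda>n. 1 / real (Suc n)) \<longlonglongrightarrow> 0" by (rule LIMSEQ_Suc[OF lim_1_over_n])
  then have "(\<lambda>n. max 0 t + 1 / real (Suc n)) \<longlonglongrightarrow> max 0 t + 0" by (intro tendsto_add tendsto_const)
  then have "p \<longlonglongrightarrow> max 0 t"
    using tendsto_sandwich[of "\<lambda>_. max 0 t" p sequentially "\<lambda>n. max 0 t + 1 / real (Suc n)" "max 0 t"]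
      up lo by (auto simp: less_imp_le)
  then have "filterlim p (at_right (max 0 t)) sequentially"
    unfolding filterlim_at using lo by (metis (mono_tags, lifting) eventuallyI greaterThan_iff less_irrefl)
  moreover have "(x \<longlongrightarrow> x (max 0 t)) (at_right (max 0 t))" using x unfolding cadlag_def by simp
  ultimately show "(\<lambda>n. x (p n)) \<longlonglongrightarrow> x (max 0 t)" by (rule filterlim_compose[rotated])
next
  fix n :: nat
  have "(\<lambda>t. (\<lambda>k::int. x ((real_of_int k + 1) / real (Suc n))) \<lfloor>real (Suc n) * max 0 t\<rfloor>) \<in> borel_measurable borel"
    by (rule measurable_compose[where N="count_space UNIV"]) measurable
  then show "(\<lambda>t. x ((real_of_int \<lfloor>real (Suc n) * max 0 t\<rfloor> + 1) / real (Suc n))) \<in> borel_measurable borel"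
    by simp
qed

section \<open>Step paths and sampling on a grid\<close>

definition step_path :: "nat \<Rightarrow> (nat \<Rightarrow> real) \<Rightarrow> real \<Rightarrow> real" where
  "step_path n a t = a (nat \<lfloor>real n * t\<rfloor>)"

lemma step_path_eq:
  assumes "n > 0" "real k \<le> real n * t" "real n * t < real k + 1"
  shows "step_path n a t = a k"
proof -
  have "nat \<lfloor>real n * t\<rfloor> = k" using assms by linarith
  then show ?thesis by (simp add: step_path_def)
qed

lemma cadlag_step_path:
  assumes n: "n > 0" shows "cadlag (step_path n a)"
  unfolding cadlag_def
proof (intro conjI allI impI)
  fix t :: real assume "0 \<le> t"
  then have "0 \<le> real n * t" by simp
  then obtain k where k: "real k \<le> real n * t" "real n * t < real k + 1" by (rule nat_cell)
  have b: "t < (real k + 1) / real n" using k n by (simp add: field_simps)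
  have "step_path n a u = step_path n a t" if u: "t < u" "u < (real k + 1) / real n" for u
  proof -
    have "real n * t \<le> real n * u" using u n by simp
    moreover have "real n * u < real k + 1" using u n by (simp add: field_simps)
    ultimately show ?thesis using step_path_eq[OF n k] step_path_eq[OF n, of k u] k by simp
  qed
  then have "eventually (\<lambda>u. step_path n a u = step_path n a t) (at_right t)"
    unfolding eventually_at_right_field using b by blast
  then show "(step_path n a \<longlongrightarrow> step_path n a t) (at_right t)" by (rule tendsto_eventually)
next
  fix t :: real assume t: "0 < t"
  \<comment> \<open>The cell just to the left of t: at a grid point it is the preceding one, hence
    the ceiling minus one instead of the floor.\<close>
  define k where "k = nat (\<lceil>real n * t\<rceil> - 1)"
  have "0 < real n * t" using n t by simp
  then have k: "real k < real n * t" "real n * t \<le> real k + 1" unfolding k_def by linarith+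
  have b: "real k / real n < t" using k n by (simp add: field_simps)
  have "step_path n a u = a k" if u: "real k / real n < u" "u < t" for u
  proof -
    have "real k \<le> real n * u" using u n by (simp add: field_simps)
    moreover have "real n * u < real n * t" using u n by simp
    ultimately show ?thesis using k by (intro step_path_eq[OF n]) auto
  qed
  then have "eventually (\<lambda>u. step_path n a u = a k) (at_left t)"
    unfolding eventually_at_left_field using b by blast
  then show "\<exists>l. (step_path n a \<longlongrightarrow> l) (at_left t)" using tendsto_eventually by blast
qed

text \<open>Sampling displaces the jumps of x by up to one mesh width, so a time change is required:
  each partition point is moved to the first grid point at or after it. A sample seen in a moved
  cell is then taken in the original cell, where x oscillates by less than \<open>e\<close>.\<close>

lemma step_path_sampling_limit:
  assumes x: "cadlag x"
  shows "limitin skorohod_topology (\<lambda>n. step_path (Suc n) (\<lambda>i. x (real i / real (Suc n)))) x sequentially"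
  unfolding limitin_skorohod
proof (intro conjI x allI impI)
  fix T e :: real assume e: "e > 0"
  obtain s r d where s: "d > 0" "s 0 = 0" "\<And>i. d \<le> s (Suc i) - s i" "T < s r"
    "\<And>i u v. i < r \<Longrightarrow> s i \<le> u \<Longrightarrow> u < s (Suc i) \<Longrightarrow> s i \<le> v \<Longrightarrow> v < s (Suc i) \<Longrightarrow> \<bar>x u - x v\<bar> < e"
    by (rule cadlag_partition[OF x e]) blast
  have "step_path (Suc n) (\<lambda>i. x (real i / real (Suc n))) \<in> skorohod_nbhd x T e"
    if n: "real n > 1 / d" "real n > 1 / e" for n
  proof -
    define m where "m = real (Suc n)"
    have m: "m > 1 / d" "m > 1 / e" "m > 0" using n unfolding m_def by simp_all
    \<comment> \<open>A mesh below the minimal gap keeps the rounded partition points distinct; a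
      mesh below \<open>e\<close> bounds the time change.\<close>
    have md: "1 < m * d" "1 / m < e" using m s(1) e by (simp_all add: field_simps)
    define q where "q i = real_of_int \<lceil>m * s i\<rceil> / m" for i
    have qs: "s i \<le> q i" "q i \<le> s i + 1 / m" for i
    proof -
      have "m * s i / m \<le> q i" unfolding q_def using m by (intro divide_right_mono) auto
      then show "s i \<le> q i" using m by simp
      have "q i \<le> (m * s i + 1) / m" unfolding q_def using m by (intro divide_right_mono) linarith+
      then show "q i \<le> s i + 1 / m" using m by (simp add: add_divide_distrib)
    qed
    have "strict_mono q" unfolding strict_mono_Suc_iff
    proof
      fix i
      have "m * d \<le> m * (s (Suc i) - s i)" using s(3) m by (intro mult_left_mono) auto
      then have "m * s i + 1 < m * s (Suc i)" using md by (simp add: algebra_simps)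
      then have "real_of_int \<lceil>m * s i\<rceil> < real_of_int \<lceil>m * s (Suc i)\<rceil>" by linarith
      then show "q i < q (Suc i)" unfolding q_def using m by (intro divide_strict_right_mono) auto
    qed
    moreover have "q 0 = 0" unfolding q_def using s by simp
    moreover have "\<exists>i. B < q i" for B
      using gap_unbounded[of d s B, OF s(1-3)] qs(1) by (meson order_less_le_trans)
    moreover have "\<bar>q i - s i\<bar> \<le> 1 / m" for i using qs[of i] by simp
    ultimately obtain \<theta> where th: "time_change \<theta>" "\<And>t. 0 \<le> t \<Longrightarrow> \<bar>\<theta> t - t\<bar> \<le> 1 / m"
      "\<And>i t. s i \<le> t \<Longrightarrow> t < s (Suc i) \<Longrightarrow> q i \<le> \<theta> t \<and> \<theta> t < q (Suc i)"
      using time_change_between_sequences[of s q "1 / m"] gap_strict_mono[of d s, OF s(1,3)]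
        gap_unbounded[of d s, OF s(1-3)] s(2) by blast
    have "\<bar>step_path (Suc n) (\<lambda>i. x (real i / m)) (\<theta> t) - x t\<bar> < e" if t: "t \<in> {0..T}" for t
    proof -
      obtain i where i: "i < r" "s i \<le> t" "t < s (Suc i)"
        using increasing_sequence_cell[of s t r] s(2,4) t by auto
      have qt: "q i \<le> \<theta> t" "\<theta> t < q (Suc i)" using th(3)[OF i(2,3)] by auto
      define k where "k = nat \<lfloor>m * \<theta> t\<rfloor>"
      have "0 \<le> \<theta> t" using th(1) t by (simp add: time_change_nonneg)
      then have "0 \<le> m * \<theta> t" using m by simp
      then have k: "real k = real_of_int \<lfloor>m * \<theta> t\<rfloor>" unfolding k_def by simp
      have "real_of_int \<lceil>m * s i\<rceil> \<le> m * \<theta> t" using qt(1) m unfolding q_def by (simp add: field_simps)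
      then have "\<lceil>m * s i\<rceil> \<le> \<lfloor>m * \<theta> t\<rfloor>" by (simp add: le_floor_iff)
      then have "m * s i \<le> real k" unfolding k by linarith
      then have 1: "s i \<le> real k / m" using m by (simp add: field_simps)
      have "m * \<theta> t < real_of_int \<lceil>m * s (Suc i)\<rceil>" using qt(2) m unfolding q_def by (simp add: field_simps)
      then have "\<lfloor>m * \<theta> t\<rfloor> < \<lceil>m * s (Suc i)\<rceil>" by linarith
      then have "real k < m * s (Suc i)" unfolding k by linarith
      then have 2: "real k / m < s (Suc i)" using m by (simp add: field_simps)
      have "step_path (Suc n) (\<lambda>i. x (real i / m)) (\<theta> t) = x (real k / m)"
        unfolding step_path_def k_def m_def ..
      then show ?thesis using s(5)[OF i(1) 1 2 i(2,3)] by simp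
    qed
    moreover have "\<forall>t\<ge>0. \<bar>\<theta> t - t\<bar> < e" using th(2) md(2) by fastforce
    ultimately show ?thesis
      unfolding skorohod_nbhd_def using th(1) cadlag_step_path[of "Suc n"] unfolding m_def by blast
  qed
  moreover have "eventually (\<lambda>n. real n > 1 / d \<and> real n > 1 / e) sequentially"
    by (intro eventually_conj)
      (metis eventually_at_top_dense filterlim_at_top_dense filterlim_real_sequentially)+
  ultimately show "eventually (\<lambda>n. step_path (Suc n) (\<lambda>i. x (real i / real (Suc n))) \<in> skorohod_nbhd x T e) sequentially"
    by (auto elim: eventually_mono)
qed

subsection \<open>Measurability of path functionals\<close>

lemma limitin_uccI:
  assumes "continuous_on {0..} x" "\<And>T \<epsilon>. \<epsilon> > 0 \<Longrightarrow> eventually (\<lambda>n. X n \<in> ucc_nbhd x T \<epsilon>) F"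
  shows "limitin ucc_topology X x F"
  unfolding limitin_def topspace_ucc
proof (intro conjI allI impI)
  show "x \<in> Collect (continuous_on {0..})" using assms(1) by blast
  fix U assume "openin ucc_topology U \<and> x \<in> U"
  then obtain T e where e: "e > 0" "ucc_nbhd x T e \<subseteq> U" unfolding openin_ucc by blast
  show "eventually (\<lambda>n. X n \<in> U) F"
    using assms(2)[OF e(1)] by (rule eventually_mono) (use e in blast)
qed

text \<open>The functional is reduced to countably many coordinates: \<open>f\<close> after
  \<open>S n\<close> is continuous for the product topology on sequences, hence measurable in the
  sampled values, and the samplings converge to the path pointwise in the sample point.\<close>

lemma path_functional_measurable:
  fixes S :: "nat \<Rightarrow> (nat \<Rightarrow> real) \<Rightarrow> real \<Rightarrow> real"
  assumes f: "continuous_map T euclideanreal f" and Y: "process M Y"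
    and cont: "\<And>n a b. a \<longlonglongrightarrow> b \<Longrightarrow> limitin T (\<lambda>k. S n (a k)) (S n b) sequentially"
    and approx: "\<And>\<omega>. \<omega> \<in> space M \<Longrightarrow>
      limitin T (\<lambda>n. S n (\<lambda>i. Y (real i / real (Suc n)) \<omega>)) (\<lambda>t. Y t \<omega>) sequentially"
  shows "(\<lambda>\<omega>. f (\<lambda>t. Y t \<omega>)) \<in> borel_measurable M"
proof (rule borel_measurable_LIMSEQ_real)
  fix \<omega> assume "\<omega> \<in> space M"
  from continuous_map_limit[OF f approx[OF this]]
  show "(\<lambda>n. f (S n (\<lambda>i. Y (real i / real (Suc n)) \<omega>))) \<longlonglongrightarrow> f (\<lambda>t. Y t \<omega>)"
    by (simp add: comp_def)
next
  fix n
  have "continuous_on UNIV (\<lambda>a. f (S n a))"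
  proof (rule continuous_on_sequentiallyI)
    fix a b assume "a \<longlonglongrightarrow> (b :: nat \<Rightarrow> real)"
    from continuous_map_limit[OF f cont[OF this]]
    show "(\<lambda>k. f (S n (a k))) \<longlonglongrightarrow> f (S n b)" by (simp add: comp_def)
  qed
  then have "(\<lambda>a. f (S n a)) \<in> borel_measurable borel" by (rule borel_measurable_continuous_onI)
  moreover have "(\<lambda>\<omega> i. Y (real i / real (Suc n)) \<omega>) \<in> borel_measurable M"
    using Y unfolding process_def by (intro measurable_coordinatewise_then_product) auto
  ultimately show "(\<lambda>\<omega>. f (S n (\<lambda>i. Y (real i / real (Suc n)) \<omega>))) \<in> borel_measurable M"
    by (rule measurable_compose[rotated])
qed

lemma tendsto_coordinates_eventually:
  assumes "a \<longlonglongrightarrow> (b :: nat \<Rightarrow> real)" "e > 0"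
  shows "eventually (\<lambda>k. \<forall>i\<le>m. \<bar>a k i - b i\<bar> < e) sequentially"
proof -
  have "eventually (\<lambda>k. \<bar>a k i - b i\<bar> < e) sequentially" for i
  proof -
    have "\<forall>c\<in>UNIV. isCont (\<lambda>x::nat \<Rightarrow> real. x i) c"
      by (subst continuous_on_eq_continuous_at[symmetric]) (rule open_UNIV continuous_on_product_coordinates)+
    then have "isCont (\<lambda>x::nat \<Rightarrow> real. x i) b" by (rule bspec) (rule UNIV_I)
    then have "(\<lambda>k. a k i) \<longlonglongrightarrow> b i" using assms(1) by (rule isCont_tendsto_compose)
    from tendstoD[OF this assms(2)] show ?thesis by (simp add: dist_real_def)
  qed
  then have "eventually (\<lambda>k. \<forall>i\<in>{..m}. \<bar>a k i - b i\<bar> < e) sequentially"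
    by (intro eventually_ball_finite) auto
  then show ?thesis by (rule eventually_mono) auto
qed

lemma skorohod_functional_measurable:
  assumes f: "continuous_map skorohod_topology euclideanreal f" and Y: "cadlag_process M Y"
  shows "(\<lambda>\<omega>. f (\<lambda>t. Y t \<omega>)) \<in> borel_measurable M"
proof (rule path_functional_measurable[OF f])
  show "process M Y" using Y unfolding cadlag_process_def by blast
  show "limitin skorohod_topology (\<lambda>n. step_path (Suc n) (\<lambda>i. Y (real i / real (Suc n)) \<omega>)) (\<lambda>t. Y t \<omega>) sequentially"
    if "\<omega> \<in> space M" for \<omega>
    using that Y unfolding cadlag_process_def by (intro step_path_sampling_limit) blast
  fix n :: nat and a :: "nat \<Rightarrow> nat \<Rightarrow> real" and b assume ab: "a \<longlonglongrightarrow> b"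
  show "limitin skorohod_topology (\<lambda>k. step_path (Suc n) (a k)) (step_path (Suc n) b) sequentially"
    unfolding limitin_skorohod
  proof (intro conjI allI impI)
    show "cadlag (step_path (Suc n) b)" by (rule cadlag_step_path) simp
    fix T e :: real assume e: "e > 0"
    \<comment> \<open>Up to time \<open>T\<close> a step path shows only the values with index at
      most this floor.\<close>
    have mem: "step_path (Suc n) (a k) \<in> skorohod_nbhd (step_path (Suc n) b) T e"
      if k: "\<forall>i\<le>nat \<lfloor>real (Suc n) * T\<rfloor>. \<bar>a k i - b i\<bar> < e" for k
    proof -
      have "\<bar>step_path (Suc n) (a k) t - step_path (Suc n) b t\<bar> < e" if "t \<in> {0..T}" for t
      proof -
        have "nat \<lfloor>real (Suc n) * t\<rfloor> \<le> nat \<lfloor>real (Suc n) * T\<rfloor>"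
          using that by (intro nat_mono floor_mono mult_left_mono) auto
        then show ?thesis unfolding step_path_def using k by blast
      qed
      then show ?thesis unfolding skorohod_nbhd_def
        using time_change_id cadlag_step_path[of "Suc n" "a k"] e by (auto intro!: exI[of _ "\<lambda>t. t"])
    qed
    show "eventually (\<lambda>k. step_path (Suc n) (a k) \<in> skorohod_nbhd (step_path (Suc n) b) T e) sequentially"
      using tendsto_coordinates_eventually[OF ab e] by (rule eventually_mono) (use mem in blast)
  qed
qed

section \<open>Polygonal approximation of continuous paths\<close>

definition polygonal_path :: "nat \<Rightarrow> nat \<Rightarrow> (nat \<Rightarrow> real) \<Rightarrow> real \<Rightarrow> real" where
  "polygonal_path n m a t = a 0 + (\<Sum>i<m. (a (Suc i) - a i) * max 0 (min 1 (real n * t - real i)))"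

lemma polygonal_path_cell:
  assumes k: "real k \<le> real n * t" "real n * t < real k + 1" and "k < m"
  shows "polygonal_path n m a t = a k + (a (Suc k) - a k) * (real n * t - real k)"
proof -
  let ?g = "\<lambda>i. (a (Suc i) - a i) * max 0 (min 1 (real n * t - real i))"
  have "sum ?g {..<m} = sum ?g {..<Suc k}"
  proof (rule sum.mono_neutral_right)
    show "\<forall>i\<in>{..<m} - {..<Suc k}. ?g i = 0"
    proof
      fix i assume "i \<in> {..<m} - {..<Suc k}"
      then have "real k + 1 \<le> real i" by auto
      then show "?g i = 0" using k by simp
    qed
  qed (use \<open>k < m\<close> in auto)
  also have "\<dots> = sum ?g {..<k} + ?g k" by simp
  also have "sum ?g {..<k} = (\<Sum>i<k. a (Suc i) - a i)"
  proof (rule sum.cong[OF refl])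
    fix i assume "i \<in> {..<k}"
    then have "real i + 1 \<le> real k" by auto
    then have "1 \<le> real n * t - real i" using k by simp
    then show "?g i = a (Suc i) - a i" by simp
  qed
  also have "\<dots> = a k - a 0" by (rule sum_lessThan_telescope)
  finally show ?thesis using k unfolding polygonal_path_def by simp
qed

lemma continuous_on_polygonal_path: "continuous_on A (polygonal_path n m a)"
  unfolding polygonal_path_def by (intro continuous_intros)

text \<open>(n+1)^2 ramps of width 1/(n+1) cover [0, n+1], so every window is eventually covered. On
  a cell the polygon is a convex combination of two nearby values of x, and uniform continuity on
  [0, T+1] applies; the extra unit accommodates the right node.\<close>

lemma polygonal_path_sampling_limit:
  assumes x: "continuous_on {0..} x"
  shows "limitin ucc_topology
    (\<lambda>n. polygonal_path (Suc n) (Suc n * Suc n) (\<lambda>i. x (real i / real (Suc n)))) x sequentially"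
proof (rule limitin_uccI[OF x])
  fix T e :: real assume e: "e > 0"
  have "uniformly_continuous_on {0..T + 1} x"
    using x by (intro compact_uniformly_continuous continuous_on_subset[OF x]) auto
  then obtain d where d: "d > 0" "\<And>s t. s \<in> {0..T + 1} \<Longrightarrow> t \<in> {0..T + 1} \<Longrightarrow> dist t s < d \<Longrightarrow> dist (x t) (x s) < e"
    unfolding uniformly_continuous_on_def using e by blast
  have mem: "polygonal_path (Suc n) (Suc n * Suc n) (\<lambda>i. x (real i / real (Suc n))) \<in> ucc_nbhd x T e"
    if n: "real n > 1 / d" "real n > T" for n
  proof -
    define m where "m = real (Suc n)"
    have m: "m > 1 / d" "m > T" "m \<ge> 1" using n unfolding m_def by simp_all
    have md: "1 / m < d" "1 / m \<le> 1" using m d(1) by (simp_all add: field_simps)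
    have "\<bar>polygonal_path (Suc n) (Suc n * Suc n) (\<lambda>i. x (real i / m)) t - x t\<bar> < e"
      if t: "t \<in> {0..T}" for t
    proof -
      have "0 \<le> m * t" using t m by simp
      then obtain k where k: "real k \<le> m * t" "m * t < real k + 1" by (rule nat_cell)
      have "m * t < m * m" using m t by (intro mult_strict_left_mono) auto
      then have "real k < m * m" using k by linarith
      then have "real k < real (Suc n * Suc n)" by (simp only: m_def of_nat_mult)
      then have "k < Suc n * Suc n" by linarith
      define p where "p = m * t - real k"
      have p: "0 \<le> p" "p \<le> 1" using k unfolding p_def by simp_all
      have eq: "polygonal_path (Suc n) (Suc n * Suc n) (\<lambda>i. x (real i / m)) t - x t =
        (1 - p) * (x (real k / m) - x t) + p * (x (real (Suc k) / m) - x t)"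
        using polygonal_path_cell[OF k[unfolded m_def] \<open>k < Suc n * Suc n\<close>, of "\<lambda>i. x (real i / m)"]
        unfolding p_def m_def[symmetric] by (simp add: algebra_simps)
      have b: "real k / m \<le> t" "t \<le> real (Suc k) / m" "t < real k / m + 1 / m" "real (Suc k) / m \<le> t + 1 / m"
        using k m by (simp_all add: field_simps)
      have "0 \<le> real k / m" "0 \<le> real (Suc k) / m" using m by simp_all
      then have mem: "t \<in> {0..T + 1}" "real k / m \<in> {0..T + 1}" "real (Suc k) / m \<in> {0..T + 1}"
        using b md t unfolding atLeastAtMost_iff by linarith+
      have "dist (real k / m) t < d" "dist (real (Suc k) / m) t < d"
        using b md unfolding dist_real_def by linarith+
      then have c: "\<bar>x (real k / m) - x t\<bar> < e" "\<bar>x (real (Suc k) / m) - x t\<bar> < e"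
        using d(2)[OF mem(1,2)] d(2)[OF mem(1,3)] unfolding dist_real_def by simp_all
      have "\<bar>(1 - p) * (x (real k / m) - x t) + p * (x (real (Suc k) / m) - x t)\<bar> < e"
      proof -
        have "\<bar>(1 - p) * (x (real k / m) - x t) + p * (x (real (Suc k) / m) - x t)\<bar>
          \<le> (1 - p) * \<bar>x (real k / m) - x t\<bar> + p * \<bar>x (real (Suc k) / m) - x t\<bar>"
          using p by (metis abs_mult abs_of_nonneg abs_triangle_ineq diff_ge_0_iff_ge)
        also have "\<dots> < e" using c p by (intro convex_bound_lt) auto
        finally show ?thesis .
      qed
      then show ?thesis unfolding eq .
    qed
    then show ?thesis unfolding ucc_nbhd_def m_def using continuous_on_polygonal_path by blast
  qed
  moreover have "eventually (\<lambda>n. real n > 1 / d \<and> real n > T) sequentially"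
    by (intro eventually_conj)
      (metis eventually_at_top_dense filterlim_at_top_dense filterlim_real_sequentially)+
  ultimately show "eventually (\<lambda>n. polygonal_path (Suc n) (Suc n * Suc n) (\<lambda>i. x (real i / real (Suc n))) \<in> ucc_nbhd x T e) sequentially"
    by (auto elim: eventually_mono)
qed

lemma ucc_functional_measurable:
  assumes f: "continuous_map ucc_topology euclideanreal f" and Y: "process M Y"
    and cont: "\<And>\<omega>. \<omega> \<in> space M \<Longrightarrow> continuous_on {0..} (\<lambda>t. Y t \<omega>)"
  shows "(\<lambda>\<omega>. f (\<lambda>t. Y t \<omega>)) \<in> borel_measurable M"
proof (rule path_functional_measurable[OF f Y])
  show "limitin ucc_topology (\<lambda>n. polygonal_path (Suc n) (Suc n * Suc n) (\<lambda>i. Y (real i / real (Suc n)) \<omega>))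
     (\<lambda>t. Y t \<omega>) sequentially" if "\<omega> \<in> space M" for \<omega>
    using polygonal_path_sampling_limit[OF cont[OF that]] .
  fix n :: nat and a :: "nat \<Rightarrow> nat \<Rightarrow> real" and b assume ab: "a \<longlonglongrightarrow> b"
  define N where "N = Suc n * Suc n"
  show "limitin ucc_topology (\<lambda>k. polygonal_path (Suc n) N (a k)) (polygonal_path (Suc n) N b) sequentially"
  proof (rule limitin_uccI[OF continuous_on_polygonal_path])
    fix T e :: real assume e: "e > 0"
    \<comment> \<open>Each of the \<open>N\<close> increments contributes at most
      \<open>2 * e'\<close> and the initial value at most \<open>e'\<close>; the denominator exceeds
      2N + 1 to keep the bound strict.\<close>
    define e' where "e' = e / (2 * real N + 2)"
    have e': "e' > 0" using e unfolding e'_def by simp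
    have bound: "\<bar>polygonal_path (Suc n) N (a k) t - polygonal_path (Suc n) N b t\<bar> < e"
      if k: "\<forall>i\<le>N. \<bar>a k i - b i\<bar> < e'" for k t
    proof -
      define c where "c i = max 0 (min 1 (real (Suc n) * t - real i))" for i
      have "polygonal_path (Suc n) N (a k) t - polygonal_path (Suc n) N b t =
        (a k 0 - b 0) + (\<Sum>i<N. ((a k (Suc i) - b (Suc i)) - (a k i - b i)) * c i)"
      proof -
        have "(\<Sum>i<N. (a k (Suc i) - a k i) * c i) - (\<Sum>i<N. (b (Suc i) - b i) * c i) =
          (\<Sum>i<N. ((a k (Suc i) - b (Suc i)) - (a k i - b i)) * c i)"
          unfolding sum_subtractf[symmetric] by (intro sum.cong refl) (simp add: algebra_simps)
        then show ?thesis unfolding polygonal_path_def c_def[symmetric] by simp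
      qed
      also have "\<bar>\<dots>\<bar> \<le> \<bar>a k 0 - b 0\<bar> + (\<Sum>i<N. \<bar>((a k (Suc i) - b (Suc i)) - (a k i - b i)) * c i\<bar>)"
        by (rule order_trans[OF abs_triangle_ineq add_left_mono[OF sum_abs]])
      also have "\<dots> \<le> e' + (\<Sum>i<N. 2 * e')"
      proof (intro add_mono sum_mono)
        show "\<bar>a k 0 - b 0\<bar> \<le> e'" using k by (simp add: less_imp_le)
        fix i assume i: "i \<in> {..<N}"
        have "\<bar>a k (Suc i) - b (Suc i)\<bar> < e'" "\<bar>a k i - b i\<bar> < e'" using k i by auto
        then have 1: "\<bar>(a k (Suc i) - b (Suc i)) - (a k i - b i)\<bar> \<le> 2 * e'" by linarith
        have "\<bar>c i\<bar> \<le> 1" unfolding c_def by auto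
        with 1 have "\<bar>(a k (Suc i) - b (Suc i)) - (a k i - b i)\<bar> * \<bar>c i\<bar> \<le> 2 * e' * 1"
          using e' by (intro mult_mono) auto
        then show "\<bar>((a k (Suc i) - b (Suc i)) - (a k i - b i)) * c i\<bar> \<le> 2 * e'" by (simp add: abs_mult)
      qed
      also have "\<dots> = e' * (2 * real N + 1)" by (simp add: algebra_simps)
      also have "\<dots> < e' * (2 * real N + 2)" using e' by simp
      also have "\<dots> = e" unfolding e'_def by simp
      finally show ?thesis .
    qed
    show "eventually (\<lambda>k. polygonal_path (Suc n) N (a k) \<in> ucc_nbhd (polygonal_path (Suc n) N b) T e) sequentially"
      using tendsto_coordinates_eventually[OF ab e', of N]
      by (rule eventually_mono) (use bound continuous_on_polygonal_path in \<open>auto simp: ucc_nbhd_def\<close>)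
  qed
qed

subsection \<open>A mapping theorem for weak convergence\<close>

text \<open>One number serves as tolerance and, inverted, as time window. Inserting 1 caps the value
  and covers the case of no admissible \<open>e\<close>. The function is not symmetric because the
  window is measured on the time axis of \<open>x\<close>.\<close>

definition skorohod_dist :: "(real \<Rightarrow> real) \<Rightarrow> (real \<Rightarrow> real) \<Rightarrow> real" where
  "skorohod_dist x y = Inf (insert 1 {e. 0 < e \<and> e < 1 \<and> y \<in> skorohod_nbhd x (1 / e) e})"

lemma skorohod_dist_bdd: "bdd_below (insert 1 {e::real. 0 < e \<and> e < 1 \<and> P e})"
  by (rule bdd_belowI[of _ 0]) auto

lemma skorohod_dist_le_one: "skorohod_dist x y \<le> 1"
  unfolding skorohod_dist_def by (intro cInf_lower skorohod_dist_bdd) auto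

lemma skorohod_dist_nonneg: "0 \<le> skorohod_dist x y"
  unfolding skorohod_dist_def by (intro cInf_greatest) auto

lemma skorohod_dist_le:
  "0 < e \<Longrightarrow> e < 1 \<Longrightarrow> y \<in> skorohod_nbhd x (1 / e) e \<Longrightarrow> skorohod_dist x y \<le> e"
  unfolding skorohod_dist_def by (intro cInf_lower skorohod_dist_bdd) auto

lemma skorohod_dist_less_obtain:
  assumes "skorohod_dist x y < r" "r \<le> 1"
  obtains e where "0 < e" "e < r" "y \<in> skorohod_nbhd x (1 / e) e"
proof -
  obtain e where "e \<in> insert 1 {e. 0 < e \<and> e < 1 \<and> y \<in> skorohod_nbhd x (1 / e) e}" "e < r"
    using assms(1) unfolding skorohod_dist_def by (subst (asm) cInf_less_iff[OF _ skorohod_dist_bdd]) auto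
  then show ?thesis using that assms(2) by auto
qed

lemma skorohod_dist_self: assumes "cadlag x" shows "skorohod_dist x x = 0"
proof (rule antisym)
  show "skorohod_dist x x \<le> 0"
  proof (rule field_le_epsilon)
    fix e :: real assume "0 < e"
    then have "skorohod_dist x x \<le> min e (1/2)"
      using skorohod_nbhd_self[OF assms] by (intro skorohod_dist_le) auto
    then show "skorohod_dist x x \<le> 0 + e" by simp
  qed
qed (rule skorohod_dist_nonneg)

text \<open>The radius \<open>1 / e\<close> of the time window makes the composition of time changes compatible with
  addition: \<open>1 / (a + b) + a \<le> 1 / b\<close> whenever \<open>a + b \<le> 1\<close>.\<close>

lemma skorohod_nbhd_compose:
  assumes y: "y \<in> skorohod_nbhd x (1 / a) a" and w: "w \<in> skorohod_nbhd y (1 / b) b"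
    and ab: "0 < a" "0 < b" "a + b \<le> 1"
  shows "w \<in> skorohod_nbhd x (1 / (a + b)) (a + b)"
proof -
  obtain f where f: "time_change f" "\<And>t. t \<ge> 0 \<Longrightarrow> \<bar>f t - t\<bar> < a"
    "\<And>t. t \<in> {0..1 / a} \<Longrightarrow> \<bar>y (f t) - x t\<bar> < a" using y unfolding skorohod_nbhd_def by blast
  obtain g where g: "cadlag w" "time_change g" "\<And>t. t \<ge> 0 \<Longrightarrow> \<bar>g t - t\<bar> < b"
    "\<And>t. t \<in> {0..1 / b} \<Longrightarrow> \<bar>w (g t) - y t\<bar> < b" using w unfolding skorohod_nbhd_def by blast
  have window: "1 / (a + b) + a \<le> 1 / b"
  proof -
    have "a * (b * (a + b)) \<le> a * 1"
      using ab by (intro mult_left_mono mult_le_one) auto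
    then show ?thesis using ab by (simp add: field_simps)
  qed
  have le: "1 / (a + b) \<le> 1 / a" using ab by (simp add: field_simps)
  have "\<bar>(g \<circ> f) t - t\<bar> < a + b" if "t \<ge> 0" for t
    using f(2)[OF that] g(3)[OF time_change_nonneg[OF f(1) that]] unfolding comp_def by linarith
  moreover have "\<bar>w ((g \<circ> f) t) - x t\<bar> < a + b" if t: "t \<in> {0..1 / (a + b)}" for t
  proof -
    have t': "0 \<le> t" "t \<le> 1 / (a + b)" using t by auto
    have "f t \<in> {0..1 / b}"
      using time_change_nonneg[OF f(1) t'(1)] f(2)[OF t'(1)] t' window unfolding atLeastAtMost_iff by linarith
    moreover have "t \<in> {0..1 / a}" using t' le unfolding atLeastAtMost_iff by linarith
    ultimately show ?thesis using g(4)[of "f t"] f(3)[of t] unfolding comp_def by linarith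
  qed
  ultimately show ?thesis
    unfolding skorohod_nbhd_def using g(1) time_change_comp[OF f(1) g(2)] by blast
qed

lemma skorohod_dist_triangle: "skorohod_dist x w \<le> skorohod_dist x y + skorohod_dist y w"
proof (rule field_le_epsilon)
  fix e :: real assume e: "0 < e"
  show "skorohod_dist x w \<le> skorohod_dist x y + skorohod_dist y w + e"
  \<comment> \<open>If the right-hand side reaches 1 the cap suffices; otherwise the two
    neighbourhoods compose.\<close>
  proof (cases "skorohod_dist x y + skorohod_dist y w + e < 1")
    case False
    then show ?thesis using skorohod_dist_le_one[of x w] by linarith
  next
    case True
    have "skorohod_dist x y < skorohod_dist x y + e / 2" "skorohod_dist x y + e / 2 \<le> 1"
      using e True skorohod_dist_nonneg[of y w] by linarith+
    then obtain a where a: "0 < a" "a < skorohod_dist x y + e / 2" "y \<in> skorohod_nbhd x (1 / a) a"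
      by (rule skorohod_dist_less_obtain)
    have "skorohod_dist y w < skorohod_dist y w + e / 2" "skorohod_dist y w + e / 2 \<le> 1"
      using e True skorohod_dist_nonneg[of x y] by linarith+
    then obtain b where b: "0 < b" "b < skorohod_dist y w + e / 2" "w \<in> skorohod_nbhd y (1 / b) b"
      by (rule skorohod_dist_less_obtain)
    have "skorohod_dist x w \<le> a + b"
      using a b True skorohod_nbhd_compose[OF a(3) b(3)] by (intro skorohod_dist_le) auto
    then show ?thesis using a b by linarith
  qed
qed

text \<open>The inverse time change moves times by up to \<open>e\<close>, which accounts for the
  loss in the window.\<close>

lemma skorohod_nbhd_flip:
  assumes x: "cadlag x" and y: "y \<in> skorohod_nbhd x (T + e) e" and "0 < e"
  shows "x \<in> skorohod_nbhd y T e"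
proof -
  obtain f where f: "time_change f" "\<And>t. t \<ge> 0 \<Longrightarrow> \<bar>f t - t\<bar> < e"
    "\<And>t. t \<in> {0..T + e} \<Longrightarrow> \<bar>y (f t) - x t\<bar> < e" using y unfolding skorohod_nbhd_def by blast
  obtain g where g: "time_change g" "\<And>t. 0 \<le> t \<Longrightarrow> f (g t) = t"
    by (rule time_change_inverse[OF f(1)]) blast
  have d: "\<bar>g t - t\<bar> < e" if t: "0 \<le> t" for t
    using f(2)[OF time_change_nonneg[OF g(1) t]] g(2)[OF t] by linarith
  have "\<bar>x (g t) - y t\<bar> < e" if t: "t \<in> {0..T}" for t
  proof -
    have t': "0 \<le> t" "t \<le> T" using t by auto
    have "g t \<in> {0..T + e}"
      using time_change_nonneg[OF g(1) t'(1)] d[OF t'(1)] t' unfolding atLeastAtMost_iff by linarith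
    from f(3)[OF this] show ?thesis using g(2)[OF t'(1)] by (simp add: abs_minus_commute)
  qed
  then show ?thesis unfolding skorohod_nbhd_def using x g(1) d by blast
qed

text \<open>The hypothesis bounds \<open>h x - h y\<close> by the distance in one order of
  arguments. Continuity at \<open>x\<close> uses both orders, and flipping a neighbourhood with
  enlarged window makes both distances small.\<close>

lemma continuous_map_skorohod_Lipschitz:
  assumes L: "L \<ge> 0" and h: "\<And>x y. cadlag x \<Longrightarrow> cadlag y \<Longrightarrow> h x \<le> h y + L * skorohod_dist y x"
  shows "continuous_map skorohod_topology euclideanreal h"
proof -
  have cont: "\<exists>T. \<exists>\<epsilon>>0. \<forall>y\<in>skorohod_nbhd x T \<epsilon>. \<bar>h y - h x\<bar> < r" if x: "cadlag x" and r: "r > 0" for x r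
  proof -
    \<comment> \<open>\<open>L + 1\<close> in place of \<open>L\<close> makes the bound
      \<open>L * e < r\<close> strict and covers \<open>L = 0\<close>.\<close>
    define e where "e = min (1/2) (r / (2 * (L + 1)))"
    have e: "0 < e" "e < 1" using r L unfolding e_def by auto
    have "e \<le> r / (2 * (L + 1))" unfolding e_def by simp
    then have "e * (2 * (L + 1)) \<le> r" using L by (simp add: pos_le_divide_eq)
    then have "2 * (L * e) + 2 * e \<le> r" by (simp add: algebra_simps)
    moreover have "0 \<le> L * e" using L e by simp
    ultimately have Le: "L * e < r" using e by linarith
    have "\<bar>h y - h x\<bar> < r" if y: "y \<in> skorohod_nbhd x (1 / e + e) e" for y
    proof -
      have cy: "cadlag y" using y unfolding skorohod_nbhd_def by blast
      have "y \<in> skorohod_nbhd x (1 / e) e" using skorohod_nbhd_mono[of "1 / e" "1 / e + e" e e x] y e by auto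
      then have 1: "skorohod_dist x y \<le> e" using e by (intro skorohod_dist_le)
      have 2: "skorohod_dist y x \<le> e" using e skorohod_nbhd_flip[OF x y e(1)] by (intro skorohod_dist_le)
      have "L * skorohod_dist x y \<le> L * e" "L * skorohod_dist y x \<le> L * e"
        using 1 2 L by (simp_all add: mult_left_mono)
      then show ?thesis using h[OF x cy] h[OF cy x] Le by linarith
    qed
    then show ?thesis using e(1) by blast
  qed
  show ?thesis
    unfolding continuous_map_def topspace_skorohod
  proof (intro conjI allI impI)
    fix V :: "real set" assume "openin euclideanreal V"
    then have V: "open V" by simp
    show "openin skorohod_topology {x \<in> Collect cadlag. h x \<in> V}"
      unfolding openin_skorohod
    proof (intro conjI ballI)
      fix x assume x: "x \<in> {x \<in> Collect cadlag. h x \<in> V}"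
      then obtain r where r: "r > 0" "ball (h x) r \<subseteq> V" using V open_contains_ball_eq by blast
      obtain T e where e: "e > 0" "\<forall>y\<in>skorohod_nbhd x T e. \<bar>h y - h x\<bar> < r" using cont[of x r] x r by auto
      have "skorohod_nbhd x T e \<subseteq> {x \<in> Collect cadlag. h x \<in> V}"
      proof
        fix y assume y: "y \<in> skorohod_nbhd x T e"
        then have "\<bar>h y - h x\<bar> < r" using e by blast
        then have "h y \<in> V" using r(2) by (auto simp: dist_real_def abs_minus_commute)
        moreover have "cadlag y" using y unfolding skorohod_nbhd_def by blast
        ultimately show "y \<in> {x \<in> Collect cadlag. h x \<in> V}" by simp
      qed
      then show "\<exists>T. \<exists>\<epsilon>>0. skorohod_nbhd x T \<epsilon> \<subseteq> {x \<in> Collect cadlag. h x \<in> V}" using e(1) by blast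
    qed auto
  qed auto
qed

text \<open>The test function \<open>f\<close>, pulled back along the relation \<open>Q n\<close> for \<open>n \<ge> k\<close>, is dominated by its
  \<open>k\<close>-Lipschitz sup-convolution \<open>h k\<close>, to which the weak convergence applies; along almost every path of
  the limit, \<open>limsup h k\<close> is at most the value of \<open>f\<close>.\<close>

lemma weak_mapping_upper:
  fixes Q :: "nat \<Rightarrow> (real \<Rightarrow> real) \<Rightarrow> (real \<Rightarrow> real) \<Rightarrow> bool" and f :: "(real \<Rightarrow> real) \<Rightarrow> real"
  assumes prob: "prob_space M" "\<And>n. n \<ge> 1 \<Longrightarrow> prob_space (N n)"
    and weak: "weakly_converges skorohod_topology N Xn M X"
    and cX: "cadlag_process M X" and cXn: "\<And>n. n \<ge> 1 \<Longrightarrow> cadlag_process (N n) (Xn n)"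
    and topY: "\<And>\<omega>. \<omega> \<in> space M \<Longrightarrow> (\<lambda>t. Y t \<omega>) \<in> topspace T"
    and topYn: "\<And>n \<omega>. n \<ge> 1 \<Longrightarrow> \<omega> \<in> space (N n) \<Longrightarrow> (\<lambda>t. Yn n t \<omega>) \<in> topspace T"
    and mY: "(\<lambda>\<omega>. f (\<lambda>t. Y t \<omega>)) \<in> borel_measurable M"
    and mYn: "\<And>n. n \<ge> 1 \<Longrightarrow> (\<lambda>\<omega>. f (\<lambda>t. Yn n t \<omega>)) \<in> borel_measurable (N n)"
    and Q: "\<And>n. n \<ge> 1 \<Longrightarrow> AE \<omega> in N n. Q n (\<lambda>t. Xn n t \<omega>) (\<lambda>t. Yn n t \<omega>)"
    and lim: "AE \<omega> in M. \<forall>U. openin T U \<and> (\<lambda>t. Y t \<omega>) \<in> U \<longrightarrow>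
      (\<exists>S \<epsilon> m. 0 < \<epsilon> \<and> (\<forall>n\<ge>m. \<forall>x\<in>skorohod_nbhd (\<lambda>t. X t \<omega>) S \<epsilon>. \<forall>y\<in>topspace T. Q n x y \<longrightarrow> y \<in> U))"
    and f: "continuous_map T euclideanreal f" and B: "\<And>y. y \<in> topspace T \<Longrightarrow> \<bar>f y\<bar> \<le> B"
    and \<eta>: "\<eta> > 0"
  shows "eventually (\<lambda>n. (\<integral>\<omega>. f (\<lambda>t. Yn n t \<omega>) \<partial>N n) < (\<integral>\<omega>. f (\<lambda>t. Y t \<omega>) \<partial>M) + \<eta>) sequentially"
proof -
  interpret M: prob_space M by fact
  obtain \<omega>0 where "\<omega>0 \<in> space M" using M.not_empty by blast
  then have B0: "0 \<le> B" using B[OF topY] by fastforce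
  \<comment> \<open>\<open>k\<close> is both the slope of the penalty and the first admissible
    index, so a single limit in \<open>k\<close> sharpens the penalty and discards the early
    \<open>n\<close>.\<close>
  define A where "A k x = {f y - real k * skorohod_dist x x' | n x' y. k \<le> n \<and> cadlag x' \<and> Q n x' y \<and> y \<in> topspace T}"
    for k :: nat and x
  \<comment> \<open>\<open>- B\<close> keeps the supremum over a nonempty set, since there may be no
    pair related by \<open>Q\<close>; being a lower bound of \<open>f\<close>, it does not disturb
    the estimates.\<close>
  define h where "h k x = Sup (insert (- B) (A k x))" for k x
  have A_le: "a \<le> B" if "a \<in> A k x" for a k x
  proof -
    obtain x' y where a: "a = f y - real k * skorohod_dist x x'" "y \<in> topspace T"
      using \<open>a \<in> A k x\<close> unfolding A_def by blast
    have "0 \<le> real k * skorohod_dist x x'" using skorohod_dist_nonneg by simp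
    then show ?thesis using a(1) B[OF a(2)] by linarith
  qed
  have bdd: "bdd_above (insert (- B) (A k x))" for k x
    using A_le B0 by (intro bdd_aboveI[of _ B]) auto
  have h_upper: "a \<le> h k x" if "a \<in> A k x" for a k x
    unfolding h_def using that bdd by (intro cSup_upper) auto
  have h_lower: "- B \<le> h k x" for k x unfolding h_def using bdd by (intro cSup_upper) auto
  have h_le: "h k x \<le> c" if "- B \<le> c" "\<And>a. a \<in> A k x \<Longrightarrow> a \<le> c" for k x c
    unfolding h_def using that by (intro cSup_least) auto
  have h_abs: "\<bar>h k x\<bar> \<le> B" for k x
    using h_lower[of k x] h_le[of B k x] A_le B0 by (intro abs_leI) auto
  have h_cont: "continuous_map skorohod_topology euclideanreal (h k)" for k
  proof (rule continuous_map_skorohod_Lipschitz[of "real k"])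
    fix x w
    have nn: "0 \<le> real k * skorohod_dist w x" using skorohod_dist_nonneg by simp
    show "h k x \<le> h k w + real k * skorohod_dist w x"
    proof (rule h_le)
      show "- B \<le> h k w + real k * skorohod_dist w x" using h_lower[of k w] nn by linarith
      fix a assume "a \<in> A k x"
      then obtain n x' y where a: "a = f y - real k * skorohod_dist x x'"
        "k \<le> n" "cadlag x'" "Q n x' y" "y \<in> topspace T" unfolding A_def by blast
      have "f y - real k * skorohod_dist w x' \<le> h k w"
        by (rule h_upper) (use a in \<open>auto simp: A_def\<close>)
      moreover have "real k * skorohod_dist w x' \<le> real k * (skorohod_dist w x + skorohod_dist x x')"
        by (intro mult_left_mono skorohod_dist_triangle) simp
      ultimately show "a \<le> h k w + real k * skorohod_dist w x" using a(1) by (simp add: distrib_left)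
    qed
  qed simp
  have h_dom: "AE \<omega> in N n. f (\<lambda>t. Yn n t \<omega>) \<le> h k (\<lambda>t. Xn n t \<omega>)" if n: "n \<ge> 1" "n \<ge> k" for n k
    using Q[OF n(1)]
  proof (rule AE_mp, intro AE_I2 impI)
    fix \<omega> assume w: "\<omega> \<in> space (N n)" "Q n (\<lambda>t. Xn n t \<omega>) (\<lambda>t. Yn n t \<omega>)"
    have c: "cadlag (\<lambda>t. Xn n t \<omega>)" using cXn[OF n(1)] w unfolding cadlag_process_def by blast
    have "f (\<lambda>t. Yn n t \<omega>) - real k * skorohod_dist (\<lambda>t. Xn n t \<omega>) (\<lambda>t. Xn n t \<omega>) \<le> h k (\<lambda>t. Xn n t \<omega>)"
      by (rule h_upper) (unfold A_def, intro CollectI exI conjI, rule refl, use c w n topYn[OF n(1) w(1)] in auto)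
    then show "f (\<lambda>t. Yn n t \<omega>) \<le> h k (\<lambda>t. Xn n t \<omega>)" by (simp add: skorohod_dist_self[OF c])
  qed
  have h_lim: "AE \<omega> in M. \<forall>r>0. eventually (\<lambda>k. h k (\<lambda>t. X t \<omega>) \<le> f (\<lambda>t. Y t \<omega>) + r) sequentially"
    using lim
  proof (rule AE_mp, intro AE_I2 impI allI)
    fix \<omega> and r :: real
    assume w: "\<omega> \<in> space M" and r: "r > 0"
      and G: "\<forall>U. openin T U \<and> (\<lambda>t. Y t \<omega>) \<in> U \<longrightarrow>
      (\<exists>S \<epsilon> m. 0 < \<epsilon> \<and> (\<forall>n\<ge>m. \<forall>x\<in>skorohod_nbhd (\<lambda>t. X t \<omega>) S \<epsilon>. \<forall>y\<in>topspace T. Q n x y \<longrightarrow> y \<in> U))"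
    let ?x = "\<lambda>t. X t \<omega>" and ?y = "\<lambda>t. Y t \<omega>"
    define U where "U = {y \<in> topspace T. f y \<in> {..< f ?y + r}}"
    have "openin T U" unfolding U_def by (rule openin_continuous_map_preimage[OF f]) simp
    moreover have "?y \<in> U" unfolding U_def using topY[OF w] r by simp
    ultimately have "\<exists>S \<epsilon> m. 0 < \<epsilon> \<and>
        (\<forall>n\<ge>m. \<forall>x\<in>skorohod_nbhd ?x S \<epsilon>. \<forall>y\<in>topspace T. Q n x y \<longrightarrow> y \<in> U)"
      by (intro G[THEN spec, THEN mp] conjI)
    then obtain S \<epsilon> m where S: "0 < \<epsilon>"
      "\<forall>n\<ge>m. \<forall>x\<in>skorohod_nbhd ?x S \<epsilon>. \<forall>y\<in>topspace T. Q n x y \<longrightarrow> y \<in> U"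
      by (elim exE conjE)
    \<comment> \<open>A distance below \<open>\<delta>\<close> forces a tolerance under
      \<open>\<epsilon>\<close> and a window reaching beyond \<open>S\<close>.\<close>
    define \<delta> where "\<delta> = min 1 (min \<epsilon> (1 / (\<bar>S\<bar> + 1)))"
    have d: "0 < \<delta>" "\<delta> \<le> 1" "\<delta> \<le> \<epsilon>" using S(1) unfolding \<delta>_def by auto
    have close: "x' \<in> skorohod_nbhd ?x S \<epsilon>" if lt: "skorohod_dist ?x x' < \<delta>" for x'
    proof -
      obtain e where e: "0 < e" "e < \<delta>" "x' \<in> skorohod_nbhd ?x (1 / e) e"
        using skorohod_dist_less_obtain[OF lt d(2)] .
      have "e < 1 / (\<bar>S\<bar> + 1)" using e unfolding \<delta>_def by simp
      then have "\<bar>S\<bar> + 1 < 1 / e" using e(1) by (simp add: field_simps)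
      then have "S \<le> 1 / e" by linarith
      then show ?thesis using skorohod_nbhd_mono[of S "1 / e" e \<epsilon> ?x] e d by auto
    qed
    \<comment> \<open>Paths within \<open>\<delta>\<close> are governed by the hypothesis on the
      limit path; for all others a penalty of at least \<open>2 * B\<close> absorbs the whole range
      of \<open>f\<close>.\<close>
    have bound: "h k ?x \<le> f ?y + r" if k: "k \<ge> m" "2 * B / \<delta> \<le> real k" for k
    proof (rule h_le)
      show "- B \<le> f ?y + r" using B[OF topY[OF w]] r by linarith
      fix a assume "a \<in> A k ?x"
      then obtain n x' y where a: "a = f y - real k * skorohod_dist ?x x'"
        "k \<le> n" "cadlag x'" "Q n x' y" "y \<in> topspace T" unfolding A_def by blast
      show "a \<le> f ?y + r"
      proof (cases "skorohod_dist ?x x' < \<delta>")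
        case True
        then have "y \<in> U" using S(2)[rule_format, of n x' y] close a k by simp
        then have "f y < f ?y + r" unfolding U_def by simp
        moreover have "0 \<le> real k * skorohod_dist ?x x'" using skorohod_dist_nonneg by simp
        ultimately show ?thesis using a(1) by linarith
      next
        case False
        have "2 * B \<le> real k * \<delta>" using k(2) d(1) by (simp add: field_simps)
        also have "\<dots> \<le> real k * skorohod_dist ?x x'" using False by (intro mult_left_mono) auto
        finally show ?thesis using a(1) B[OF a(5)] B[OF topY[OF w]] r by linarith
      qed
    qed
    have "eventually (\<lambda>k. k \<ge> max m (nat \<lceil>2 * B / \<delta>\<rceil>)) sequentially" by (rule eventually_ge_at_top)
    then show "eventually (\<lambda>k. h k ?x \<le> f ?y + r) sequentially"
    proof eventually_elim
      case (elim k)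
      then show ?case by (intro bound) linarith+
    qed
  qed
  have mh: "(\<lambda>\<omega>. h k (\<lambda>t. X t \<omega>)) \<in> borel_measurable M" for k
    using skorohod_functional_measurable[OF h_cont cX] .
  have fY: "\<bar>f (\<lambda>t. Y t \<omega>)\<bar> \<le> B" if "\<omega> \<in> space M" for \<omega> using B[OF topY[OF that]] .
  \<comment> \<open>Only an upper bound for \<open>h k\<close> is available in the limit; taking the
    maximum with the limiting value turns it into convergence, to which dominated convergence
    applies.\<close>
  have "(\<lambda>k. \<integral>\<omega>. max (h k (\<lambda>t. X t \<omega>)) (f (\<lambda>t. Y t \<omega>)) \<partial>M) \<longlonglongrightarrow> (\<integral>\<omega>. f (\<lambda>t. Y t \<omega>) \<partial>M)"
  proof (rule integral_dominated_convergence[where w="\<lambda>_. B"])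
    show "AE \<omega> in M. (\<lambda>k. max (h k (\<lambda>t. X t \<omega>)) (f (\<lambda>t. Y t \<omega>))) \<longlonglongrightarrow> f (\<lambda>t. Y t \<omega>)"
      using h_lim
    proof (rule AE_mp, intro AE_I2 impI)
      fix \<omega> assume L: "\<forall>r>0. eventually (\<lambda>k. h k (\<lambda>t. X t \<omega>) \<le> f (\<lambda>t. Y t \<omega>) + r) sequentially"
      show "(\<lambda>k. max (h k (\<lambda>t. X t \<omega>)) (f (\<lambda>t. Y t \<omega>))) \<longlonglongrightarrow> f (\<lambda>t. Y t \<omega>)"
      proof (rule tendstoI)
        fix e :: real assume "e > 0"
        then have "eventually (\<lambda>k. h k (\<lambda>t. X t \<omega>) \<le> f (\<lambda>t. Y t \<omega>) + e / 2) sequentially" using L by simp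
        then show "eventually (\<lambda>k. dist (max (h k (\<lambda>t. X t \<omega>)) (f (\<lambda>t. Y t \<omega>))) (f (\<lambda>t. Y t \<omega>)) < e) sequentially"
          by (rule eventually_mono) (use \<open>e > 0\<close> in \<open>simp add: dist_real_def\<close>)
      qed
    qed
    show "AE \<omega> in M. norm (max (h k (\<lambda>t. X t \<omega>)) (f (\<lambda>t. Y t \<omega>))) \<le> B" for k
    proof (rule AE_I2)
      fix \<omega> assume "\<omega> \<in> space M"
      then show "norm (max (h k (\<lambda>t. X t \<omega>)) (f (\<lambda>t. Y t \<omega>))) \<le> B"
        using h_abs[of k "\<lambda>t. X t \<omega>"] fY[of \<omega>] by (simp add: max_def)
    qed
  qed (use mY mh in \<open>auto intro: borel_measurable_max\<close>)
  then have "eventually (\<lambda>k. (\<integral>\<omega>. max (h k (\<lambda>t. X t \<omega>)) (f (\<lambda>t. Y t \<omega>)) \<partial>M) < (\<integral>\<omega>. f (\<lambda>t. Y t \<omega>) \<partial>M) + \<eta>) sequentially"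
    using \<eta> by (intro order_tendstoD(2)) auto
  then obtain k where k: "(\<integral>\<omega>. max (h k (\<lambda>t. X t \<omega>)) (f (\<lambda>t. Y t \<omega>)) \<partial>M) < (\<integral>\<omega>. f (\<lambda>t. Y t \<omega>) \<partial>M) + \<eta>"
    unfolding eventually_sequentially by blast
  have intM: "integrable M g" if "g \<in> borel_measurable M" "\<And>\<omega>. \<omega> \<in> space M \<Longrightarrow> \<bar>g \<omega>\<bar> \<le> B" for g :: "'a \<Rightarrow> real"
    using that by (intro M.integrable_const_bound[where B=B] AE_I2) auto
  have "(\<integral>\<omega>. h k (\<lambda>t. X t \<omega>) \<partial>M) \<le> (\<integral>\<omega>. max (h k (\<lambda>t. X t \<omega>)) (f (\<lambda>t. Y t \<omega>)) \<partial>M)"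
    by (intro integral_mono intM) (use mh mY h_abs fY in \<open>auto intro: borel_measurable_max simp: max_def\<close>)
  then have k': "(\<integral>\<omega>. h k (\<lambda>t. X t \<omega>) \<partial>M) < (\<integral>\<omega>. f (\<lambda>t. Y t \<omega>) \<partial>M) + \<eta>" using k by linarith
  have "bounded (h k ` topspace skorohod_topology)"
    unfolding bounded_iff using h_abs by (intro exI[of _ B]) auto
  then have "(\<lambda>n. \<integral>\<omega>. h k (\<lambda>t. Xn n t \<omega>) \<partial>N n) \<longlonglongrightarrow> (\<integral>\<omega>. h k (\<lambda>t. X t \<omega>) \<partial>M)"
    using weak h_cont[of k] unfolding weakly_converges_def by blast
  then have "eventually (\<lambda>n. (\<integral>\<omega>. h k (\<lambda>t. Xn n t \<omega>) \<partial>N n) < (\<integral>\<omega>. f (\<lambda>t. Y t \<omega>) \<partial>M) + \<eta>) sequentially"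
    using k' by (rule order_tendstoD(2))
  moreover have "eventually (\<lambda>n. n \<ge> max 1 k) sequentially" by (rule eventually_ge_at_top)
  ultimately show ?thesis
  proof eventually_elim
    case (elim n)
    then have n: "n \<ge> 1" "n \<ge> k" by simp_all
    interpret N: prob_space "N n" using prob(2)[OF n(1)] .
    have "(\<integral>\<omega>. f (\<lambda>t. Yn n t \<omega>) \<partial>N n) \<le> (\<integral>\<omega>. h k (\<lambda>t. Xn n t \<omega>) \<partial>N n)"
    proof (rule integral_mono_AE)
      show "integrable (N n) (\<lambda>\<omega>. f (\<lambda>t. Yn n t \<omega>))"
        using mYn[OF n(1)] B[OF topYn[OF n(1)]] by (intro N.integrable_const_bound[where B=B] AE_I2) auto
      show "integrable (N n) (\<lambda>\<omega>. h k (\<lambda>t. Xn n t \<omega>))"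
        using skorohod_functional_measurable[OF h_cont cXn[OF n(1)]] h_abs
        by (intro N.integrable_const_bound[where B=B] AE_I2) auto
    qed (rule h_dom[OF n])
    then show ?case using elim by linarith
  qed
qed

text \<open>The upper estimate for \<open>f\<close> and for \<open>- f\<close> gives the two halves.
  \<open>Q\<close> is a relation rather than a map: it records the path equations linking driver and
  output, and holds along the approximating paths almost surely.\<close>

lemma weak_mapping:
  fixes Q :: "nat \<Rightarrow> (real \<Rightarrow> real) \<Rightarrow> (real \<Rightarrow> real) \<Rightarrow> bool"
  assumes prob: "prob_space M" "\<And>n. n \<ge> 1 \<Longrightarrow> prob_space (N n)"
    and weak: "weakly_converges skorohod_topology N Xn M X"
    and cX: "cadlag_process M X" and cXn: "\<And>n. n \<ge> 1 \<Longrightarrow> cadlag_process (N n) (Xn n)"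
    and topY: "\<And>\<omega>. \<omega> \<in> space M \<Longrightarrow> (\<lambda>t. Y t \<omega>) \<in> topspace T"
    and topYn: "\<And>n \<omega>. n \<ge> 1 \<Longrightarrow> \<omega> \<in> space (N n) \<Longrightarrow> (\<lambda>t. Yn n t \<omega>) \<in> topspace T"
    and mY: "\<And>f. continuous_map T euclideanreal f \<Longrightarrow> (\<lambda>\<omega>. f (\<lambda>t. Y t \<omega>)) \<in> borel_measurable M"
    and mYn: "\<And>f n. continuous_map T euclideanreal f \<Longrightarrow> n \<ge> 1 \<Longrightarrow>
      (\<lambda>\<omega>. f (\<lambda>t. Yn n t \<omega>)) \<in> borel_measurable (N n)"
    and Q: "\<And>n. n \<ge> 1 \<Longrightarrow> AE \<omega> in N n. Q n (\<lambda>t. Xn n t \<omega>) (\<lambda>t. Yn n t \<omega>)"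
    and lim: "AE \<omega> in M. \<forall>U. openin T U \<and> (\<lambda>t. Y t \<omega>) \<in> U \<longrightarrow>
      (\<exists>S \<epsilon> m. 0 < \<epsilon> \<and> (\<forall>n\<ge>m. \<forall>x\<in>skorohod_nbhd (\<lambda>t. X t \<omega>) S \<epsilon>. \<forall>y\<in>topspace T. Q n x y \<longrightarrow> y \<in> U))"
  shows "weakly_converges T N Yn M Y"
  unfolding weakly_converges_def
proof (intro allI impI)
  fix f assume "continuous_map T euclideanreal f \<and> bounded (f ` topspace T)"
  then have f: "continuous_map T euclideanreal f" and bf: "bounded (f ` topspace T)" by auto
  obtain B where B: "\<And>y. y \<in> topspace T \<Longrightarrow> \<bar>f y\<bar> \<le> B" using bf unfolding bounded_iff by auto
  have f': "continuous_map T euclideanreal (\<lambda>y. - f y)" using f by (intro continuous_intros)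
  have B': "\<And>y. y \<in> topspace T \<Longrightarrow> \<bar>- f y\<bar> \<le> B" using B by simp
  show "(\<lambda>n. \<integral>\<omega>. f (\<lambda>t. Yn n t \<omega>) \<partial>N n) \<longlonglongrightarrow> (\<integral>\<omega>. f (\<lambda>t. Y t \<omega>) \<partial>M)"
  proof (rule tendstoI)
    fix e :: real assume e: "e > 0"
    have "eventually (\<lambda>n. (\<integral>\<omega>. f (\<lambda>t. Yn n t \<omega>) \<partial>N n) < (\<integral>\<omega>. f (\<lambda>t. Y t \<omega>) \<partial>M) + e) sequentially"
      by (rule weak_mapping_upper[OF prob weak cX cXn topY topYn mY[OF f] mYn[OF f] Q lim f B e])
    moreover have "eventually (\<lambda>n. (\<integral>\<omega>. - f (\<lambda>t. Yn n t \<omega>) \<partial>N n) < (\<integral>\<omega>. - f (\<lambda>t. Y t \<omega>) \<partial>M) + e) sequentially"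
      by (rule weak_mapping_upper[OF prob weak cX cXn topY topYn mY[OF f'] mYn[OF f'] Q lim f' B' e])
    ultimately show "eventually (\<lambda>n. dist (\<integral>\<omega>. f (\<lambda>t. Yn n t \<omega>) \<partial>N n) (\<integral>\<omega>. f (\<lambda>t. Y t \<omega>) \<partial>M) < e) sequentially"
    proof eventually_elim
      case (elim n)
      then have "(\<integral>\<omega>. f (\<lambda>t. Y t \<omega>) \<partial>M) - e < (\<integral>\<omega>. f (\<lambda>t. Yn n t \<omega>) \<partial>N n)" by simp
      then show ?case using elim(1) unfolding dist_real_def by linarith
    qed
  qed
qed

subsection \<open>The limit equation\<close>

lemma cadlag_tendsto_left_lim:
  assumes "cadlag x" "t > 0" shows "(x \<longlongrightarrow> left_lim x t) (at_left t)"
proof -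
  obtain l where l: "(x \<longlongrightarrow> l) (at_left t)" using assms unfolding cadlag_def by blast
  then have "left_lim x t = l" unfolding left_lim_def by (intro tendsto_Lim) simp_all
  then show ?thesis using l by simp
qed

lemma no_negative_jump_bound:
  assumes "cadlag x" "t > 0" "left_lim x t \<le> x t" "\<eta> > 0"
  obtains b where "b < t" "\<And>s. b < s \<Longrightarrow> s < t \<Longrightarrow> x s < x t + \<eta>"
proof -
  have "eventually (\<lambda>s. x s < x t + \<eta>) (at_left t)"
    using cadlag_tendsto_left_lim[OF assms(1,2)] assms(3,4) by (intro order_tendstoD(2)) auto
  then show ?thesis using that unfolding eventually_at_left_field by blast
qed

lemma set_integral_indicator_eq_measure:
  assumes "S \<in> sets lborel" "\<And>s. s \<in> {0..t} \<Longrightarrow> Z s \<in> A \<longleftrightarrow> s \<in> S"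
  shows "(LBINT s:{0..t}. indicat_real A (Z s)) = measure lborel ({0..t} \<inter> S)"
proof -
  have "(LBINT s:{0..t}. indicat_real A (Z s)) = (\<integral>s. indicat_real ({0..t} \<inter> S) s \<partial>lborel)"
    unfolding set_lebesgue_integral_def
    by (intro Bochner_Integration.integral_cong refl) (use assms(2) in \<open>auto simp: indicator_def\<close>)
  also have "\<dots> = measure lborel ({0..t} \<inter> S \<inter> space lborel)" by (rule Bochner_Integration.integral_indicator)
  finally show ?thesis by simp
qed

lemma interval_Int_fmeasurable:
  assumes "S \<in> sets lborel"
  shows "{s..t::real} \<inter> S \<in> fmeasurable lborel" "{s<..t::real} \<inter> S \<in> fmeasurable lborel"
proof -
  have "{s..t} \<in> fmeasurable lborel" by (cases "s \<le> t") (auto intro: fmeasurableI)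
  then show "{s..t} \<inter> S \<in> fmeasurable lborel" "{s<..t} \<inter> S \<in> fmeasurable lborel"
    using assms by (auto intro: fmeasurableI2)
qed

lemma measure_interval_split:
  assumes S: "S \<in> sets lborel" and "0 \<le> s" "s \<le> (t::real)"
  shows "measure lborel ({0..t} \<inter> S) = measure lborel ({0..s} \<inter> S) + measure lborel ({s<..t} \<inter> S)"
proof -
  have "{0..t} \<inter> S = ({0..s} \<inter> S) \<union> ({s<..t} \<inter> S)" using assms by auto
  moreover have "{0..s} \<inter> S \<in> fmeasurable lborel" "{s<..t} \<inter> S \<in> fmeasurable lborel"
    using S by (rule interval_Int_fmeasurable)+
  moreover have "({0..s} \<inter> S) \<inter> ({s<..t} \<inter> S) = {}" by auto
  ultimately show ?thesis
    by (simp add: measure_Un3)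
qed

text \<open>The limit equation frozen at one sample point, so that the comparison estimates are free
  of probability.\<close>

locale sticky_path =
  fixes x Z C :: "real \<Rightarrow> real" and \<gamma> z :: real
  assumes \<gamma>: "\<gamma> > 0" and z: "0 \<le> z"
    and cadlag_x: "cadlag x" and x0: "x 0 = 0" and jumps: "\<And>t. t > 0 \<Longrightarrow> left_lim x t \<le> x t"
    and cadlag_Z: "cadlag Z"
    and Z_eq: "\<And>t. t \<ge> 0 \<Longrightarrow> Z t = z + x (C t) + \<gamma> * (LBINT s:{0..t}. indicat_real {0} (Z s))"
    and C_eq: "\<And>t. t \<ge> 0 \<Longrightarrow> C t = (LBINT s:{0..t}. indicat_real {0<..} (Z s))"
begin

definition L :: "real \<Rightarrow> real" where "L t = (LBINT s:{0..t}. indicat_real {0} (Z s))"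

text \<open>Clamping the argument at 0 makes this a Borel set of the whole line, as \<open>Z\<close>
  is unconstrained at negative arguments.\<close>

definition level :: "real set \<Rightarrow> real set" where "level A = {s. Z (max 0 s) \<in> A}"

lemma level_sets: "A \<in> sets borel \<Longrightarrow> level A \<in> sets lborel"
  using measurable_sets[OF cadlag_borel_measurable[OF cadlag_Z], of A]
  unfolding level_def by (auto simp: vimage_def)

lemma L_measure: "L t = measure lborel ({0..t} \<inter> level {0})"
  unfolding L_def by (rule set_integral_indicator_eq_measure) (rule level_sets, simp, auto simp: level_def)

lemma C_measure: "t \<ge> 0 \<Longrightarrow> C t = measure lborel ({0..t} \<inter> level {0<..})"
  unfolding C_eq by (rule set_integral_indicator_eq_measure) (rule level_sets, simp, auto simp: level_def)

lemma level_bounds: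
  assumes "A \<in> sets borel" "s \<le> t"
  shows "measure lborel ({s<..t} \<inter> level A) \<le> t - s"
proof -
  have "measure lborel ({s<..t} \<inter> level A) \<le> measure lborel {s<..t}"
    using assms level_sets by (intro measure_mono_fmeasurable) (auto simp: fmeasurable_def)
  then show ?thesis using assms by simp
qed

lemma L_diff: "0 \<le> s \<Longrightarrow> s \<le> t \<Longrightarrow> L t = L s + measure lborel ({s<..t} \<inter> level {0})"
  unfolding L_measure by (rule measure_interval_split[OF level_sets]) auto

lemma C_diff: "0 \<le> s \<Longrightarrow> s \<le> t \<Longrightarrow> C t = C s + measure lborel ({s<..t} \<inter> level {0<..})"
  using measure_interval_split[OF level_sets, of "{0<..}" s t] C_measure[of s] C_measure[of t] by simp

lemma L_mono: "0 \<le> s \<Longrightarrow> s \<le> t \<Longrightarrow> L s \<le> L t" using L_diff[of s t] by simp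

lemma C_mono: "0 \<le> s \<Longrightarrow> s \<le> t \<Longrightarrow> C s \<le> C t" using C_diff[of s t] by simp

lemma L_Lipschitz: "0 \<le> s \<Longrightarrow> s \<le> t \<Longrightarrow> L t \<le> L s + (t - s)"
  using L_diff[of s t] level_bounds[of "{0}" s t] by simp

lemma C_Lipschitz: "0 \<le> s \<Longrightarrow> s \<le> t \<Longrightarrow> C t \<le> C s + (t - s)"
  using C_diff[of s t] level_bounds[of "{0<..}" s t] by simp

lemma L_const: "0 \<le> s \<Longrightarrow> s \<le> t \<Longrightarrow> (\<And>u. s < u \<Longrightarrow> u \<le> t \<Longrightarrow> Z u \<noteq> 0) \<Longrightarrow> L t = L s"
proof -
  assume a: "0 \<le> s" "s \<le> t" "\<And>u. s < u \<Longrightarrow> u \<le> t \<Longrightarrow> Z u \<noteq> 0"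
  then have "{s<..t} \<inter> level {0} = {}" unfolding level_def by (auto simp: max_def)
  then show "L t = L s" using L_diff[OF a(1,2)] by simp
qed

lemma C_const: "0 \<le> s \<Longrightarrow> s \<le> t \<Longrightarrow> (\<And>u. s < u \<Longrightarrow> u \<le> t \<Longrightarrow> Z u \<le> 0) \<Longrightarrow> C t = C s"
proof -
  assume a: "0 \<le> s" "s \<le> t" "\<And>u. s < u \<Longrightarrow> u \<le> t \<Longrightarrow> Z u \<le> 0"
  then have "Z (max 0 u) \<le> 0" if "s < u" "u \<le> t" for u using that by simp
  then have "{s<..t} \<inter> level {0<..} = {}" unfolding level_def by fastforce
  then show "C t = C s" using C_diff[OF a(1,2)] by simp
qed

lemma C_zero: "C 0 = 0"
proof -
  have "C 0 \<le> measure lborel {0..0::real}"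
    unfolding C_measure[OF order_refl] using level_sets[of "{0<..}"]
    by (intro measure_mono_fmeasurable) (auto simp: fmeasurable_def)
  moreover have "0 \<le> C 0" using C_measure[of 0] by simp
  ultimately show ?thesis by simp
qed

lemma L_zero: "L 0 = 0"
proof -
  have "L 0 \<le> measure lborel {0..0::real}"
    unfolding L_measure using level_sets[of "{0}"]
    by (intro measure_mono_fmeasurable) (auto simp: fmeasurable_def)
  moreover have "0 \<le> L 0" unfolding L_measure by simp
  ultimately show ?thesis by simp
qed

lemma Z_eq_L: "t \<ge> 0 \<Longrightarrow> Z t = z + x (C t) + \<gamma> * L t"
  unfolding L_def by (rule Z_eq)

lemma C_nonneg: "0 \<le> t \<Longrightarrow> 0 \<le> C t" using C_mono[of 0 t] C_zero by simp

text \<open>While \<open>Z\<close> is negative both clocks \<open>C\<close> and \<open>L\<close> stand still, so \<open>Z\<close> could only have become negative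
  by a negative jump of \<open>x\<close>.\<close>

lemma Z_nonneg: assumes t: "0 \<le> t" shows "0 \<le> Z t"
proof (rule ccontr)
  assume "\<not> 0 \<le> Z t"
  then have neg: "Z t < 0" by simp
  define P where "P = {u. 0 \<le> u \<and> u \<le> t \<and> 0 \<le> Z u}"
  \<comment> \<open>After the last chance of being nonnegative both clocks stand still, so
    \<open>Z s = Z t < 0\<close>; hence \<open>s\<close> is not in \<open>P\<close> and is
    approached by earlier points of \<open>P\<close>.\<close>
  define s where "s = Sup P"
  have "0 \<in> P" unfolding P_def using t Z_eq_L[of 0] C_zero L_zero x0 z by simp
  have bdd: "bdd_above P" unfolding P_def by (intro bdd_aboveI[of _ t]) auto
  have s: "0 \<le> s" "s \<le> t"
    unfolding s_def using \<open>0 \<in> P\<close> bdd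
    by (auto intro: cSup_upper cSup_least simp: P_def)
  have after: "Z u < 0" if "s < u" "u \<le> t" for u
  proof -
    have "u \<notin> P" using that bdd cSup_upper[of u P] unfolding s_def by fastforce
    then show ?thesis using that s unfolding P_def by auto
  qed
  have "C t = C s" using C_const[OF s] after by (simp add: less_imp_le)
  moreover have "L t = L s" using L_const[OF s] after by force
  ultimately have Zs: "Z s = Z t" using Z_eq_L[OF t] Z_eq_L[OF s(1)] by simp
  \<comment> \<open>Half the depth: points \<open>u\<close> of \<open>P\<close> close to
    \<open>s\<close> would satisfy \<open>Z u \<le> Z s + \<eta> = Z s / 2 < 0\<close>.\<close>
  define \<eta> where "\<eta> = - Z s / 2"
  have \<eta>: "0 < \<eta>" using Zs neg unfolding \<eta>_def by simp
  have "\<exists>b<s. \<forall>u. b < u \<and> u < s \<and> 0 \<le> u \<longrightarrow> x (C u) < x (C s) + \<eta>"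
  proof (cases "C s > 0")
    case True
    obtain b where b: "b < C s" "\<And>v. b < v \<Longrightarrow> v < C s \<Longrightarrow> x v < x (C s) + \<eta>"
      using no_negative_jump_bound[OF cadlag_x True jumps[OF True] \<eta>] by blast
    \<comment> \<open>\<open>C\<close> is 1-Lipschitz, so \<open>C u\<close> stays above
      \<open>b\<close> as long as \<open>u\<close> is within \<open>C s - b\<close> of
      \<open>s\<close>.\<close>
    have "x (C u) < x (C s) + \<eta>" if u: "s - (C s - b) < u" "u < s" "0 \<le> u" for u
    proof (cases "C u = C s")
      case True then show ?thesis using \<eta> by simp
    next
      case False
      then have "C u < C s" using C_mono[of u s] u by simp
      moreover have "b < C u" using C_Lipschitz[of u s] u by linarith
      ultimately show ?thesis using b by blast
    qed
    then show ?thesis using b(1) by (intro exI[of _ "s - (C s - b)"]) auto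
  next
    case False
    then have "C s = 0" using C_nonneg[OF s(1)] by simp
    then have "C u = C s" if "0 \<le> u" "u < s" for u using C_mono[of u s] C_nonneg[of u] that by simp
    then show ?thesis using \<eta> by (intro exI[of _ "s - 1"]) auto
  qed
  then obtain b where b: "b < s" "\<And>u. b < u \<Longrightarrow> u < s \<Longrightarrow> 0 \<le> u \<Longrightarrow> x (C u) < x (C s) + \<eta>" by blast
  obtain u where u: "u \<in> P" "b < u"
    using less_cSup_iff[OF _ bdd, of b] \<open>0 \<in> P\<close> b(1) unfolding s_def by blast
  have u': "0 \<le> u" "0 \<le> Z u" using u unfolding P_def by auto
  have "u \<le> s" using u(1) bdd unfolding s_def by (simp add: cSup_upper)
  moreover have "u \<noteq> s" using u' Zs neg by auto
  ultimately have us: "u < s" by simp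
  have "\<gamma> * L u \<le> \<gamma> * L s" using L_mono[of u s] us u' \<gamma> by simp
  then have "Z u \<le> Z s + \<eta>" using b(2)[OF u(2) us u'(1)] Z_eq_L[OF u'(1)] Z_eq_L[OF s(1)] by linarith
  then show False using u' Zs neg unfolding \<eta>_def by simp
qed

section \<open>Complementary clocks and the reflection formula\<close>

lemma L_eq: assumes t: "0 \<le> t" shows "L t = t - C t"
proof -
  have "{0..t} = ({0..t} \<inter> level {0}) \<union> ({0..t} \<inter> level {0<..})"
  proof -
    have "Z s = 0 \<or> Z s > 0" if "0 \<le> s" for s using Z_nonneg[OF that] by linarith
    then have "\<forall>s\<ge>0. s \<in> level {0} \<or> s \<in> level {0<..}" unfolding level_def by auto
    then show ?thesis by fastforce
  qed
  then have "measure lborel {0..t} = measure lborel (({0..t} \<inter> level {0}) \<union> ({0..t} \<inter> level {0<..}))"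
    by (rule arg_cong)
  also have "\<dots> = L t + C t"
  proof -
    have "({0..t} \<inter> level {0}) \<inter> ({0..t} \<inter> level {0<..}) = {}" unfolding level_def by auto
    moreover have "{0..t} \<inter> level A \<in> fmeasurable lborel" if "A \<in> sets borel" for A
      using level_sets[OF that] by (rule interval_Int_fmeasurable)
    ultimately show ?thesis unfolding L_measure C_measure[OF t] by (simp add: measure_Un3)
  qed
  finally show ?thesis using t by simp
qed

lemma Z_eq': "t \<ge> 0 \<Longrightarrow> Z t = z + x (C t) + \<gamma> * (t - C t)"
  using Z_eq_L[of t] L_eq[of t] by simp

text \<open>On a flat stretch of \<open>C\<close> the elapsed time pushes \<open>Z\<close> up at
  rate \<gamma>, so \<open>Z\<close> is positive right after its start; then \<open>L\<close> is
  flat as well, which contradicts \<open>L t = t - C t\<close>.\<close>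

lemma C_strict_mono: assumes "0 \<le> s" "s < t" shows "C s < C t"
proof (rule ccontr)
  assume "\<not> C s < C t"
  then have st: "C t = C s" using C_mono[of s t] assms by simp
  have "Z u \<noteq> 0" if u: "s < u" "u \<le> t" for u
  proof -
    have "C u = C s" using C_mono[of s u] C_mono[of u t] st u assms by simp
    then have "Z u = Z s + \<gamma> * (u - s)" using Z_eq'[of u] Z_eq'[of s] u assms by (simp add: algebra_simps)
    moreover have "0 < \<gamma> * (u - s)" using \<gamma> u by simp
    ultimately show ?thesis using Z_nonneg[OF assms(1)] by linarith
  qed
  then have "L t = L s" using assms by (intro L_const) auto
  then show False using L_eq[of t] L_eq[of s] st assms by simp
qed

text \<open>One half of the supremum formula: nonnegativity of \<open>Z\<close> at the earlier time,
  together with monotonicity of \<open>L\<close>.\<close>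

lemma reflection_lower: assumes "0 \<le> s" "s \<le> t" shows "- (z + x (C s)) \<le> \<gamma> * (t - C t)"
proof -
  have "\<gamma> * L s \<le> \<gamma> * L t" using L_mono[OF assms] \<gamma> by simp
  then show ?thesis using Z_nonneg[OF assms(1)] Z_eq_L[OF assms(1)] L_eq[of t] assms by simp
qed

text \<open>The other half: \<open>L\<close> has not grown since the last zero of \<open>Z\<close>,
  and at a zero \<open>\<gamma> * L\<close> equals \<open>- (z + x (C s))\<close>. The supremum of
  the zeros need not be a zero of a cadlag path; the slack \<eta> pays for a zero within
  \<eta>/\<gamma> of it.\<close>

lemma reflection_upper:
  assumes t: "0 \<le> t" and \<eta>: "\<eta> > 0"
  shows "t - C t = 0 \<or> (\<exists>s. 0 \<le> s \<and> s \<le> t \<and> \<gamma> * (t - C t) \<le> - (z + x (C s)) + \<eta>)"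
proof (rule disjCI)
  assume N: "\<not> (\<exists>s. 0 \<le> s \<and> s \<le> t \<and> \<gamma> * (t - C t) \<le> - (z + x (C s)) + \<eta>)"
  define P where "P = {u. 0 \<le> u \<and> u \<le> t \<and> Z u = 0}"
  have bdd: "bdd_above P" unfolding P_def by (intro bdd_aboveI[of _ t]) auto
  show "t - C t = 0"
  proof (cases "P = {}")
    case True
    then have "L t = L 0" using t by (intro L_const) (auto simp: P_def)
    then show ?thesis using L_zero L_eq[OF t] by simp
  next
    case False
    define g where "g = Sup P"
    have gt: "g \<le> t" unfolding g_def using False by (intro cSup_least) (auto simp: P_def)
    obtain s where s: "s \<in> P" "g - \<eta> / \<gamma> < s"
      using less_cSup_iff[OF False bdd, of "g - \<eta> / \<gamma>"] \<eta> \<gamma> unfolding g_def by auto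
    have sg: "s \<le> g" unfolding g_def using s bdd by (simp add: cSup_upper)
    have s0: "0 \<le> s" "Z s = 0" using s unfolding P_def by auto
    have "u \<notin> P" if "g < u" for u using that bdd cSup_upper[of u P] unfolding g_def by fastforce
    then have "L t = L g" using s0 sg gt by (intro L_const) (auto simp: P_def)
    moreover have "L g \<le> L s + (g - s)" using s0 sg by (intro L_Lipschitz)
    ultimately have "L t \<le> L s + \<eta> / \<gamma>" using s(2) by linarith
    then have "\<gamma> * L t \<le> \<gamma> * (L s + \<eta> / \<gamma>)" using \<gamma> by simp
    also have "\<dots> = \<gamma> * L s + \<eta>" using \<gamma> by (simp add: distrib_left)
    finally have "\<gamma> * (t - C t) \<le> - (z + x (C s)) + \<eta>" using Z_eq_L[OF s0(1)] s0 L_eq[OF t] by simp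
    then show ?thesis using N s0 sg gt by (meson order_trans)
  qed
qed

text \<open>A bounded clock would see only a bounded part of \<open>x\<close>, so the reflection
  formula would bound the lag t - C t, which is at least t - K.\<close>

lemma C_unbounded: "\<exists>t\<ge>0. K < C t"
proof (rule ccontr)
  assume N: "\<not> (\<exists>t\<ge>0. K < C t)"
  obtain B where B: "\<And>t. 0 \<le> t \<Longrightarrow> t \<le> K \<Longrightarrow> \<bar>x t\<bar> \<le> B" by (rule cadlag_bounded[OF cadlag_x, of K]) blast
  define t where "t = \<bar>K\<bar> + 1 + (\<bar>B\<bar> + 1) / \<gamma>"
  have t: "0 \<le> t" unfolding t_def using \<gamma> by simp
  have Ct: "C s \<le> K" if "0 \<le> s" for s using N that by (meson not_less)
  have "(\<bar>B\<bar> + 1) / \<gamma> < t - C t" using Ct[OF t] unfolding t_def by linarith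
  then have big: "\<bar>B\<bar> + 1 < \<gamma> * (t - C t)" using \<gamma> by (simp add: field_simps)
  then have "t - C t \<noteq> 0" by auto
  then obtain s where s: "0 \<le> s" "s \<le> t" "\<gamma> * (t - C t) \<le> - (z + x (C s)) + 1"
    using reflection_upper[OF t zero_less_one] by blast
  have "\<bar>x (C s)\<bar> \<le> B" using B C_nonneg Ct s by simp
  then show False using big s(3) z by linarith
qed

lemma continuous_C: "continuous_on {0..} C"
proof (rule continuous_onI)
  fix s e :: real assume s: "s \<in> {0..}" and e: "e > 0"
  have "dist (C t) (C s) \<le> e" if "t \<in> {0..}" "dist t s < e" for t
    using that s C_Lipschitz[of s t] C_Lipschitz[of t s] C_mono[of s t] C_mono[of t s]
    unfolding dist_real_def by (cases "s \<le> t") auto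
  then show "\<exists>d>0. \<forall>t\<in>{0..}. dist t s < d \<longrightarrow> dist (C t) (C s) \<le> e" using e by blast
qed

lemma time_change_C: "time_change C"
proof (rule time_changeI)
  fix v :: real assume v: "0 \<le> v"
  obtain b where b: "0 \<le> b" "v < C b" using C_unbounded by blast
  have "\<exists>s\<ge>0. s \<le> b \<and> C s = v"
    using v b C_zero by (intro IVT' continuous_on_subset[OF continuous_C]) auto
  then show "\<exists>s\<ge>0. C s = v" by blast
qed (use C_nonneg C_strict_mono in auto)

lemma C_le: "0 \<le> t \<Longrightarrow> C t \<le> t" using C_Lipschitz[of 0 t] C_zero by simp

lemma C_abs_Lipschitz: "0 \<le> s \<Longrightarrow> 0 \<le> t \<Longrightarrow> \<bar>C t - C s\<bar> \<le> \<bar>t - s\<bar>"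
  using C_Lipschitz[of s t] C_Lipschitz[of t s] C_mono[of s t] C_mono[of t s] by (cases "s \<le> t") auto

end

subsection \<open>The discretization\<close>

lemma cadlag_cong:
  assumes "cadlag x" "\<And>t. 0 \<le> t \<Longrightarrow> x t = y t" shows "cadlag y"
  unfolding cadlag_def
proof (intro conjI allI impI)
  fix t :: real assume t: "0 \<le> t"
  have "(x \<longlongrightarrow> x t) (at_right t)" using assms(1) t unfolding cadlag_def by blast
  moreover have "eventually (\<lambda>s. x s = y s) (at_right t)"
    using eventually_at_right_less[of t] by eventually_elim (use assms(2) t in auto)
  ultimately show "(y \<longlongrightarrow> y t) (at_right t)" using assms(2)[OF t] tendsto_cong by fastforce
next
  fix t :: real assume t: "0 < t"
  then obtain l where l: "(x \<longlongrightarrow> l) (at_left t)" using assms(1) unfolding cadlag_def by blast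
  have "eventually (\<lambda>s. x s = y s) (at_left t)"
    unfolding eventually_at_left_field using t assms(2) by (intro exI[of _ 0]) auto
  then have "(y \<longlongrightarrow> l) (at_left t)" using l tendsto_cong by fastforce
  then show "\<exists>l. (y \<longlongrightarrow> l) (at_left t)" by blast
qed

lemma grid_floor_eq:
  assumes "n > 0" "real k \<le> real n * t" "real n * t < real k + 1"
  shows "grid_floor n t = real k / real n"
proof -
  have "\<lfloor>real n * t\<rfloor> = int k" using assms by linarith
  then show ?thesis by (simp add: grid_floor_def)
qed

text \<open>\<open>clock n \<gamma> z x k\<close> is \<open>n C\<^sup>n(k / n)\<close>, and \<open>discrete_height n \<gamma> z x k (clock n \<gamma> z x k)\<close> is \<open>Z\<^sup>n(k / n)\<close>.\<close>

definition discrete_height :: "nat \<Rightarrow> real \<Rightarrow> real \<Rightarrow> (real \<Rightarrow> real) \<Rightarrow> nat \<Rightarrow> nat \<Rightarrow> real" where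
  "discrete_height n \<gamma> z x k j = z + x (real j / real n) - \<gamma> * (real j / real n) + \<gamma> * (real k / real n)"

primrec clock :: "nat \<Rightarrow> real \<Rightarrow> real \<Rightarrow> (real \<Rightarrow> real) \<Rightarrow> nat \<Rightarrow> nat" where
  "clock n \<gamma> z x 0 = 0"
| "clock n \<gamma> z x (Suc k) = clock n \<gamma> z x k + (if 0 < discrete_height n \<gamma> z x k (clock n \<gamma> z x k) then 1 else 0)"

text \<open>The equations look implicit, but on a cell \<open>w\<close> depends only on
  \<open>c\<close> at the left endpoint, and there \<open>c\<close> is a left limit read off from
  the affine formula on the preceding cell. Induction over the cells gives the closed form.\<close>

lemma discretized_paths_grid:
  assumes n: "n > 0" and D: "discretized_paths n \<gamma> z x c w"
    and t: "real k \<le> real n * t" "real n * t < real k + 1"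
  shows "w t = discrete_height n \<gamma> z x k (clock n \<gamma> z x k)"
    and "c t = real (clock n \<gamma> z x k) / real n +
      (t - real k / real n) * indicat_real {0<..} (discrete_height n \<gamma> z x k (clock n \<gamma> z x k))"
proof -
  define G where "G k = real k / real n" for k :: nat
  let ?h = "\<lambda>k. z + x (c (G k)) - \<gamma> * c (G k) + \<gamma> * G k"
  have cD: "\<And>t. 0 \<le> t \<Longrightarrow> c t = (if grid_floor n t = 0 then 0 else left_lim c (grid_floor n t)) +
                 (t - grid_floor n t) * indicat_real {0<..} (w t)"
    and wD: "\<And>t. 0 \<le> t \<Longrightarrow> w t = (z + x (c (grid_floor n t)) - \<gamma> * c (grid_floor n t)) + \<gamma> * grid_floor n t"
    and c0: "c 0 = 0"
    using D unfolding discretized_paths_def by blast+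
  have cell: "w t = ?h k \<and> c t = c (G k) + (t - G k) * indicat_real {0<..} (?h k)"
    if t: "real k \<le> real n * t" "real n * t < real k + 1" for k t
  proof -
    have "0 \<le> real n * t" using t(1) by (rule order_trans[OF of_nat_0_le_iff])
    then have t0: "0 \<le> t" using n by (simp add: zero_le_mult_iff)
    have gt: "grid_floor n t = G k" unfolding G_def by (rule grid_floor_eq[OF n t])
    have G: "real k \<le> real n * G k" "real n * G k < real k + 1" using n unfolding G_def by auto
    have gG: "grid_floor n (G k) = G k" using grid_floor_eq[OF n G] unfolding G_def .
    have G0: "0 \<le> G k" unfolding G_def by simp
    have w: "w t = ?h k" using wD[OF t0] gt by simp
    have "c (G k) = (if G k = 0 then 0 else left_lim c (G k))" using cD[OF G0] gG by simp
    then show ?thesis using cD[OF t0] gt w by simp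
  qed
  have cG: "c (G k) = real (clock n \<gamma> z x k) / real n" for k
  proof (induction k)
    case 0
    then show ?case using c0 unfolding G_def by simp
  next
    case (Suc k)
    let ?i = "indicat_real {0<..} (?h k)"
    have "?h k = discrete_height n \<gamma> z x k (clock n \<gamma> z x k)" using Suc unfolding discrete_height_def G_def by simp
    then have i: "?i = (if 0 < discrete_height n \<gamma> z x k (clock n \<gamma> z x k) then 1 else 0)" by simp
    have GS: "G (Suc k) = G k + 1 / real n" unfolding G_def by (simp add: add_divide_distrib)
    have lt: "G k < G (Suc k)" using n GS by simp
    have ev: "eventually (\<lambda>s. c (G k) + (s - G k) * ?i = c s) (at_left (G (Suc k)))"
      unfolding eventually_at_left_field
    proof (intro exI[of _ "G k"] conjI allI impI lt)
      fix s assume "G k < s" "s < G (Suc k)"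
      then have "real k \<le> real n * s" "real n * s < real k + 1"
        using n unfolding G_def by (simp_all add: field_simps)
      then show "c (G k) + (s - G k) * ?i = c s" using cell by simp
    qed
    have "((\<lambda>s. c (G k) + (s - G k) * ?i) \<longlongrightarrow> c (G k) + (G (Suc k) - G k) * ?i) (at_left (G (Suc k)))"
      by (intro tendsto_intros)
    then have "(c \<longlongrightarrow> c (G k) + (G (Suc k) - G k) * ?i) (at_left (G (Suc k)))"
      using tendsto_cong[OF ev] by simp
    then have ll: "left_lim c (G (Suc k)) = c (G k) + (G (Suc k) - G k) * ?i"
      unfolding left_lim_def by (intro tendsto_Lim) simp_all
    have G: "real (Suc k) \<le> real n * G (Suc k)" "real n * G (Suc k) < real (Suc k) + 1" using n unfolding G_def by auto
    have gG: "grid_floor n (G (Suc k)) = G (Suc k)" using grid_floor_eq[OF n G] unfolding G_def .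
    have "0 < G (Suc k)" using n unfolding G_def by simp
    then have "c (G (Suc k)) = left_lim c (G (Suc k))"
      using cD[of "G (Suc k)"] gG by simp
    also have "\<dots> = real (clock n \<gamma> z x (Suc k)) / real n"
    proof -
      have "G (Suc k) - G k = 1 / real n" using GS by simp
      then show ?thesis unfolding ll i by (simp add: Suc.IH add_divide_distrib)
    qed
    finally show ?case .
  qed
  have "?h k = discrete_height n \<gamma> z x k (clock n \<gamma> z x k)" unfolding cG by (simp add: discrete_height_def G_def)
  then show "w t = discrete_height n \<gamma> z x k (clock n \<gamma> z x k)"
    "c t = real (clock n \<gamma> z x k) / real n +
      (t - real k / real n) * indicat_real {0<..} (discrete_height n \<gamma> z x k (clock n \<gamma> z x k))"
    using cell[OF t] cG[of k] unfolding G_def by simp_all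
qed

lemma scaled_cell:
  assumes "n > 0" "0 \<le> t" obtains k where "real k \<le> real n * t" "real n * t < real k + 1"
proof -
  have "0 \<le> real n * t" using assms by simp
  then show ?thesis using that by (rule nat_cell)
qed

lemma discretized_paths_cadlag:
  assumes n: "n > 0" and D: "discretized_paths n \<gamma> z x c w" shows "cadlag w"
proof (rule cadlag_cong[OF cadlag_step_path[OF n]])
  fix t :: real assume "0 \<le> t"
  then obtain k where k: "real k \<le> real n * t" "real n * t < real k + 1" using scaled_cell[OF n] by blast
  show "step_path n (\<lambda>k. discrete_height n \<gamma> z x k (clock n \<gamma> z x k)) t = w t"
    using step_path_eq[OF n k] discretized_paths_grid(1)[OF n D k] by simp
qed

text \<open>Near each time \<open>c\<close> coincides with the polygon through the values of the
  clock; \<open>m\<close> is chosen so that the nodes cover a unit neighbourhood.\<close>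

lemma discretized_paths_continuous:
  assumes n: "n > 0" and D: "discretized_paths n \<gamma> z x c w" shows "continuous_on {0..} c"
  unfolding continuous_on_eq_continuous_within
proof
  fix t :: real assume t: "t \<in> {0..}"
  let ?a = "\<lambda>i. real (clock n \<gamma> z x i) / real n"
  obtain m :: nat where m: "real n * (t + 1) < real m" using reals_Archimedean2 by blast
  have "continuous (at t within {0..}) (polygonal_path n m ?a)"
    using continuous_on_polygonal_path t by (auto simp: continuous_on_eq_continuous_within)
  then show "continuous (at t within {0..}) c"
  proof (rule continuous_transform_within[OF _ zero_less_one t])
    fix s :: real assume s: "s \<in> {0..}" "dist s t < 1"
    then obtain k where k: "real k \<le> real n * s" "real n * s < real k + 1" using scaled_cell[OF n] by auto
    have "real n * s \<le> real n * (t + 1)" using s by (intro mult_left_mono) (auto simp: dist_real_def)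
    then have "k < m" using k m by linarith
    show "polygonal_path n m ?a s = c s"
      unfolding polygonal_path_cell[OF k \<open>k < m\<close>] discretized_paths_grid(2)[OF n D k]
      using n by (simp add: field_simps)
  qed
qed

text \<open>The clock enters the height as a random index into a countable family of measurable
  functions.\<close>

lemma discretized_paths_process:
  assumes n: "n > 0" and X: "process N X"
    and D: "\<And>\<omega>. \<omega> \<in> space N \<Longrightarrow> discretized_paths n \<gamma> z (\<lambda>t. X t \<omega>) (\<lambda>t. C t \<omega>) (\<lambda>t. Z t \<omega>)"
  shows "process N C" "process N Z"
proof -
  have mX: "X (real j / real n) \<in> borel_measurable N" for j using X unfolding process_def by simp
  have mh: "(\<lambda>\<omega>. discrete_height n \<gamma> z (\<lambda>t. X t \<omega>) k j) \<in> borel_measurable N" for k j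
    unfolding discrete_height_def using mX by (intro borel_measurable_add borel_measurable_diff borel_measurable_const)
  have mk: "(\<lambda>\<omega>. clock n \<gamma> z (\<lambda>t. X t \<omega>) k) \<in> N \<rightarrow>\<^sub>M count_space UNIV" for k
  proof (induction k)
    case (Suc k)
    have "(\<lambda>\<omega>. j + (if 0 < discrete_height n \<gamma> z (\<lambda>t. X t \<omega>) k j then 1 else 0)) \<in> N \<rightarrow>\<^sub>M count_space UNIV" for j :: nat
      using mh[of k j] by measurable
    then show ?case unfolding clock.simps
      by (rule measurable_compose_countable'[of UNIV "\<lambda>j \<omega>. j + (if 0 < discrete_height n \<gamma> z (\<lambda>t. X t \<omega>) k j then 1 else 0)"])
        (use Suc in simp_all)
  qed simp
  have mhk: "(\<lambda>\<omega>. discrete_height n \<gamma> z (\<lambda>t. X t \<omega>) k (clock n \<gamma> z (\<lambda>t. X t \<omega>) k)) \<in> borel_measurable N" for k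
    by (rule measurable_compose_countable'[of UNIV "\<lambda>j \<omega>. discrete_height n \<gamma> z (\<lambda>t. X t \<omega>) k j", OF mh mk]) simp
  have mrk: "(\<lambda>\<omega>. real (clock n \<gamma> z (\<lambda>t. X t \<omega>) k)) \<in> borel_measurable N" for k
    using mk[of k] by measurable
  show "process N C" unfolding process_def
  proof (intro allI impI)
    fix t :: real assume "0 \<le> t"
    then obtain k where k: "real k \<le> real n * t" "real n * t < real k + 1" using scaled_cell[OF n] by blast
    have "(\<lambda>\<omega>. real (clock n \<gamma> z (\<lambda>t. X t \<omega>) k) / real n + (t - real k / real n) *
        indicat_real {0<..} (discrete_height n \<gamma> z (\<lambda>t. X t \<omega>) k (clock n \<gamma> z (\<lambda>t. X t \<omega>) k))) \<in> borel_measurable N"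
      using mrk[of k] mhk[of k] by measurable
    then show "C t \<in> borel_measurable N"
      using discretized_paths_grid(2)[OF n D k] by (simp cong: measurable_cong)
  qed
  show "process N Z" unfolding process_def
  proof (intro allI impI)
    fix t :: real assume "0 \<le> t"
    then obtain k where k: "real k \<le> real n * t" "real n * t < real k + 1" using scaled_cell[OF n] by blast
    show "Z t \<in> borel_measurable N"
      using mhk[of k] discretized_paths_grid(1)[OF n D k] by (simp cong: measurable_cong)
  qed
qed

section \<open>The clock of a single grid path\<close>

locale discrete_path =
  fixes n :: nat and \<gamma> z :: real and x :: "real \<Rightarrow> real"
  assumes n: "n > 0" and \<gamma>: "\<gamma> > 0" and z: "0 \<le> z" and x0: "x 0 = 0"
    and x_const: "\<And>t. 0 \<le> t \<Longrightarrow> x t = x (grid_floor n t)"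
begin

abbreviation "\<kappa> \<equiv> clock n \<gamma> z x"

lemma x_cell: "real k \<le> real n * t \<Longrightarrow> real n * t < real k + 1 \<Longrightarrow> x t = x (real k / real n)"
proof -
  assume k: "real k \<le> real n * t" "real n * t < real k + 1"
  then have "0 \<le> real n * t" by linarith
  then have "0 \<le> t" using n by (simp add: zero_le_mult_iff)
  from x_const[OF this] show ?thesis using grid_floor_eq[OF n k] by simp
qed

lemma \<kappa>_mono: "i \<le> k \<Longrightarrow> \<kappa> i \<le> \<kappa> k"
  by (rule lift_Suc_mono_le[of \<kappa>]) auto

text \<open>The lag \<open>k - \<kappa> k\<close> counts the idle steps: it is the discrete
  counterpart of \<open>L\<close>, scaled by n.\<close>

lemma lag_mono: assumes "i \<le> k" shows "real i - real (\<kappa> i) \<le> real k - real (\<kappa> k)"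
  by (rule lift_Suc_mono_le[of "\<lambda>i. real i - real (\<kappa> i)", OF _ assms]) auto

lemma \<kappa>_le: "\<kappa> k \<le> k" using lag_mono[of 0 k] by simp

text \<open>The lag grows only at an idle step, where the height is at most 0 and so \<gamma> times
  the rescaled lag is at most \<open>- (z + x)\<close>; the step itself then adds
  \<open>\<gamma> / n\<close>. The witness \<open>i\<close> is the latest idle step.\<close>

lemma clock_upper:
  "\<kappa> k = k \<or> (\<exists>i\<le>k. \<gamma> * (real k / real n - real (\<kappa> k) / real n) \<le> - (z + x (real (\<kappa> i) / real n)) + \<gamma> / real n)"
proof (induction k)
  case (Suc k)
  show ?case
  proof (cases "0 < discrete_height n \<gamma> z x k (\<kappa> k)")
    case True
    then have "\<kappa> (Suc k) = Suc (\<kappa> k)" by simp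
    moreover from this have "real (Suc k) / real n - real (\<kappa> (Suc k)) / real n = real k / real n - real (\<kappa> k) / real n"
      by (simp add: add_divide_distrib)
    ultimately show ?thesis using Suc by (metis le_SucI)
  next
    case False
    then have "\<kappa> (Suc k) = \<kappa> k" by simp
    moreover have "\<gamma> * (real k / real n - real (\<kappa> k) / real n) \<le> - (z + x (real (\<kappa> k) / real n))"
      using False unfolding discrete_height_def by (simp add: right_diff_distrib)
    moreover have "\<gamma> * (real (Suc k) / real n - real (\<kappa> k) / real n) =
        \<gamma> * (real k / real n - real (\<kappa> k) / real n) + \<gamma> / real n"
      by (simp add: add_divide_distrib algebra_simps)
    ultimately show ?thesis by (intro disjI2 exI[of _ k]) auto
  qed
qed simp

text \<open>The discrete form of Z \<ge> 0: a step of the clock starts from positive height and adds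
  one increment of \<open>x\<close>, an idle step adds \<open>\<gamma> / n\<close>, so the
  undershoot never exceeds one negative increment. Only increments already consumed by the clock are
  restricted.\<close>

lemma discrete_height_lower:
  assumes \<delta>: "0 \<le> \<delta>" and J: "\<And>j. j < \<kappa> k \<Longrightarrow> - \<delta> \<le> x (real (Suc j) / real n) - x (real j / real n)"
    and "i \<le> k"
  shows "- \<delta> \<le> discrete_height n \<gamma> z x i (\<kappa> i)"
  using \<open>i \<le> k\<close>
proof (induction i)
  case 0
  then show ?case using z \<delta> x0 by (simp add: discrete_height_def)
next
  case (Suc i)
  show ?case
  proof (cases "0 < discrete_height n \<gamma> z x i (\<kappa> i)")
    case True
    then have \<kappa>: "\<kappa> (Suc i) = Suc (\<kappa> i)" by simp
    then have "\<kappa> i < \<kappa> k" using \<kappa>_mono[OF Suc.prems] by simp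
    then have "- \<delta> \<le> x (real (Suc (\<kappa> i)) / real n) - x (real (\<kappa> i) / real n)" by (rule J)
    moreover have "discrete_height n \<gamma> z x (Suc i) (\<kappa> (Suc i)) =
        discrete_height n \<gamma> z x i (\<kappa> i) + (x (real (Suc (\<kappa> i)) / real n) - x (real (\<kappa> i) / real n))"
      unfolding \<kappa> discrete_height_def by (simp add: add_divide_distrib algebra_simps)
    ultimately show ?thesis using True by linarith
  next
    case False
    then have \<kappa>: "\<kappa> (Suc i) = \<kappa> i" by simp
    have "discrete_height n \<gamma> z x (Suc i) (\<kappa> (Suc i)) = discrete_height n \<gamma> z x i (\<kappa> i) + \<gamma> / real n"
      unfolding \<kappa> discrete_height_def by (simp add: add_divide_distrib algebra_simps)
    moreover have "0 \<le> \<gamma> / real n" using \<gamma> by simp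
    ultimately show ?thesis using Suc by linarith
  qed
qed

lemma clock_lower:
  assumes "0 \<le> \<delta>" "\<And>j. j < \<kappa> k \<Longrightarrow> - \<delta> \<le> x (real (Suc j) / real n) - x (real j / real n)" "i \<le> k"
  shows "- (z + x (real (\<kappa> i) / real n)) - \<delta> \<le> \<gamma> * (real k / real n - real (\<kappa> k) / real n)"
proof -
  have "- (z + x (real (\<kappa> i) / real n)) - \<delta> \<le> \<gamma> * ((real i - real (\<kappa> i)) / real n)"
    using discrete_height_lower[of \<delta> k i, OF assms] unfolding discrete_height_def by (simp add: diff_divide_distrib right_diff_distrib)
  also have "\<dots> \<le> \<gamma> * ((real k - real (\<kappa> k)) / real n)"
    using lag_mono[OF assms(3)] \<gamma> by (intro mult_left_mono divide_right_mono) auto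
  finally show ?thesis by (simp add: diff_divide_distrib)
qed

text \<open>A clock staying below \<open>J\<close> sees finitely many values of \<open>x\<close>;
  \<open>clock_upper\<close> then caps the lag, which must grow with \<open>k\<close>.\<close>

lemma clock_unbounded: "\<exists>k. J \<le> \<kappa> k"
proof (rule ccontr)
  assume "\<not> (\<exists>k. J \<le> \<kappa> k)"
  then have lt: "\<kappa> k < J" for k by (meson not_le)
  define B where "B = (\<Sum>j<J. \<bar>x (real j / real n)\<bar>)"
  have B: "\<bar>x (real (\<kappa> i) / real n)\<bar> \<le> B" for i
    unfolding B_def using lt[of i] by (intro member_le_sum[of "\<kappa> i"]) auto
  obtain k :: nat where k: "real J + real n * (B / \<gamma>) + 2 < real k" using reals_Archimedean2 by blast
  have "0 \<le> B" using B[of 0] by linarith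
  then have "0 \<le> real n * (B / \<gamma>)" using \<gamma> by simp
  then have "\<kappa> k \<noteq> k" using lt[of k] k by linarith
  then obtain i where i: "\<gamma> * (real k / real n - real (\<kappa> k) / real n) \<le> - (z + x (real (\<kappa> i) / real n)) + \<gamma> / real n"
    using clock_upper[of k] by blast
  have "\<gamma> * (real k / real n - real (\<kappa> k) / real n) \<le> B + \<gamma> / real n" using i B[of i] z by linarith
  then have "real n * (\<gamma> * (real k / real n - real (\<kappa> k) / real n)) \<le> real n * (B + \<gamma> / real n)"
    by (intro mult_left_mono) simp_all
  moreover have "real n * (\<gamma> * (real k / real n - real (\<kappa> k) / real n)) = \<gamma> * (real k - real (\<kappa> k))"
    "real n * (B + \<gamma> / real n) = real n * B + \<gamma>" using n by (simp_all add: field_simps)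
  ultimately have "\<gamma> * (real k - real (\<kappa> k)) \<le> real n * B + \<gamma>" by simp
  then have "real k - real (\<kappa> k) \<le> real n * (B / \<gamma>) + 1" using \<gamma> by (simp add: field_simps)
  then show False using lt[of k] k by linarith
qed

text \<open>The generalized inverse of the clock. Since the clock moves by at most one per step it
  takes every value, so \<open>hit j\<close> is the first step showing exactly
  \<open>j\<close>.\<close>

definition hit :: "nat \<Rightarrow> nat" where "hit j = (LEAST k. j \<le> \<kappa> k)"

lemma le_clock_iff: "j \<le> \<kappa> k \<longleftrightarrow> hit j \<le> k"
proof
  show "hit j \<le> k" if "j \<le> \<kappa> k" unfolding hit_def using that by (rule Least_le)
  have "j \<le> \<kappa> (hit j)" unfolding hit_def using clock_unbounded by (rule LeastI_ex)
  then show "j \<le> \<kappa> k" if "hit j \<le> k" using \<kappa>_mono[OF that] by simp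
qed

lemma clock_hit: "\<kappa> (hit j) = j"
proof (cases "hit j")
  case 0
  then show ?thesis using le_clock_iff[of j "hit j"] by simp
next
  case (Suc m)
  then have "\<kappa> m < j" using le_clock_iff[of j m] by simp
  moreover have "\<kappa> (hit j) \<le> \<kappa> m + 1" using Suc by simp
  moreover have "j \<le> \<kappa> (hit j)" using le_clock_iff by blast
  ultimately show ?thesis by simp
qed

lemma clock_eq: "hit j \<le> k \<Longrightarrow> k < hit (Suc j) \<Longrightarrow> \<kappa> k = j"
  using le_clock_iff[of j k] le_clock_iff[of "Suc j" k] by simp

lemma hit_zero: "hit 0 = 0" unfolding hit_def by simp

lemma hit_strict_mono: "strict_mono hit"
  unfolding strict_mono_Suc_iff
proof
  fix j
  have "\<not> hit (Suc j) \<le> hit j" using le_clock_iff[of "Suc j" "hit j"] clock_hit[of j] by simp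
  then show "hit j < hit (Suc j)" by simp
qed

end

subsection \<open>Convergence of the discretization\<close>

text \<open>A property of the path alone, so that it can enter the relation of the weak mapping
  theorem, which does not see the sample point.\<close>

definition grid_driver :: "nat \<Rightarrow> (real \<Rightarrow> real) \<Rightarrow> bool" where
  "grid_driver n x \<longleftrightarrow> x 0 = 0 \<and> (\<forall>t\<ge>0. x t = x (grid_floor n t))"

context sticky_path
begin

text \<open>\<open>y\<close> may jump down although \<open>x\<close> does not, but J1 closeness
  keeps such jumps small: just before the preimage of the jump time \<open>x\<close> lies below its
  value there plus \<epsilon>, and replacing \<open>y\<close> by \<open>x\<close> on both sides
  costs \<epsilon> each.\<close>

lemma approximation_jump:
  assumes D: "discrete_path n \<gamma> zn y" and \<theta>: "time_change \<theta>" and \<epsilon>: "\<epsilon> > 0"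
    and close: "\<And>t. 0 \<le> t \<Longrightarrow> t \<le> T \<Longrightarrow> \<bar>y (\<theta> t) - x t\<bar> < \<epsilon>"
    and j: "real (Suc j) / real n \<le> \<theta> t" and t: "0 \<le> t" "t \<le> T"
  shows "- (3 * \<epsilon>) \<le> y (real (Suc j) / real n) - y (real j / real n)"
proof -
  interpret D: discrete_path n \<gamma> zn y by fact
  obtain p where p: "0 \<le> p" "\<theta> p = real (Suc j) / real n"
    using time_change_surj[OF \<theta>, of "real (Suc j) / real n"] by auto
  obtain q where q: "0 \<le> q" "\<theta> q = real j / real n"
    using time_change_surj[OF \<theta>, of "real j / real n"] by auto
  have "\<theta> q < \<theta> p" unfolding p q using D.n by (intro divide_strict_right_mono) auto
  then have qp: "q < p" using time_change_less_iff[OF \<theta>] p q by blast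
  then have p0: "0 < p" using q by simp
  have "p \<le> t" using time_change_le_iff[OF \<theta> p(1) t(1)] j p(2) by simp
  then have pT: "p \<le> T" using t by simp
  obtain b where b: "b < p" "\<And>s. b < s \<Longrightarrow> s < p \<Longrightarrow> x s < x p + \<epsilon>"
    using no_negative_jump_bound[OF cadlag_x p0 jumps[OF p0] \<epsilon>] by blast
  \<comment> \<open>A point before \<open>p\<close> lying both in the window of the bound on
    \<open>x\<close> and in the preimage of cell \<open>j\<close>, where \<open>y\<close> still has
    the value at j/n.\<close>
  define r where "r = (max b q + p) / 2"
  have r: "b < r" "q < r" "r < p" "0 \<le> r" "r \<le> T" using b(1) qp q(1) pT unfolding r_def by auto
  have "\<theta> q \<le> \<theta> r" "\<theta> r < \<theta> p" using time_change_less[OF \<theta>] r q(1) by (simp_all add: less_imp_le)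
  then have "real j \<le> real n * \<theta> r" "real n * \<theta> r < real j + 1"
    unfolding p q using D.n by (simp_all add: field_simps)
  then have "y (\<theta> r) = y (real j / real n)" by (rule D.x_cell)
  then show ?thesis using close[OF r(4,5)] close[OF p(1) pT] b(2)[OF r(1,3)] p(2) by simp
qed

text \<open>After \<open>k\<close> steps the discrete clock reads what
  \<open>\<theta> \<circ> C\<close> reads at \<open>t\<close>, so only the lags are left to compare,
  by the reflection formulas. The upper direction costs 2\<epsilon> for driver and start and
  \<gamma>\<epsilon> for the last idle step; the lower one 6\<epsilon>, namely 3\<epsilon> for
  negative jumps and \<epsilon> each for driver, start and the slack in the supremum. Dividing (6 +
  \<gamma>)\<epsilon> by \<gamma> and adding \<epsilon> for |u - C t| gives the constant.\<close>

lemma clock_estimate: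
  assumes D: "discrete_path n \<gamma> zn y" and \<theta>: "time_change \<theta>" and \<epsilon>: "\<epsilon> > 0"
    and \<theta>_id: "\<And>t. 0 \<le> t \<Longrightarrow> \<bar>\<theta> t - t\<bar> < \<epsilon>"
    and close: "\<And>t. 0 \<le> t \<Longrightarrow> t \<le> T \<Longrightarrow> \<bar>y (\<theta> t) - x t\<bar> < \<epsilon>"
    and zn: "\<bar>zn - z\<bar> < \<epsilon>" and n: "1 / real n < \<epsilon>"
    and t: "0 \<le> t" "C t \<le> T" and k: "\<theta> (C t) = real (clock n \<gamma> zn y k) / real n"
  shows "\<bar>real k / real n - t\<bar> \<le> (2 + 6 / \<gamma>) * \<epsilon>"
proof -
  interpret D: discrete_path n \<gamma> zn y by fact
  have C0: "0 \<le> C t" using C_nonneg[OF t(1)] .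
  define u where "u = real (D.\<kappa> k) / real n"
  have u: "\<bar>u - C t\<bar> < \<epsilon>" using \<theta>_id[OF C0] k unfolding u_def by simp
  have gn: "\<gamma> / real n < \<gamma> * \<epsilon>" using mult_strict_left_mono[OF n \<gamma>] by simp
  have ge: "0 < \<gamma> * \<epsilon>" using \<gamma> \<epsilon> by simp
  have upper: "\<gamma> * (real k / real n - u) \<le> \<gamma> * (t - C t) + 2 * \<epsilon> + \<gamma> * \<epsilon>"
    using D.clock_upper[of k]
  proof
    assume "D.\<kappa> k = k"
    moreover have "0 \<le> \<gamma> * (t - C t)" using C_le[OF t(1)] \<gamma> by simp
    ultimately show ?thesis using \<epsilon> ge unfolding u_def by simp
  next
    assume "\<exists>i\<le>k. \<gamma> * (real k / real n - real (D.\<kappa> k) / real n) \<le> - (zn + y (real (D.\<kappa> i) / real n)) + \<gamma> / real n"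
    then obtain i where i: "i \<le> k" "\<gamma> * (real k / real n - u) \<le> - (zn + y (real (D.\<kappa> i) / real n)) + \<gamma> / real n"
      unfolding u_def by blast
    \<comment> \<open>The step that bounds the discrete lag is pulled back through
      \<open>\<theta>\<close> and \<open>C\<close> to a time \<open>s \<le> t\<close> of the
      limit.\<close>
    obtain v where v: "0 \<le> v" "\<theta> v = real (D.\<kappa> i) / real n"
      using time_change_surj[OF \<theta>, of "real (D.\<kappa> i) / real n"] by auto
    have "\<theta> v \<le> \<theta> (C t)" unfolding v k using D.\<kappa>_mono[OF i(1)] by (simp add: divide_right_mono)
    then have vt: "v \<le> C t" using time_change_le_iff[OF \<theta> v(1) C0] by simp
    obtain s where s: "0 \<le> s" "C s = v" using time_change_surj[OF time_change_C v(1)] by blast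
    have "s \<le> t" using time_change_le_iff[OF time_change_C s(1) t(1)] vt s by simp
    then have "- (z + x v) \<le> \<gamma> * (t - C t)" using reflection_lower[of s t] s by simp
    moreover have "\<bar>y (real (D.\<kappa> i) / real n) - x v\<bar> < \<epsilon>" using close[OF v(1)] vt t v(2) by simp
    ultimately show ?thesis using i(2) zn gn by linarith
  qed
  have lower: "\<gamma> * (t - C t) \<le> \<gamma> * (real k / real n - u) + 6 * \<epsilon>"
    using reflection_upper[OF t(1) \<epsilon>]
  proof
    assume "t - C t = 0"
    moreover have "0 \<le> \<gamma> * (real k / real n - u)"
      unfolding u_def using D.\<kappa>_le[of k] \<gamma> by (simp add: divide_right_mono)
    ultimately show ?thesis using \<epsilon> by simp
  next
    assume "\<exists>s. 0 \<le> s \<and> s \<le> t \<and> \<gamma> * (t - C t) \<le> - (z + x (C s)) + \<epsilon>"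
    then obtain s where s: "0 \<le> s" "s \<le> t" "\<gamma> * (t - C t) \<le> - (z + x (C s)) + \<epsilon>" by blast
    have Cs: "0 \<le> C s" "C s \<le> C t" using C_nonneg[OF s(1)] C_mono[OF s(1,2)] by auto
    then have \<theta>s: "\<theta> (C s) \<le> u" using time_change_le_iff[OF \<theta> Cs(1) C0] k unfolding u_def by simp
    \<comment> \<open>Conversely, the near-maximizer of the limit is pushed forward to its grid cell
      \<open>i\<close>, which the clock has shown by step \<open>k\<close>.\<close>
    obtain i where i: "real i \<le> real n * \<theta> (C s)" "real n * \<theta> (C s) < real i + 1"
      using scaled_cell[OF D.n time_change_nonneg[OF \<theta> Cs(1)]] .
    have "real n * \<theta> (C s) \<le> real (D.\<kappa> k)" using \<theta>s D.n unfolding u_def by (simp add: field_simps)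
    then have "i \<le> D.\<kappa> k" using i(1) by linarith
    then have hit: "D.hit i \<le> k" using D.le_clock_iff by blast
    have jump: "- (3 * \<epsilon>) \<le> y (real (Suc j) / real n) - y (real j / real n)" if "j < D.\<kappa> k" for j
    proof (rule approximation_jump[OF D \<theta> \<epsilon> close _ C0 t(2)])
      show "real (Suc j) / real n \<le> \<theta> (C t)" unfolding k using that by (intro divide_right_mono) auto
    qed
    have "- (zn + y (real i / real n)) - 3 * \<epsilon> \<le> \<gamma> * (real k / real n - u)"
      using D.clock_lower[OF _ jump hit] \<epsilon> unfolding u_def D.clock_hit by simp
    moreover have "\<bar>y (real i / real n) - x (C s)\<bar> < \<epsilon>"
      using close[of "C s"] Cs t(2) D.x_cell[OF i] by simp
    ultimately show ?thesis using s(3) zn by linarith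
  qed
  have "\<gamma> * ((real k / real n - u) - (t - C t)) \<le> (6 + \<gamma>) * \<epsilon>"
    "\<gamma> * ((t - C t) - (real k / real n - u)) \<le> (6 + \<gamma>) * \<epsilon>"
    using upper lower \<epsilon> ge by (simp_all add: algebra_simps)
  then have "(real k / real n - u) - (t - C t) \<le> (6 + \<gamma>) * \<epsilon> / \<gamma>"
    "(t - C t) - (real k / real n - u) \<le> (6 + \<gamma>) * \<epsilon> / \<gamma>"
    using \<gamma> by (simp_all add: field_simps)
  moreover have "(6 + \<gamma>) * \<epsilon> / \<gamma> = 6 / \<gamma> * \<epsilon> + \<epsilon>" using \<gamma> by (simp add: field_simps)
  ultimately show ?thesis using u unfolding distrib_right by linarith
qed

text \<open>The time \<open>s\<close> at which \<open>\<theta> \<circ> C\<close> shows the clock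
  value of step \<open>k\<close> is close to k/n, and \<open>C\<close> is 1-Lipschitz. Besides the
  clock estimate, \<epsilon> is paid for the movement of \<open>c\<close> inside its cell,
  \<epsilon> for \<open>\<theta>\<close> and \<epsilon> for the distance of \<open>t\<close> from
  k/n.\<close>

lemma discretization_close_C:
  assumes D: "discrete_path n \<gamma> zn y" and y: "y \<in> skorohod_nbhd x (T + 2) \<epsilon>" and \<epsilon>: "0 < \<epsilon>" "\<epsilon> \<le> 1"
    and zn: "\<bar>zn - z\<bar> < \<epsilon>" and n: "1 / real n < \<epsilon>" and d: "discretized_paths n \<gamma> zn y c w"
    and t: "0 \<le> t" "t \<le> T"
  shows "\<bar>c t - C t\<bar> \<le> (5 + 6 / \<gamma>) * \<epsilon>"
proof -
  interpret D: discrete_path n \<gamma> zn y by fact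
  obtain \<theta> where \<theta>: "time_change \<theta>" and \<theta>_id: "\<And>t. 0 \<le> t \<Longrightarrow> \<bar>\<theta> t - t\<bar> < \<epsilon>"
    and close: "\<And>t. 0 \<le> t \<Longrightarrow> t \<le> T + 2 \<Longrightarrow> \<bar>y (\<theta> t) - x t\<bar> < \<epsilon>"
    using y unfolding skorohod_nbhd_def by auto
  obtain k where k: "real k \<le> real n * t" "real n * t < real k + 1" using scaled_cell[OF D.n t(1)] .
  define u where "u = real (D.\<kappa> k) / real n"
  have kt: "real k / real n \<le> t" "t < real k / real n + 1 / real n"
    using k D.n by (simp_all add: field_simps)
  have "u \<le> real k / real n" unfolding u_def using D.\<kappa>_le by (simp add: divide_right_mono)
  then have uT: "u \<le> T" using kt t by linarith
  obtain v where v: "0 \<le> v" "\<theta> v = u" using time_change_surj[OF \<theta>, of u] unfolding u_def by auto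
  obtain s where s: "0 \<le> s" "C s = v" using time_change_surj[OF time_change_C v(1)] .
  have uv: "\<bar>u - v\<bar> < \<epsilon>" using \<theta>_id[OF v(1)] v by simp
  have "C s \<le> T + 2" using uv uT \<epsilon>(2) s(2) by linarith
  then have "\<bar>real k / real n - s\<bar> \<le> (2 + 6 / \<gamma>) * \<epsilon>"
    using v(2) s unfolding u_def
    by (intro clock_estimate[OF D \<theta> \<epsilon>(1) \<theta>_id close zn n s(1)]) auto
  moreover have "\<bar>C t - C s\<bar> \<le> \<bar>t - s\<bar>" using C_abs_Lipschitz s t by blast
  moreover have "\<bar>c t - u\<bar> \<le> 1 / real n"
  proof -
    have "c t - u = (t - real k / real n) * indicat_real {0<..} (discrete_height n \<gamma> zn y k (D.\<kappa> k))"
      unfolding discretized_paths_grid(2)[OF D.n d k] u_def by simp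
    then show ?thesis using kt by (simp add: indicator_def)
  qed
  ultimately have "\<bar>c t - C t\<bar> \<le> 1 / real n + \<epsilon> + ((2 + 6 / \<gamma>) * \<epsilon> + 1 / real n)"
    using uv s kt by linarith
  also have "\<dots> \<le> \<epsilon> + \<epsilon> + ((2 + 6 / \<gamma>) * \<epsilon> + \<epsilon>)" using n by simp
  finally show ?thesis by (simp add: algebra_simps)
qed

text \<open>Under the time change built here \<open>w\<close> reads \<open>y\<close> in the very
  grid cell of \<open>\<theta> (C t)\<close>, so jumps are matched without loss. What remains is
  \<epsilon> for the start, \<epsilon> for the driver and \<gamma>(3\<epsilon> + \<delta>) for the
  lag, which with \<delta> = (2 + 6/\<gamma>)\<epsilon> sums to (8 + 5\<gamma>)\<epsilon>.\<close>

lemma discretization_close_Z: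
  assumes D: "discrete_path n \<gamma> zn y" and y: "y \<in> skorohod_nbhd x (T + 2) \<epsilon>" and \<epsilon>: "0 < \<epsilon>" "3 * \<epsilon> \<le> 1"
    and zn: "\<bar>zn - z\<bar> < \<epsilon>" and n: "1 / real n < \<epsilon>" and d: "discretized_paths n \<gamma> zn y c w"
    and T: "0 \<le> T" and e: "(2 + 6 / \<gamma>) * \<epsilon> < e" "(8 + 5 * \<gamma>) * \<epsilon> < e"
  shows "w \<in> skorohod_nbhd Z T e"
proof -
  interpret D: discrete_path n \<gamma> zn y by fact
  obtain \<theta> where \<theta>: "time_change \<theta>" and \<theta>_id: "\<And>t. 0 \<le> t \<Longrightarrow> \<bar>\<theta> t - t\<bar> < \<epsilon>"
    and close: "\<And>t. 0 \<le> t \<Longrightarrow> t \<le> T + 2 \<Longrightarrow> \<bar>y (\<theta> t) - x t\<bar> < \<epsilon>"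
    using y unfolding skorohod_nbhd_def by auto
  define \<delta> where "\<delta> = (2 + 6 / \<gamma>) * \<epsilon>"
  obtain \<Psi> where \<Psi>: "time_change \<Psi>" "\<And>t. 0 \<le> t \<Longrightarrow> (\<theta> \<circ> C) (\<Psi> t) = t" "\<And>t. 0 \<le> t \<Longrightarrow> \<Psi> ((\<theta> \<circ> C) t) = t"
    by (rule time_change_inverse[OF time_change_comp[OF time_change_C \<theta>]]) blast
  \<comment> \<open>The limiting time at which \<open>\<theta> \<circ> C\<close> passes j/n;
    \<open>a j\<close> is its discrete counterpart.\<close>
  define s where "s j = \<Psi> (real j / real n)" for j :: nat
  define a where "a j = real (D.hit j) / real n" for j
  have s_nonneg: "0 \<le> s j" for j unfolding s_def by (intro time_change_nonneg[OF \<Psi>(1)]) simp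
  have \<theta>Cs: "\<theta> (C (s j)) = real j / real n" for j using \<Psi>(2)[of "real j / real n"] unfolding s_def by simp
  have s_le: "s j \<le> t \<longleftrightarrow> real j / real n \<le> \<theta> (C t)" if "0 \<le> t" for j t
  proof -
    have "s j \<le> t \<longleftrightarrow> C (s j) \<le> C t" using time_change_le_iff[OF time_change_C s_nonneg that] by simp
    also have "\<dots> \<longleftrightarrow> \<theta> (C (s j)) \<le> \<theta> (C t)"
      using time_change_le_iff[OF \<theta> C_nonneg[OF s_nonneg] C_nonneg[OF that]] by simp
    finally show ?thesis unfolding \<theta>Cs .
  qed
  have s_mono: "strict_mono s" unfolding strict_mono_Suc_iff s_def
    using D.n by (auto intro!: time_change_less[OF \<Psi>(1)] divide_strict_right_mono)
  have s_zero: "s 0 = 0" unfolding s_def using time_change_zero[OF \<Psi>(1)] by simp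
  have s_unb: "\<exists>i. B < s i" for B
  proof -
    obtain i :: nat where i: "real n * \<theta> (C (max 0 B)) < real i" using reals_Archimedean2 by blast
    then have "\<not> real i / real n \<le> \<theta> (C (max 0 B))" using D.n by (simp add: field_simps not_le)
    then have "\<not> s i \<le> max 0 B" using s_le[of "max 0 B" i] by simp
    then have "max 0 B < s i" by (simp only: not_le)
    then show ?thesis by (intro exI[of _ i]) simp
  qed
  have est: "\<bar>a j - s j\<bar> \<le> \<delta>" if "C (s j) \<le> T + 2" for j
    unfolding a_def \<delta>_def using that
    by (intro clock_estimate[OF D \<theta> \<epsilon>(1) \<theta>_id close zn n s_nonneg]) (simp_all add: D.clock_hit \<theta>Cs)
  have a_mono: "strict_mono a" unfolding strict_mono_Suc_iff a_def
    using D.hit_strict_mono D.n by (auto intro!: divide_strict_right_mono simp: strict_mono_Suc_iff)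
  \<comment> \<open>The two grids can only be compared on a bounded window; past \<open>J\<close> the time change is a translation.\<close>
  obtain J where J: "real J \<le> real n * \<theta> (T + 1)" "real n * \<theta> (T + 1) < real J + 1"
    using scaled_cell[OF D.n time_change_nonneg[OF \<theta>, of "T + 1"]] T by auto
  have J': "real J / real n \<le> \<theta> (T + 1)" "\<theta> (T + 1) < real J / real n + 1 / real n"
    using J D.n by (simp_all add: field_simps)
  have "\<theta> (C (s j)) \<le> \<theta> (T + 1)" if "j \<le> J" for j
    unfolding \<theta>Cs using that J'(1) by (meson divide_right_mono of_nat_0_le_iff of_nat_mono order_trans)
  then have CsJ: "C (s j) \<le> T + 1" if "j \<le> J" for j
    using that time_change_le_iff[OF \<theta> C_nonneg[OF s_nonneg]] T by simp
  define r where "r j = (if j \<le> J then a j else a J + (s j - s J))" for j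
  have r_mono: "strict_mono r" unfolding strict_mono_Suc_iff
  proof
    fix j
    have "a j < a (Suc j)" "s j < s (Suc j)" using a_mono s_mono by (simp_all add: strict_mono_Suc_iff)
    then show "r j < r (Suc j)" unfolding r_def by (cases "j = J") auto
  qed
  have r_zero: "r 0 = 0" unfolding r_def a_def by (simp add: D.hit_zero)
  have r_close: "\<bar>r j - s j\<bar> \<le> \<delta>" for j
    using est[of j] est[of J] CsJ[of j] CsJ[of J] unfolding r_def by auto
  have r_unb: "\<exists>i. B < r i" for B
  proof -
    obtain i where "B + \<delta> < s i" using s_unb by blast
    then show ?thesis using r_close[of i] by (intro exI[of _ i]) linarith
  qed
  obtain \<mu> where \<mu>: "time_change \<mu>" "\<And>t. 0 \<le> t \<Longrightarrow> \<bar>\<mu> t - t\<bar> \<le> \<delta>"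
    "\<And>i t. s i \<le> t \<Longrightarrow> t < s (Suc i) \<Longrightarrow> r i \<le> \<mu> t \<and> \<mu> t < r (Suc i)"
    using time_change_between_sequences[OF s_mono s_zero s_unb r_mono r_zero r_unb r_close] by blast
  have "\<bar>w (\<mu> t) - Z t\<bar> < e" if t: "t \<in> {0..T}" for t
  proof -
    have t': "0 \<le> t" "t \<le> T" using t by auto
    have C': "0 \<le> C t" "C t \<le> t" using C_nonneg[OF t'(1)] C_le[OF t'(1)] .
    obtain j where j: "real j \<le> real n * \<theta> (C t)" "real n * \<theta> (C t) < real j + 1"
      using scaled_cell[OF D.n time_change_nonneg[OF \<theta> C'(1)]] .
    have j': "real j / real n \<le> \<theta> (C t)" "\<theta> (C t) < real (Suc j) / real n" "\<theta> (C t) < real j / real n + 1 / real n"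
      using j D.n by (simp_all add: field_simps)
    have "s j \<le> t" "t < s (Suc j)" using s_le[OF t'(1)] j' by (simp_all add: not_le[symmetric])
    then have rj: "r j \<le> \<mu> t" "\<mu> t < r (Suc j)" using \<mu>(3) by blast+
    \<comment> \<open>\<open>3 * \<epsilon> \<le> 1\<close> enters here:
      \<open>\<theta> (C t)\<close> is below T + \<epsilon> while J/n exceeds T + 1 - 2\<epsilon>,
      so \<open>t\<close> falls among the genuine hitting times.\<close>
    have "\<theta> (C t) < real J / real n"
      using \<theta>_id[OF C'(1)] \<theta>_id[of "T + 1"] J'(2) C' t' T n \<epsilon> by linarith
    then have "real j / real n < real J / real n" using j'(1) by linarith
    then have "j < J" using D.n by (simp add: divide_less_cancel)
    then have aj: "a j \<le> \<mu> t" "\<mu> t < a (Suc j)" using rj unfolding r_def by auto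
    have \<mu>0: "0 \<le> \<mu> t" using time_change_nonneg[OF \<mu>(1) t'(1)] .
    obtain k where k: "real k \<le> real n * \<mu> t" "real n * \<mu> t < real k + 1" using scaled_cell[OF D.n \<mu>0] .
    have "real (D.hit j) \<le> real n * \<mu> t" "real n * \<mu> t < real (D.hit (Suc j))"
      using aj D.n unfolding a_def by (simp_all add: field_simps)
    then have "D.hit j \<le> k" "k < D.hit (Suc j)" using k by linarith+
    then have \<kappa>: "D.\<kappa> k = j" by (rule D.clock_eq)
    have w: "w (\<mu> t) = zn + y (\<theta> (C t)) + \<gamma> * (real k / real n - real j / real n)"
      unfolding discretized_paths_grid(1)[OF D.n d k] \<kappa> discrete_height_def D.x_cell[OF j]
      by (simp add: algebra_simps)
    have kt: "real k / real n \<le> \<mu> t" "\<mu> t < real k / real n + 1 / real n"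
      using k D.n by (simp_all add: field_simps)
    \<comment> \<open>Four discrepancies: k/n against \<open>\<mu> t\<close> and j/n against
      \<open>\<theta> (C t)\<close>, each less than \<epsilon> by the mesh; \<open>\<theta>\<close>
      against the identity, \<epsilon>; \<open>\<mu>\<close> against the identity, \<delta>.\<close>
    have "\<bar>(real k / real n - real j / real n) - (t - C t)\<bar> \<le> 3 * \<epsilon> + \<delta>"
      using kt j' \<mu>(2)[OF t'(1)] \<theta>_id[OF C'(1)] n by linarith
    then have "\<bar>\<gamma> * ((real k / real n - real j / real n) - (t - C t))\<bar> \<le> \<gamma> * (3 * \<epsilon> + \<delta>)"
      using \<gamma> by (simp add: abs_mult)
    moreover have "\<gamma> * (3 * \<epsilon> + \<delta>) = 5 * \<gamma> * \<epsilon> + 6 * \<epsilon>" unfolding \<delta>_def using \<gamma> by (simp add: field_simps)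
    moreover have "w (\<mu> t) - Z t = (zn - z) + (y (\<theta> (C t)) - x (C t)) +
        \<gamma> * ((real k / real n - real j / real n) - (t - C t))"
      unfolding w Z_eq'[OF t'(1)] by (simp add: algebra_simps)
    moreover have "\<bar>y (\<theta> (C t)) - x (C t)\<bar> < \<epsilon>" using close[OF C'(1)] C' t' by simp
    moreover have "(8 + 5 * \<gamma>) * \<epsilon> = 8 * \<epsilon> + 5 * \<gamma> * \<epsilon>" by (simp add: algebra_simps)
    ultimately show ?thesis using zn e(2) by linarith
  qed
  moreover have "\<forall>t\<ge>0. \<bar>\<mu> t - t\<bar> < e" using \<mu>(2) e(1) unfolding \<delta>_def by force
  ultimately show ?thesis
    unfolding skorohod_nbhd_def using \<mu>(1) discretized_paths_cadlag[OF D.n d] by blast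
qed

text \<open>Quantifying over every grid path near \<open>x\<close>, rather than along one sequence,
  produces the hypothesis of the weak mapping theorem; the almost sure case specializes it.\<close>

lemma discretization_converges:
  assumes zs: "zs \<longlonglongrightarrow> z" "\<And>n. n \<ge> 1 \<Longrightarrow> 0 \<le> zs n" and e: "e > 0"
  shows "\<exists>S \<epsilon> m. 0 < \<epsilon> \<and> (\<forall>n\<ge>m. \<forall>y\<in>skorohod_nbhd x S \<epsilon>. \<forall>c w.
     grid_driver n y \<and> discretized_paths n \<gamma> (zs n) y c w \<longrightarrow>
       (\<forall>t\<in>{0..T}. \<bar>c t - C t\<bar> < e) \<and> w \<in> skorohod_nbhd Z T e)"
proof -
  define T' where "T' = max 0 T"
  \<comment> \<open>A sum of positive terms that dominates each of the three error
    constants.\<close>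
  define A where "A = (5 + 6 / \<gamma>) + (8 + 5 * \<gamma>)"
  have A: "0 < A" unfolding A_def using \<gamma> by (simp add: add_pos_pos)
  define \<epsilon> where "\<epsilon> = min (1/3) (e / (2 * A))"
  have \<epsilon>: "0 < \<epsilon>" "3 * \<epsilon> \<le> 1" "\<epsilon> \<le> 1" using e A unfolding \<epsilon>_def by auto
  have "\<epsilon> \<le> e / (2 * A)" unfolding \<epsilon>_def by simp
  then have "A * \<epsilon> \<le> e / 2" using A by (simp add: field_simps)
  then have "A * \<epsilon> < e" using e by linarith
  moreover have "(5 + 6 / \<gamma>) * \<epsilon> \<le> A * \<epsilon>" "(2 + 6 / \<gamma>) * \<epsilon> \<le> A * \<epsilon>" "(8 + 5 * \<gamma>) * \<epsilon> \<le> A * \<epsilon>"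
    unfolding A_def using \<gamma> \<epsilon>(1) by (intro mult_right_mono; simp)+
  ultimately have bounds: "(5 + 6 / \<gamma>) * \<epsilon> < e" "(2 + 6 / \<gamma>) * \<epsilon> < e" "(8 + 5 * \<gamma>) * \<epsilon> < e" by linarith+
  have "eventually (\<lambda>n. dist (zs n) z < \<epsilon>) sequentially" using zs(1) \<epsilon>(1) by (rule tendstoD)
  then obtain m0 where m0: "\<And>n. n \<ge> m0 \<Longrightarrow> \<bar>zs n - z\<bar> < \<epsilon>"
    unfolding eventually_sequentially dist_real_def by blast
  obtain m1 :: nat where m1: "1 / \<epsilon> < real m1" using reals_Archimedean2 by blast
  show ?thesis
  proof (intro exI conjI allI impI ballI)
    show "0 < \<epsilon>" by (rule \<epsilon>(1))
    fix n y c w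
    assume n: "max 1 (max m0 m1) \<le> n" and y: "y \<in> skorohod_nbhd x (T' + 2) \<epsilon>"
      and "grid_driver n y \<and> discretized_paths n \<gamma> (zs n) y c w"
    then have d: "discretized_paths n \<gamma> (zs n) y c w" and D: "discrete_path n \<gamma> (zs n) y"
      using \<gamma> zs(2) unfolding grid_driver_def by (auto intro!: discrete_path.intro)
    have "1 / \<epsilon> < real n" using m1 n by linarith
    then have n': "1 / real n < \<epsilon>" using \<epsilon>(1) n by (simp add: field_simps)
    have zn: "\<bar>zs n - z\<bar> < \<epsilon>" using m0 n by simp
    show "\<bar>c t - C t\<bar> < e" if "t \<in> {0..T}" for t
      using discretization_close_C[OF D y \<epsilon>(1,3) zn n' d, of t] that bounds(1) unfolding T'_def by simp
    have "w \<in> skorohod_nbhd Z T' e"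
      by (rule discretization_close_Z[OF D y \<epsilon>(1,2) zn n' d _ bounds(2,3)]) (simp add: T'_def)
    then show "w \<in> skorohod_nbhd Z T e" using skorohod_nbhd_mono[of T T' e e Z] unfolding T'_def by auto
  qed
qed

end

section \<open>From single paths to processes\<close>

lemma piecewise_constant_extension_grid:
  assumes "n > 0" "piecewise_constant_extension N n Y X" "\<omega> \<in> space N" "0 \<le> t"
  shows "X t \<omega> = X (grid_floor n t) \<omega>"
proof -
  obtain k where k: "real k \<le> real n * t" "real n * t < real k + 1" using scaled_cell[OF assms(1,4)] .
  let ?g = "real k / real n"
  have g: "grid_floor n t = ?g" using grid_floor_eq[OF assms(1) k] .
  have "real k \<le> real n * ?g" "real n * ?g < real k + 1" using assms(1) by auto
  then have "grid_floor n ?g = ?g" by (rule grid_floor_eq[OF assms(1)])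
  moreover have "X s \<omega> = Y (grid_floor n s) \<omega>" if "0 \<le> s" for s
    using assms(2,3) that unfolding piecewise_constant_extension_def by blast
  ultimately show ?thesis using assms(4) g by simp
qed

lemma AE_sticky_path:
  assumes "spectrally_positive_levy M X" "\<gamma> > 0" "0 \<le> z" "sticky_solution M X \<gamma> z Z C"
  shows "AE \<omega> in M. sticky_path (\<lambda>t. X t \<omega>) (\<lambda>t. Z t \<omega>) (\<lambda>t. C t \<omega>) \<gamma> z"
proof -
  have cX: "\<And>\<omega>. \<omega> \<in> space M \<Longrightarrow> cadlag (\<lambda>t. X t \<omega>)" and cZ: "\<And>\<omega>. \<omega> \<in> space M \<Longrightarrow> cadlag (\<lambda>t. Z t \<omega>)"
    using assms(1,4)
    unfolding spectrally_positive_levy_def levy_process_def sticky_solution_def cadlag_process_def by blast+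
  have "AE \<omega> in M. X 0 \<omega> = 0" "AE \<omega> in M. \<forall>t>0. left_lim (\<lambda>s. X s \<omega>) t \<le> X t \<omega>"
    using assms(1) unfolding spectrally_positive_levy_def levy_process_def by blast+
  moreover have "AE \<omega> in M. \<forall>t\<ge>0.
        Z t \<omega> = z + X (C t \<omega>) \<omega> + \<gamma> * (LBINT s:{0..t}. indicat_real {0} (Z s \<omega>)) \<and>
        C t \<omega> = (LBINT s:{0..t}. indicat_real {0<..} (Z s \<omega>))"
    using assms(4) unfolding sticky_solution_def by blast
  moreover have "AE \<omega> in M. cadlag (\<lambda>t. X t \<omega>) \<and> cadlag (\<lambda>t. Z t \<omega>)" using cX cZ by (intro AE_I2) blast
  ultimately show ?thesis
  proof eventually_elim
    case (elim \<omega>)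
    then show ?case using assms(2,3) by unfold_locales blast+
  qed
qed

lemma discrete_approximation_driver:
  assumes "n > 0" "discrete_approximation N n \<gamma> z X C Z"
  shows "AE \<omega> in N. grid_driver n (\<lambda>t. X t \<omega>) \<and> discretized_paths n \<gamma> z (\<lambda>t. X t \<omega>) (\<lambda>t. C t \<omega>) (\<lambda>t. Z t \<omega>)"
proof -
  obtain Y where Y: "piecewise_constant_extension N n Y X"
    using assms(2) unfolding discrete_approximation_def by blast
  have D: "\<And>\<omega>. \<omega> \<in> space N \<Longrightarrow> discretized_paths n \<gamma> z (\<lambda>t. X t \<omega>) (\<lambda>t. C t \<omega>) (\<lambda>t. Z t \<omega>)"
    using assms(2) unfolding discrete_approximation_def by blast
  have "AE \<omega> in N. X 0 \<omega> = 0" using assms(2) unfolding discrete_approximation_def by blast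
  then show ?thesis
  proof (rule AE_mp, intro AE_I2 impI conjI)
    fix \<omega> assume w: "\<omega> \<in> space N" "X 0 \<omega> = 0"
    show "grid_driver n (\<lambda>t. X t \<omega>)"
      unfolding grid_driver_def using w piecewise_constant_extension_grid[OF assms(1) Y w(1)] by blast
    show "discretized_paths n \<gamma> z (\<lambda>t. X t \<omega>) (\<lambda>t. C t \<omega>) (\<lambda>t. Z t \<omega>)" using D w(1) .
  qed
qed

lemma discrete_approximation_paths:
  assumes "n > 0" "discrete_approximation N n \<gamma> z X C Z"
  shows "prob_space N" "cadlag_process N X" "process N C" "cadlag_process N Z"
    "\<And>\<omega>. \<omega> \<in> space N \<Longrightarrow> continuous_on {0..} (\<lambda>t. C t \<omega>)"
proof -
  show "prob_space N" and X: "cadlag_process N X"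
    using assms(2) unfolding discrete_approximation_def by blast+
  have D: "\<And>\<omega>. \<omega> \<in> space N \<Longrightarrow> discretized_paths n \<gamma> z (\<lambda>t. X t \<omega>) (\<lambda>t. C t \<omega>) (\<lambda>t. Z t \<omega>)"
    using assms(2) unfolding discrete_approximation_def by blast
  have "process N X" using X unfolding cadlag_process_def by blast
  note proc = discretized_paths_process[OF assms(1) this D]
  show "process N C" by (rule proc(1))
  show "cadlag_process N Z"
    unfolding cadlag_process_def using proc(2) discretized_paths_cadlag[OF assms(1) D] by blast
  show "continuous_on {0..} (\<lambda>t. C t \<omega>)" if "\<omega> \<in> space N" for \<omega>
    by (rule discretized_paths_continuous[OF assms(1) D[OF that]])
qed

text \<open>\<open>T\<close> and \<open>e\<close> are quantified inside, so one null set serves all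
  windows and tolerances.\<close>

lemma AE_discretization_converges:
  assumes levy: "spectrally_positive_levy M X" and "\<gamma> > 0" and zs0: "\<forall>n\<ge>1. zs n \<ge> 0"
    and zs: "zs \<longlonglongrightarrow> z" and sol: "sticky_solution M X \<gamma> z Z C"
  shows "AE \<omega> in M. \<forall>T e. 0 < e \<longrightarrow> (\<exists>S \<epsilon> m. 0 < \<epsilon> \<and> (\<forall>n\<ge>m. \<forall>y\<in>skorohod_nbhd (\<lambda>t. X t \<omega>) S \<epsilon>. \<forall>c w.
     grid_driver n y \<and> discretized_paths n \<gamma> (zs n) y c w \<longrightarrow>
       (\<forall>t\<in>{0..T}. \<bar>c t - C t \<omega>\<bar> < e) \<and> w \<in> skorohod_nbhd (\<lambda>t. Z t \<omega>) T e))"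
proof -
  have z: "0 \<le> z" using zs zs0 by (intro LIMSEQ_le_const) auto
  from AE_sticky_path[OF levy \<open>\<gamma> > 0\<close> z sol] show ?thesis
  proof (eventually_elim, intro allI impI)
    fix \<omega> and T e :: real
    assume "sticky_path (\<lambda>t. X t \<omega>) (\<lambda>t. Z t \<omega>) (\<lambda>t. C t \<omega>) \<gamma> z" and e: "0 < e"
    from sticky_path.discretization_converges[OF this(1) zs zs0[rule_format] e, of T]
    show "\<exists>S \<epsilon> m. 0 < \<epsilon> \<and> (\<forall>n\<ge>m. \<forall>y\<in>skorohod_nbhd (\<lambda>t. X t \<omega>) S \<epsilon>. \<forall>c w.
       grid_driver n y \<and> discretized_paths n \<gamma> (zs n) y c w \<longrightarrow>
         (\<forall>t\<in>{0..T}. \<bar>c t - C t \<omega>\<bar> < e) \<and> w \<in> skorohod_nbhd (\<lambda>t. Z t \<omega>) T e)" .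
  qed
qed

text \<open>The two outputs are mapped separately; each relation quantifies the other output
  existentially, which is sound because the path estimate holds for every solution pair.\<close>

lemma weak_convergence_part:
  assumes levy: "spectrally_positive_levy M X" and "\<gamma> > 0" and zs0: "\<forall>n\<ge>1. zs n \<ge> 0"
    and zs: "zs \<longlonglongrightarrow> z" and sol: "sticky_solution M X \<gamma> z Z C"
    and approx: "\<forall>n\<ge>1. discrete_approximation (N n) n \<gamma> (zs n) (Xn n) (Cn n) (Zn n)"
    and weak: "weakly_converges skorohod_topology N Xn M X"
  shows "weakly_converges ucc_topology N Cn M C" "weakly_converges skorohod_topology N Zn M Z"
proof -
  have P: "prob_space M" and cX: "cadlag_process M X"
    using levy unfolding spectrally_positive_levy_def levy_process_def by blast+
  have cZ: "cadlag_process M Z" and pC: "process M C"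
    and cC: "\<And>\<omega>. \<omega> \<in> space M \<Longrightarrow> continuous_on {0..} (\<lambda>t. C t \<omega>)"
    using sol unfolding sticky_solution_def by blast+
  have A: "discrete_approximation (N n) n \<gamma> (zs n) (Xn n) (Cn n) (Zn n)" "0 < n" if "n \<ge> 1" for n
    using approx that by auto
  note DP = discrete_approximation_paths[OF A(2,1)]
  note DD = discrete_approximation_driver[OF A(2,1)]
  note conv = AE_discretization_converges[OF levy \<open>\<gamma> > 0\<close> zs0 zs sol]
  show "weakly_converges ucc_topology N Cn M C"
  proof (rule weak_mapping[where Q="\<lambda>n x c. grid_driver n x \<and> (\<exists>w. discretized_paths n \<gamma> (zs n) x c w)",
        OF P DP(1) weak cX DP(2)])
    show "AE \<omega> in N n. grid_driver n (\<lambda>t. Xn n t \<omega>) \<and>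
        (\<exists>w. discretized_paths n \<gamma> (zs n) (\<lambda>t. Xn n t \<omega>) (\<lambda>t. Cn n t \<omega>) w)" if "n \<ge> 1" for n
      using DD[OF that that] by eventually_elim blast
    show "AE \<omega> in M. \<forall>U. openin ucc_topology U \<and> (\<lambda>t. C t \<omega>) \<in> U \<longrightarrow>
       (\<exists>S \<epsilon> m. 0 < \<epsilon> \<and> (\<forall>n\<ge>m. \<forall>x\<in>skorohod_nbhd (\<lambda>t. X t \<omega>) S \<epsilon>. \<forall>y\<in>topspace ucc_topology.
          grid_driver n x \<and> (\<exists>w. discretized_paths n \<gamma> (zs n) x y w) \<longrightarrow> y \<in> U))"
      using conv
    proof (eventually_elim, intro allI impI)
      fix \<omega> U
      assume L: "\<forall>T e. 0 < e \<longrightarrow> (\<exists>S \<epsilon> m. 0 < \<epsilon> \<and> (\<forall>n\<ge>m. \<forall>y\<in>skorohod_nbhd (\<lambda>t. X t \<omega>) S \<epsilon>. \<forall>c w.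
         grid_driver n y \<and> discretized_paths n \<gamma> (zs n) y c w \<longrightarrow>
           (\<forall>t\<in>{0..T}. \<bar>c t - C t \<omega>\<bar> < e) \<and> w \<in> skorohod_nbhd (\<lambda>t. Z t \<omega>) T e))"
        and "openin ucc_topology U \<and> (\<lambda>t. C t \<omega>) \<in> U"
      then obtain T e where e: "0 < e" "ucc_nbhd (\<lambda>t. C t \<omega>) T e \<subseteq> U" unfolding openin_ucc by blast
      obtain S \<epsilon> m where S: "0 < \<epsilon>"
        and H: "\<forall>n\<ge>m. \<forall>y\<in>skorohod_nbhd (\<lambda>t. X t \<omega>) S \<epsilon>. \<forall>c w.
          grid_driver n y \<and> discretized_paths n \<gamma> (zs n) y c w \<longrightarrow>
             (\<forall>t\<in>{0..T}. \<bar>c t - C t \<omega>\<bar> < e) \<and> w \<in> skorohod_nbhd (\<lambda>t. Z t \<omega>) T e"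
        using L[rule_format, OF e(1), of T] by (elim exE conjE)
      show "\<exists>S \<epsilon> m. 0 < \<epsilon> \<and> (\<forall>n\<ge>m. \<forall>x\<in>skorohod_nbhd (\<lambda>t. X t \<omega>) S \<epsilon>.
          \<forall>y\<in>topspace ucc_topology. grid_driver n x \<and> (\<exists>w. discretized_paths n \<gamma> (zs n) x y w) \<longrightarrow> y \<in> U)"
      proof (intro exI conjI allI impI ballI)
        show "0 < \<epsilon>" by (rule S)
        fix n x c
        assume n: "m \<le> n" "x \<in> skorohod_nbhd (\<lambda>t. X t \<omega>) S \<epsilon>"
          and c: "c \<in> topspace ucc_topology"
          and G: "grid_driver n x \<and> (\<exists>w. discretized_paths n \<gamma> (zs n) x c w)"
        from G obtain w where w: "grid_driver n x \<and> discretized_paths n \<gamma> (zs n) x c w" by blast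
        have "\<forall>t\<in>{0..T}. \<bar>c t - C t \<omega>\<bar> < e" using H[rule_format, OF n w] by simp
        then have "c \<in> ucc_nbhd (\<lambda>t. C t \<omega>) T e" using c unfolding ucc_nbhd_def topspace_ucc by simp
        then show "c \<in> U" using e(2) by blast
      qed
    qed
  qed (use cC DP(5) ucc_functional_measurable[OF _ pC cC] ucc_functional_measurable[OF _ DP(3,5)] in
      \<open>simp_all add: topspace_ucc\<close>)
  show "weakly_converges skorohod_topology N Zn M Z"
  proof (rule weak_mapping[where Q="\<lambda>n x w. grid_driver n x \<and> (\<exists>c. discretized_paths n \<gamma> (zs n) x c w)",
        OF P DP(1) weak cX DP(2)])
    show "AE \<omega> in N n. grid_driver n (\<lambda>t. Xn n t \<omega>) \<and>
        (\<exists>c. discretized_paths n \<gamma> (zs n) (\<lambda>t. Xn n t \<omega>) c (\<lambda>t. Zn n t \<omega>))" if "n \<ge> 1" for n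
      using DD[OF that that] by eventually_elim blast
    show "AE \<omega> in M. \<forall>U. openin skorohod_topology U \<and> (\<lambda>t. Z t \<omega>) \<in> U \<longrightarrow>
       (\<exists>S \<epsilon> m. 0 < \<epsilon> \<and> (\<forall>n\<ge>m. \<forall>x\<in>skorohod_nbhd (\<lambda>t. X t \<omega>) S \<epsilon>. \<forall>y\<in>topspace skorohod_topology.
          grid_driver n x \<and> (\<exists>c. discretized_paths n \<gamma> (zs n) x c y) \<longrightarrow> y \<in> U))"
      using conv
    proof (eventually_elim, intro allI impI)
      fix \<omega> U
      assume L: "\<forall>T e. 0 < e \<longrightarrow> (\<exists>S \<epsilon> m. 0 < \<epsilon> \<and> (\<forall>n\<ge>m. \<forall>y\<in>skorohod_nbhd (\<lambda>t. X t \<omega>) S \<epsilon>. \<forall>c w.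
         grid_driver n y \<and> discretized_paths n \<gamma> (zs n) y c w \<longrightarrow>
           (\<forall>t\<in>{0..T}. \<bar>c t - C t \<omega>\<bar> < e) \<and> w \<in> skorohod_nbhd (\<lambda>t. Z t \<omega>) T e))"
        and "openin skorohod_topology U \<and> (\<lambda>t. Z t \<omega>) \<in> U"
      then obtain T e where e: "0 < e" "skorohod_nbhd (\<lambda>t. Z t \<omega>) T e \<subseteq> U" unfolding openin_skorohod by blast
      obtain S \<epsilon> m where S: "0 < \<epsilon>"
        and H: "\<forall>n\<ge>m. \<forall>y\<in>skorohod_nbhd (\<lambda>t. X t \<omega>) S \<epsilon>. \<forall>c w.
          grid_driver n y \<and> discretized_paths n \<gamma> (zs n) y c w \<longrightarrow>
             (\<forall>t\<in>{0..T}. \<bar>c t - C t \<omega>\<bar> < e) \<and> w \<in> skorohod_nbhd (\<lambda>t. Z t \<omega>) T e"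
        using L[rule_format, OF e(1), of T] by (elim exE conjE)
      show "\<exists>S \<epsilon> m. 0 < \<epsilon> \<and> (\<forall>n\<ge>m. \<forall>x\<in>skorohod_nbhd (\<lambda>t. X t \<omega>) S \<epsilon>.
          \<forall>y\<in>topspace skorohod_topology. grid_driver n x \<and> (\<exists>c. discretized_paths n \<gamma> (zs n) x c y) \<longrightarrow> y \<in> U)"
      proof (intro exI conjI allI impI ballI)
        show "0 < \<epsilon>" by (rule S)
        fix n x w
        assume n: "m \<le> n" "x \<in> skorohod_nbhd (\<lambda>t. X t \<omega>) S \<epsilon>"
          and G: "grid_driver n x \<and> (\<exists>c. discretized_paths n \<gamma> (zs n) x c w)"
        from G obtain c where c: "grid_driver n x \<and> discretized_paths n \<gamma> (zs n) x c w" by blast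
        have "w \<in> skorohod_nbhd (\<lambda>t. Z t \<omega>) T e" using H[rule_format, OF n c] by simp
        then show "w \<in> U" using e(2) by blast
      qed
    qed
  qed (use cZ DP(4) skorohod_functional_measurable[OF _ cZ] skorohod_functional_measurable[OF _ DP(4)] in
      \<open>simp_all add: topspace_skorohod cadlag_process_def\<close>)
qed

lemma almost_sure_convergence_part:
  assumes levy: "spectrally_positive_levy M X" and "\<gamma> > 0" and zs0: "\<forall>n\<ge>1. zs n \<ge> 0"
    and zs: "zs \<longlonglongrightarrow> z" and sol: "sticky_solution M X \<gamma> z Z C"
    and approx: "\<forall>n\<ge>1. discrete_approximation M n \<gamma> (zs n) (Xn n) (Cn n) (Zn n)"
    and conv: "AE \<omega> in M. limitin skorohod_topology (\<lambda>n t. Xn n t \<omega>) (\<lambda>t. X t \<omega>) sequentially"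
  shows "AE \<omega> in M. (\<forall>T. uniform_limit {0..T} (\<lambda>n t. Cn n t \<omega>) (\<lambda>t. C t \<omega>) sequentially) \<and>
     limitin skorohod_topology (\<lambda>n t. Zn n t \<omega>) (\<lambda>t. Z t \<omega>) sequentially"
proof -
  \<comment> \<open>The guard keeps the statement total in \<open>n\<close>, nothing being known at
    index 0, so that countably many null sets can be joined.\<close>
  have "AE \<omega> in M. n \<ge> 1 \<longrightarrow> grid_driver n (\<lambda>t. Xn n t \<omega>) \<and>
      discretized_paths n \<gamma> (zs n) (\<lambda>t. Xn n t \<omega>) (\<lambda>t. Cn n t \<omega>) (\<lambda>t. Zn n t \<omega>)" for n
  proof (cases "n \<ge> 1")
    case True
    then have "AE \<omega> in M. grid_driver n (\<lambda>t. Xn n t \<omega>) \<and>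
        discretized_paths n \<gamma> (zs n) (\<lambda>t. Xn n t \<omega>) (\<lambda>t. Cn n t \<omega>) (\<lambda>t. Zn n t \<omega>)"
      using approx by (intro discrete_approximation_driver) auto
    then show ?thesis by eventually_elim simp
  qed simp
  then have "AE \<omega> in M. \<forall>n. n \<ge> 1 \<longrightarrow> grid_driver n (\<lambda>t. Xn n t \<omega>) \<and>
      discretized_paths n \<gamma> (zs n) (\<lambda>t. Xn n t \<omega>) (\<lambda>t. Cn n t \<omega>) (\<lambda>t. Zn n t \<omega>)"
    by (simp add: AE_all_countable)
  moreover have "AE \<omega> in M. cadlag (\<lambda>t. Z t \<omega>)"
    using sol unfolding sticky_solution_def cadlag_process_def by (intro AE_I2) blast
  ultimately show ?thesis using conv AE_discretization_converges[OF levy \<open>\<gamma> > 0\<close> zs0 zs sol]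
  proof eventually_elim
    case (elim \<omega>)
    have close: "eventually (\<lambda>n. (\<forall>t\<in>{0..T}. \<bar>Cn n t \<omega> - C t \<omega>\<bar> < e) \<and>
        (\<lambda>t. Zn n t \<omega>) \<in> skorohod_nbhd (\<lambda>t. Z t \<omega>) T e) sequentially" if e: "e > 0" for T e
    proof -
      obtain S \<epsilon> m where S: "0 < \<epsilon>" "\<forall>n\<ge>m. \<forall>y\<in>skorohod_nbhd (\<lambda>t. X t \<omega>) S \<epsilon>. \<forall>c w.
         grid_driver n y \<and> discretized_paths n \<gamma> (zs n) y c w \<longrightarrow>
           (\<forall>t\<in>{0..T}. \<bar>c t - C t \<omega>\<bar> < e) \<and> w \<in> skorohod_nbhd (\<lambda>t. Z t \<omega>) T e"
        using elim(4)[rule_format, OF e, of T] by (elim exE conjE)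
      have "eventually (\<lambda>n. (\<lambda>t. Xn n t \<omega>) \<in> skorohod_nbhd (\<lambda>t. X t \<omega>) S \<epsilon>) sequentially"
        using elim(3) S(1) unfolding limitin_skorohod by blast
      then show ?thesis using eventually_ge_at_top[of "max 1 m"]
      proof eventually_elim
        case n: (elim n)
        then have "m \<le> n" "1 \<le> n" by simp_all
        from S(2)[rule_format, OF this(1) n(1) elim(1)[rule_format, OF this(2)]] show ?case .
      qed
    qed
    have "uniform_limit {0..T} (\<lambda>n t. Cn n t \<omega>) (\<lambda>t. C t \<omega>) sequentially" for T
      unfolding uniform_limit_iff dist_real_def
    proof (intro allI impI)
      fix e :: real assume "e > 0"
      from close[OF this, of T] show "eventually (\<lambda>n. \<forall>t\<in>{0..T}. \<bar>Cn n t \<omega> - C t \<omega>\<bar> < e) sequentially"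
        by eventually_elim blast
    qed
    moreover have "limitin skorohod_topology (\<lambda>n t. Zn n t \<omega>) (\<lambda>t. Z t \<omega>) sequentially"
      unfolding limitin_skorohod
    proof (intro conjI elim(2) allI impI)
      fix T e :: real assume "e > 0"
      from close[OF this, of T] show "eventually (\<lambda>n. (\<lambda>t. Zn n t \<omega>) \<in> skorohod_nbhd (\<lambda>t. Z t \<omega>) T e) sequentially"
        by eventually_elim blast
    qed
    ultimately show ?case by blast
  qed
qed

theorem theorem2:
  fixes M :: "'a measure" and X Z C :: "real \<Rightarrow> 'a \<Rightarrow> real"
    and \<gamma> z :: real and zs :: "nat \<Rightarrow> real"
  assumes "spectrally_positive_levy M X"
    and "unbounded_variation_paths M X"
    and "\<gamma> > 0"
    and "\<forall>n\<ge>1. zs n \<ge> 0"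
    and "zs \<longlonglongrightarrow> z"
    and "sticky_solution M X \<gamma> z Z C"
  shows
    "(\<forall>(N :: nat \<Rightarrow> 'b measure) Xn Cn Zn.
        (\<forall>n\<ge>1. discrete_approximation (N n) n \<gamma> (zs n) (Xn n) (Cn n) (Zn n)) \<and>
        weakly_converges skorohod_topology N Xn M X \<longrightarrow>
          weakly_converges ucc_topology N Cn M C \<and>
          weakly_converges skorohod_topology N Zn M Z) \<and>
     (\<forall>Xn Cn Zn.
        (\<forall>n\<ge>1. discrete_approximation M n \<gamma> (zs n) (Xn n) (Cn n) (Zn n)) \<and>
        (AE \<omega> in M. limitin skorohod_topology (\<lambda>n t. Xn n t \<omega>) (\<lambda>t. X t \<omega>) sequentially) \<longrightarrow>
          (AE \<omega> in M.
             (\<forall>T. uniform_limit {0..T} (\<lambda>n t. Cn n t \<omega>) (\<lambda>t. C t \<omega>) sequentially) \<and>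
             limitin skorohod_topology (\<lambda>n t. Zn n t \<omega>) (\<lambda>t. Z t \<omega>) sequentially))"
  using weak_convergence_part[OF assms(1,3-6)] almost_sure_convergence_part[OF assms(1,3-6)] by blast

end
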